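(* Let $(G,\Sigma)$ be a plane graph. If $G$ is $5$-critical, then $(G,\Sigma)$ has a $3$-face which is adjacent to a $3$-face or to a $4$-face.
   Context: All graphs are finite and simple. $\Delta(G)$ denotes the maximum vertex-degree of $G$. A plane graph $(G,\Sigma)$ is a planar graph $G$ together with an embedding $\Sigma$ of $G$ into the Euclidean plane; its faces (including the unbounded one) form the set $F(G)$. The degree of a face is the length of its facial circuit, and a $k$-face is a face of degree $k$. Two distinct faces are adjacent if their boundaries share an edge. The edge-chromatic number $\chi'(G)$ is the minimum $k$ such that $G$ admits a proper $k$-edge-coloring. By Vizing's theorem, $\chi'(G)\in\{\Delta(G),\Delta(G)+1\}$; $G$ is a class 1 graph if $\chi'(G)=\Delta(G)$, and a class 2 graph otherwise. A class 2 graph $H$ is $k$-critical if $\Delta(H)=k$ and $\chi'(H')<\chi'(H)$ for every proper subgraph $H'$ of $H$. *)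

theory Defs
  imports "HOL-Analysis.Analysis"
begin

datatype 'a graph = Graph (verts: "'a set") (edges: "'a set set")

definition simple_graph :: "'a graph \<Rightarrow> bool" where
  "simple_graph G \<longleftrightarrow>
     finite (verts G) \<and> (\<forall>e\<in>edges G. e \<subseteq> verts G \<and> card e = 2)"

definition subgraph :: "'a graph \<Rightarrow> 'a graph \<Rightarrow> bool" where
  "subgraph H G \<longleftrightarrow>
     simple_graph H \<and> verts H \<subseteq> verts G \<and> edges H \<subseteq> edges G"

definition proper_subgraph :: "'a graph \<Rightarrow> 'a graph \<Rightarrow> bool" where
  "proper_subgraph H G \<longleftrightarrow> subgraph H G \<and> H \<noteq> G"

definition vertex_degree :: "'a graph \<Rightarrow> 'a \<Rightarrow> nat" where
  "vertex_degree G v = card {e \<in> edges G. v \<in> e}"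

text \<open>Inserting 0 only matters for the graph without vertices, whose maximum degree
  would otherwise be the unspecified maximum of the empty set.\<close>

definition max_degree :: "'a graph \<Rightarrow> nat" where
  "max_degree G = Max (insert 0 (vertex_degree G ` verts G))"

definition proper_edge_colouring :: "'a graph \<Rightarrow> nat \<Rightarrow> ('a set \<Rightarrow> nat) \<Rightarrow> bool" where
  "proper_edge_colouring G k c \<longleftrightarrow>
     c ` edges G \<subseteq> {..<k} \<and>
     (\<forall>e\<in>edges G. \<forall>e'\<in>edges G. e \<noteq> e' \<and> e \<inter> e' \<noteq> {} \<longrightarrow> c e \<noteq> c e')"

definition edge_chromatic_number :: "'a graph \<Rightarrow> nat" where
  "edge_chromatic_number G = (LEAST k. \<exists>c. proper_edge_colouring G k c)"

definition class1 :: "'a graph \<Rightarrow> bool" where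
  "class1 G \<longleftrightarrow> edge_chromatic_number G = max_degree G"

definition class2 :: "'a graph \<Rightarrow> bool" where
  "class2 G \<longleftrightarrow> \<not> class1 G"

definition critical :: "nat \<Rightarrow> 'a graph \<Rightarrow> bool" where
  "critical k G \<longleftrightarrow>
     simple_graph G \<and> class2 G \<and> max_degree G = k \<and>
     (\<forall>H. proper_subgraph H G \<longrightarrow> edge_chromatic_number H < edge_chromatic_number G)"

text \<open>The Euclidean plane is \<^typ>\<open>complex\<close>, where the library states its planar topology
  (Jordan curve theorem etc.). An embedding gives a point for each vertex and a
  (continuous, injective) arc for each edge; values outside the graph are irrelevant.\<close>

datatype 'a embedding =
  Embedding (point: "'a \<Rightarrow> complex") (curve: "'a set \<Rightarrow> real \<Rightarrow> complex")

definition plane_graph :: "'a graph \<Rightarrow> 'a embedding \<Rightarrow> bool" where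
  "plane_graph G S \<longleftrightarrow>
     simple_graph G \<and>
     inj_on (point S) (verts G) \<and>
     (\<forall>e\<in>edges G.
        arc (curve S e) \<and>
        {pathstart (curve S e), pathfinish (curve S e)} = point S ` e \<and>
        path_image (curve S e) \<inter> point S ` verts G = point S ` e) \<and>
     (\<forall>e\<in>edges G. \<forall>e'\<in>edges G. e \<noteq> e' \<longrightarrow>
        path_image (curve S e) \<inter> path_image (curve S e') = point S ` (e \<inter> e'))"

definition drawing :: "'a graph \<Rightarrow> 'a embedding \<Rightarrow> complex set" where
  "drawing G S = point S ` verts G \<union> (\<Union>e\<in>edges G. path_image (curve S e))"

definition faces :: "'a graph \<Rightarrow> 'a embedding \<Rightarrow> complex set set" where
  "faces G S = components (- drawing G S)"

definition circuit_edges :: "'a list \<Rightarrow> 'a set set" where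
  "circuit_edges C = {{C ! i, C ! (Suc i mod length C)} | i. i < length C}"

definition circuit :: "'a graph \<Rightarrow> 'a list \<Rightarrow> bool" where
  "circuit G C \<longleftrightarrow> 3 \<le> length C \<and> distinct C \<and> circuit_edges C \<subseteq> edges G"

definition facial_circuit :: "'a graph \<Rightarrow> 'a embedding \<Rightarrow> complex set \<Rightarrow> 'a list \<Rightarrow> bool" where
  "facial_circuit G S f C \<longleftrightarrow>
     circuit G C \<and> frontier f = (\<Union>e\<in>circuit_edges C. path_image (curve S e))"

text \<open>The degree of a face is the length of its facial circuit. It is a relation because a face
  whose boundary is not a circuit, which can occur only in plane graphs that are not
  2-connected, has no facial circuit; such a face is not a \<open>k\<close>-face for any \<open>k\<close>. Otherwise
  the boundary determines the edge set of the circuit and hence \<open>k\<close>.\<close>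

definition k_face :: "'a graph \<Rightarrow> 'a embedding \<Rightarrow> nat \<Rightarrow> complex set \<Rightarrow> bool" where
  "k_face G S k f \<longleftrightarrow> f \<in> faces G S \<and> (\<exists>C. facial_circuit G S f C \<and> length C = k)"

definition adjacent_faces :: "'a graph \<Rightarrow> 'a embedding \<Rightarrow> complex set \<Rightarrow> complex set \<Rightarrow> bool" where
  "adjacent_faces G S f g \<longleftrightarrow>
     f \<in> faces G S \<and> g \<in> faces G S \<and> f \<noteq> g \<and>
     (\<exists>e\<in>edges G. path_image (curve S e) \<subseteq> frontier f \<and> path_image (curve S e) \<subseteq> frontier g)"

end

(* Give every vertex and every face x the charge d(x) - 4; by Euler's formula the total is -8. Suppose that
   no 3-face is adjacent to a 3-face or 4-face, and spread the charge of each face evenly over its edges.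
   An edge receives -1/3 from a 3-face and at least 1/5 from a face of degree at least 5, so an edge of a
   3-face gets at least -2/15 in total and any other edge a nonnegative amount. Passing this on in halves
   to the ends of the edge leaves at least 26/30 at a vertex of degree 5 and at least -8/30, -1, -64/30 at
   vertices of degree 4, 3, 2. Vizing's adjacency lemma, and the fact that two adjacent vertices of degree 5
   do not have different neighbours of degree 2, permit the vertices of degree 5 to compensate the others,
   which contradicts the negative total.

   Euler's formula and the facial circuits are obtained by adding ears to a circuit. An ear is a cross-cut
   of a face bounded by a closed curve, and it splits that face in two because a theta curve has exactly three
   complementary components, by the Jordan curve theorem and Janiszewski's theorem. Ears exist because a
   critical graph has no cut vertex. *)
theory Submission
  imports Defs
begin

section \<open>Edge colourings of edge sets and swaps along two-coloured chains\<close>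

section \<open>Kempe changes\<close>

text \<open>Three obstacles shape the proof. A face counts as a \<open>k\<close>-face only if its
  frontier is a circuit, so besides Euler's formula one needs that every face is bounded by a
  circuit and that every edge lies on exactly two faces. These facts are carried together through
  the ear additions, because the circuit around a face is what turns the next ear into a cross-cut.
  Bounding every edge separately would leave only 20/30 at a vertex of degree 5. Two observations
  restore 26/30: the number of edges at a vertex that lie on 3-faces is even, and a lone edge off
  the 3-faces lies between two faces of degree at least 5. A vertex of degree 2 may lack 64/30, and
  its two neighbours, of degree 5, may own only 26/30 each. The adjacency lemma gives each of them
  four neighbours of degree 5, but these could be just as poor. Hence adjacent vertices of degree 5
  with different neighbours of degree 2 have to be excluded, which takes Kempe changes of its
  own.\<close>

definition pec :: "'a set set \<Rightarrow> nat \<Rightarrow> ('a set \<Rightarrow> nat) \<Rightarrow> bool" where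
  "pec E k c \<longleftrightarrow> c ` E \<subseteq> {..<k} \<and> (\<forall>e\<in>E. \<forall>e'\<in>E. e \<noteq> e' \<and> e \<inter> e' \<noteq> {} \<longrightarrow> c e \<noteq> c e')"

definition colourable :: "nat \<Rightarrow> 'a set set \<Rightarrow> bool" where
  "colourable k E \<longleftrightarrow> (\<exists>c. pec E k c)"

definition edge_set :: "'a set set \<Rightarrow> bool" where
  "edge_set E \<longleftrightarrow> finite E \<and> (\<forall>e\<in>E. card e = 2)"

definition deg :: "'a set set \<Rightarrow> 'a \<Rightarrow> nat" where
  "deg E v = card {e\<in>E. v \<in> e}"

definition missing :: "'a set set \<Rightarrow> nat \<Rightarrow> ('a set \<Rightarrow> nat) \<Rightarrow> 'a \<Rightarrow> nat set" where
  "missing E k c v = {i. i < k \<and> (\<forall>e\<in>E. v \<in> e \<longrightarrow> c e \<noteq> i)}"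

lemma pecD: "pec E k c \<Longrightarrow> e \<in> E \<Longrightarrow> e' \<in> E \<Longrightarrow> v \<in> e \<Longrightarrow> v \<in> e' \<Longrightarrow> c e = c e' \<Longrightarrow> e = e'"
  unfolding pec_def by blast

lemma pec_range: "pec E k c \<Longrightarrow> e \<in> E \<Longrightarrow> c e < k"
  unfolding pec_def by blast

lemma pecI:
  assumes "\<And>e. e \<in> E \<Longrightarrow> c e < k"
    and "\<And>e e' v. e \<in> E \<Longrightarrow> e' \<in> E \<Longrightarrow> v \<in> e \<Longrightarrow> v \<in> e' \<Longrightarrow> c e = c e' \<Longrightarrow> e = e'"
  shows "pec E k c"
  unfolding pec_def
proof (intro conjI ballI impI subsetI)
  fix i assume "i \<in> c ` E"
  then show "i \<in> {..<k}" using assms(1) by auto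
next
  fix e e' assume *: "e \<in> E" "e' \<in> E" "e \<noteq> e' \<and> e \<inter> e' \<noteq> {}"
  then obtain v where "v \<in> e" "v \<in> e'" by blast
  then show "c e \<noteq> c e'" using assms(2) * by metis
qed

lemma pec_subset:
  assumes "pec E k c" "E' \<subseteq> E"
  shows "pec E' k c"
proof (rule pecI)
  show "c e < k" if "e \<in> E'" for e using that pec_range assms by blast
  show "e = e'" if "e \<in> E'" "e' \<in> E'" "v \<in> e" "v \<in> e'" "c e = c e'" for e e' v
    by (rule pecD[OF assms(1) _ _ that(3-5)]) (use that assms in auto)
qed

lemma edge_set_subset: "edge_set E \<Longrightarrow> E' \<subseteq> E \<Longrightarrow> edge_set E'"
  unfolding edge_set_def using finite_subset[of E' E] by auto

lemma edge_setE:
  assumes "edge_set E" "e \<in> E" "v \<in> e"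
  obtains u where "e = {v, u}" "u \<noteq> v"
proof -
  obtain p q where "e = {p, q}" "p \<noteq> q"
    using assms unfolding edge_set_def by (metis card_2_iff)
  then show thesis using assms(3) that by fastforce
qed

lemma edge_set_neq: "edge_set E \<Longrightarrow> {u, v} \<in> E \<Longrightarrow> u \<noteq> v"
  unfolding edge_set_def by fastforce

lemma finite_edge_set: "edge_set E \<Longrightarrow> finite E"
  unfolding edge_set_def by blast

lemma finite_missing [simp]: "finite (missing E k c v)"
  unfolding missing_def by simp

lemma card_missing:
  assumes "pec E k c" "finite E"
  shows "card (missing E k c v) + deg E v = k"
proof -
  have inj: "inj_on c {e\<in>E. v \<in> e}"
    by (rule inj_onI) (use assms(1) pecD in fastforce)
  have sub: "c ` {e\<in>E. v \<in> e} \<subseteq> {..<k}"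
    using assms(1) pec_range by fastforce
  have "missing E k c v = {..<k} - c ` {e\<in>E. v \<in> e}"
    unfolding missing_def by auto
  then have "card (missing E k c v) = k - deg E v"
    using card_Diff_subset[OF _ sub] card_image[OF inj] assms(2) by (simp add: deg_def)
  moreover have "deg E v \<le> k"
    using card_mono[OF _ sub] card_image[OF inj] by (simp add: deg_def)
  ultimately show ?thesis by simp
qed

text \<open>In a proper colouring every vertex has at most two \<open>kadj\<close> neighbours, so
  the classes of \<open>linked\<close> are paths and cycles: the Kempe chains of the colours
  \<open>a\<close> and \<open>b\<close>.\<close>

definition kadj :: "'a set set \<Rightarrow> ('a set \<Rightarrow> nat) \<Rightarrow> nat \<Rightarrow> nat \<Rightarrow> 'a \<Rightarrow> 'a \<Rightarrow> bool" where
  "kadj E c a b p q \<longleftrightarrow> {p, q} \<in> E \<and> c {p, q} \<in> {a, b}"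

definition linked :: "'a set set \<Rightarrow> ('a set \<Rightarrow> nat) \<Rightarrow> nat \<Rightarrow> nat \<Rightarrow> 'a \<Rightarrow> 'a \<Rightarrow> bool" where
  "linked E c a b = (kadj E c a b)\<^sup>*\<^sup>*"

definition flip :: "nat \<Rightarrow> nat \<Rightarrow> nat \<Rightarrow> nat" where
  "flip a b i = (if i = a then b else if i = b then a else i)"

definition kswap :: "'a set set \<Rightarrow> ('a set \<Rightarrow> nat) \<Rightarrow> nat \<Rightarrow> nat \<Rightarrow> 'a \<Rightarrow> 'a set \<Rightarrow> nat" where
  "kswap E c a b u e = (if \<exists>v\<in>e. linked E c a b u v then flip a b (c e) else c e)"

lemma flip_eq_iff [simp]: "flip a b i = flip a b j \<longleftrightarrow> i = j"
  by (auto simp: flip_def)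

lemma eq_flip_iff: "i = flip a b j \<longleftrightarrow> flip a b i = j"
  by (auto simp: flip_def)

lemma flip_less: "a < k \<Longrightarrow> b < k \<Longrightarrow> i < k \<Longrightarrow> flip a b i < k"
  by (simp add: flip_def)

lemma flip_less_iff: "a < k \<Longrightarrow> b < k \<Longrightarrow> flip a b i < k \<longleftrightarrow> i < k"
  by (auto simp add: flip_def)

lemma linked_refl [simp]: "linked E c a b u u"
  by (simp add: linked_def)

lemma linked_sym: "linked E c a b u v \<Longrightarrow> linked E c a b v u"
proof -
  have "symp (kadj E c a b)"
    by (auto simp: symp_def kadj_def insert_commute)
  then show "linked E c a b u v \<Longrightarrow> linked E c a b v u"
    unfolding linked_def by (metis sympD symp_rtranclp)
qed

lemma linked_trans: "linked E c a b u v \<Longrightarrow> linked E c a b v w \<Longrightarrow> linked E c a b u w"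
  by (simp add: linked_def)

text \<open>It does not matter which end of an edge is tested: the two ends of an edge coloured
  \<open>a\<close> or \<open>b\<close> are linked to each other, and \<open>flip\<close> fixes every
  other colour.\<close>

lemma kswap_at:
  assumes "edge_set E" "e \<in> E" "v \<in> e"
  shows "kswap E c a b u e = (if linked E c a b u v then flip a b (c e) else c e)"
proof (cases "c e \<in> {a, b}")
  case True
  obtain w where e: "e = {v, w}" using edge_setE assms by metis
  have "linked E c a b v w"
    unfolding linked_def using True assms e by (auto simp: kadj_def)
  then have "linked E c a b u v \<longleftrightarrow> linked E c a b u w"
    by (meson linked_trans linked_sym)
  then show ?thesis by (auto simp: kswap_def e)
next
  case False
  then show ?thesis by (auto simp: kswap_def flip_def)
qed

lemma pec_kswap:
  assumes "edge_set E" "pec E k c" "a < k" "b < k"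
  shows "pec E k (kswap E c a b u)"
proof (rule pecI)
  fix e assume "e \<in> E"
  then show "kswap E c a b u e < k"
    using flip_less[OF assms(3,4)] pec_range[OF assms(2)] by (simp add: kswap_def)
next
  fix e e' v assume *: "e \<in> E" "e' \<in> E" "v \<in> e" "v \<in> e'" "kswap E c a b u e = kswap E c a b u e'"
  then have "c e = c e'"
    using kswap_at[OF assms(1) *(1) *(3), of c a b u] kswap_at[OF assms(1) *(2) *(4), of c a b u]
    by (metis flip_eq_iff)
  then show "e = e'" using pecD[OF assms(2)] * by blast
qed

lemma missing_kswap:
  assumes "edge_set E" "a < k" "b < k"
  shows "missing E k (kswap E c a b u) v =
    (if linked E c a b u v then flip a b ` missing E k c v else missing E k c v)"
proof (cases "linked E c a b u v")
  case True
  have "i \<in> missing E k (kswap E c a b u) v \<longleftrightarrow> i \<in> flip a b ` missing E k c v" for i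
  proof -
    have "i \<in> flip a b ` missing E k c v \<longleftrightarrow> flip a b i \<in> missing E k c v"
      by (auto simp: image_iff eq_flip_iff)
    also have "\<dots> \<longleftrightarrow> i < k \<and> (\<forall>e\<in>E. v \<in> e \<longrightarrow> flip a b (c e) \<noteq> i)"
      by (simp add: missing_def flip_less_iff[OF assms(2,3)] eq_flip_iff)
    also have "\<dots> \<longleftrightarrow> i \<in> missing E k (kswap E c a b u) v"
      using kswap_at[OF assms(1), of _ v c a b u] True by (simp add: missing_def)
    finally show ?thesis by simp
  qed
  then show ?thesis using True by auto
next
  case False
  then show ?thesis using kswap_at[OF assms(1), of _ v c a b u] by (simp add: missing_def)
qed

text \<open>Serves twice: with a singleton \<open>T\<close> for Kempe chains, and with
  \<open>T\<close> among the vertices already drawn for ears, where the path has to stop at the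
  first vertex of \<open>T\<close>.\<close>

lemma simple_path_to:
  assumes "R\<^sup>*\<^sup>* x t" "t \<in> T"
  shows "\<exists>xs. successively R xs \<and> distinct xs \<and> xs \<noteq> [] \<and> hd xs = x \<and> last xs \<in> T \<and> set (butlast xs) \<inter> T = {}"
  using assms(1)
proof (induction rule: converse_rtranclp_induct)
  case base
  then show ?case using assms(2) by (intro exI[of _ "[t]"]) auto
next
  case (step v v')
  then obtain xs where xs: "successively R xs" "distinct xs" "xs \<noteq> []" "hd xs = v'" "last xs \<in> T"
    "set (butlast xs) \<inter> T = {}" by blast
  consider "v \<in> T" | "v \<in> set xs" | "v \<notin> T" "v \<notin> set xs" by blast
  then show ?case
  proof cases
    case 1
    then show ?thesis by (intro exI[of _ "[v]"]) auto
  next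
    case 2
    then obtain ys zs where *: "xs = ys @ v # zs" by (meson split_list)
    show ?thesis
      using xs unfolding * by (intro exI[of _ "v # zs"]) (auto simp: successively_append_iff butlast_append)
  next
    case 3
    then show ?thesis
      using xs step(1) by (intro exI[of _ "v # xs"]) (auto simp: successively_Cons)
  qed
qed

lemma simple_path_between:
  assumes "R\<^sup>*\<^sup>* x u"
  obtains xs where "successively R (x # xs)" "distinct (x # xs)" "last (x # xs) = u"
proof -
  obtain ys where ys: "successively R ys" "distinct ys" "ys \<noteq> []" "hd ys = x" "last ys \<in> {u}"
    using simple_path_to[OF assms, of "{u}"] by blast
  show thesis
    by (rule that[of "tl ys"]) (use ys in \<open>cases ys; auto\<close>)+
qed

text \<open>Both paths are followed simultaneously from \<open>p\<close>. By \<open>deg2\<close>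
  there is only one way to go on other than back to \<open>r\<close>, so they agree as long as both
  continue; neither stops before the other, because an end has only one neighbour.\<close>

lemma path_end_unique:
  assumes "symp R"
    and deg2: "\<And>p q1 q2 q3. R p q1 \<Longrightarrow> R p q2 \<Longrightarrow> R p q3 \<Longrightarrow> q1 = q2 \<or> q1 = q3 \<or> q2 = q3"
  shows "R r p \<Longrightarrow> successively R (p # xs) \<Longrightarrow> successively R (p # ys) \<Longrightarrow>
    distinct (r # p # xs) \<Longrightarrow> distinct (r # p # ys) \<Longrightarrow>
    (\<And>q1 q2. R (last (p # xs)) q1 \<Longrightarrow> R (last (p # xs)) q2 \<Longrightarrow> q1 = q2) \<Longrightarrow>
    (\<And>q1 q2. R (last (p # ys)) q1 \<Longrightarrow> R (last (p # ys)) q2 \<Longrightarrow> q1 = q2) \<Longrightarrow>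
    last (p # xs) = last (p # ys)"
proof (induction xs arbitrary: p r ys)
  case Nil
  show ?case
  proof (cases ys)
    case (Cons q zs)
    have "R p r" using Nil.prems(1) assms(1) by (simp add: sympD)
    moreover have "R p q" using Nil.prems(3) Cons by simp
    ultimately show ?thesis using Nil.prems(5,6) Cons by fastforce
  qed simp
next
  case (Cons q xs)
  have rp: "R p r" "R p q" using Cons.prems(1,2) assms(1) by (auto simp: sympD)
  show ?case
  proof (cases ys)
    case Nil
    then show ?thesis using Cons.prems(4,7) rp by fastforce
  next
    case Cons': (Cons q' zs)
    have "R p q'" using Cons.prems(3) Cons' by simp
    then have [simp]: "q' = q" using deg2[OF rp] Cons.prems(4,5) Cons' by auto
    have "last (q # xs) = last (q # zs)"
      by (rule Cons.IH[OF rp(2)]) (use Cons.prems Cons' in \<open>auto\<close>)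
    then show ?thesis using Cons' by simp
  qed
qed

text \<open>A vertex that misses \<open>a\<close> or \<open>b\<close> is an end of its chain. With
  \<open>x\<close> as one end, the chain is a path and has just one other end.\<close>

lemma linked_ends:
  assumes E: "edge_set E" and c: "pec E k c"
    and link: "linked E c a b x u" "linked E c a b x v"
    and neq: "x \<noteq> u" "x \<noteq> v"
    and miss: "missing E k c x \<inter> {a, b} \<noteq> {}" "missing E k c u \<inter> {a, b} \<noteq> {}" "missing E k c v \<inter> {a, b} \<noteq> {}"
  shows "u = v"
proof -
  let ?R = "kadj E c a b"
  have sym: "symp ?R" by (auto simp: symp_def kadj_def insert_commute)
  have same: "q1 = q2" if "?R p q1" "?R p q2" "c {p, q1} = c {p, q2}" for p q1 q2
  proof -
    have "{p, q1} = {p, q2}"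
      by (rule pecD[OF c, where v = p]) (use that in \<open>auto simp: kadj_def\<close>)
    then show ?thesis by (metis doubleton_eq_iff)
  qed
  have deg2: "q1 = q2 \<or> q1 = q3 \<or> q2 = q3" if "?R p q1" "?R p q2" "?R p q3" for p q1 q2 q3
  proof -
    have "c {p, q1} = a \<or> c {p, q1} = b" "c {p, q2} = a \<or> c {p, q2} = b" "c {p, q3} = a \<or> c {p, q3} = b"
      using that by (auto simp: kadj_def)
    then have "c {p, q1} = c {p, q2} \<or> c {p, q1} = c {p, q3} \<or> c {p, q2} = c {p, q3}" by metis
    then show ?thesis using same that by metis
  qed
  have deg1: "q1 = q2" if "missing E k c p \<inter> {a, b} \<noteq> {}" "?R p q1" "?R p q2" for p q1 q2
  proof -
    have "c {p, q1} = c {p, q2}"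
      using that unfolding missing_def kadj_def by fastforce
    then show ?thesis using same that by blast
  qed
  obtain xs where xs: "successively ?R (x # xs)" "distinct (x # xs)" "last (x # xs) = u"
    by (rule simple_path_between[OF link(1)[unfolded linked_def]])
  obtain ys where ys: "successively ?R (x # ys)" "distinct (x # ys)" "last (x # ys) = v"
    by (rule simple_path_between[OF link(2)[unfolded linked_def]])
  obtain p xs' where [simp]: "xs = p # xs'" using xs(3) neq(1) by (cases xs) simp_all
  obtain q ys' where [simp]: "ys = q # ys'" using ys(3) neq(2) by (cases ys) simp_all
  have "?R x p" "?R x q" using xs(1) ys(1) by simp_all
  then have [simp]: "q = p" using deg1[OF miss(1)] by blast
  have u1: "q1 = q2" if "?R (last (p # xs')) q1" "?R (last (p # xs')) q2" for q1 q2
    using that deg1[OF miss(2)] xs(3) by simp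
  have v1: "q1 = q2" if "?R (last (p # ys')) q1" "?R (last (p # ys')) q2" for q1 q2
    using that deg1[OF miss(3)] ys(3) by simp
  have "last (p # xs') = last (p # ys')"
    by (rule path_end_unique[OF sym deg2 \<open>?R x p\<close> _ _ _ _ u1 v1])
      (use xs(1,2) ys(1,2) in simp_all)
  then show ?thesis using xs(3) ys(3) by simp
qed

section \<open>Vizing's fan argument around an uncoloured edge\<close>

section \<open>Vizing fans\<close>

text \<open>A linear Vizing fan at \<open>x\<close>. The edge from \<open>x\<close> to the first vertex of the list is the uncoloured one,
  hence its removal from \<open>E\<close>.\<close>

definition fan :: "'a set set \<Rightarrow> nat \<Rightarrow> ('a set \<Rightarrow> nat) \<Rightarrow> 'a \<Rightarrow> 'a list \<Rightarrow> bool" where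
  "fan E k c x zs \<longleftrightarrow> zs \<noteq> [] \<and> distinct zs \<and> (\<forall>z\<in>set zs. {x, z} \<in> E) \<and>
     successively (\<lambda>u v. c {x, v} \<in> missing (E - {{x, hd zs}}) k c u) zs"

lemma missingD: "i \<in> missing E k c v \<Longrightarrow> e \<in> E \<Longrightarrow> v \<in> e \<Longrightarrow> c e \<noteq> i"
  by (simp add: missing_def)

lemma missing_less: "i \<in> missing E k c v \<Longrightarrow> i < k"
  by (simp add: missing_def)

lemma missingI: "i < k \<Longrightarrow> (\<And>e. e \<in> E \<Longrightarrow> v \<in> e \<Longrightarrow> c e \<noteq> i) \<Longrightarrow> i \<in> missing E k c v"
  by (simp add: missing_def)

lemma pec_insert:
  assumes c: "pec (E - {{x, z}}) k c"
    and i: "i \<in> missing (E - {{x, z}}) k c x" "i \<in> missing (E - {{x, z}}) k c z"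
  shows "pec E k (c({x, z} := i))"
proof (rule pecI)
  show "(c({x, z} := i)) e < k" if "e \<in> E" for e
    using that i pec_range[OF c] missing_less by auto
  fix e e' v assume *: "e \<in> E" "e' \<in> E" "v \<in> e" "v \<in> e'" "(c({x, z} := i)) e = (c({x, z} := i)) e'"
  have new: "c f \<noteq> i" if "f \<in> E - {{x, z}}" "v \<in> f" "v \<in> {x, z}" for f
    using that missingD[OF i(1) that(1)] missingD[OF i(2) that(1)] by auto
  consider "e = {x, z}" | "e' = {x, z}" | "e \<noteq> {x, z}" "e' \<noteq> {x, z}" by blast
  then show "e = e'"
  proof cases
    case 1
    then show ?thesis using new[of e'] * by (cases "e' = {x, z}") auto
  next
    case 2
    then show ?thesis using new[of e] * by (cases "e = {x, z}") auto
  next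
    case 3
    then show ?thesis using pecD[OF c, of e e' v] * by auto
  qed
qed

text \<open>A colour missing at both ends would allow to shift colours along the fan and to colour the last edge.\<close>

lemma fan_disjoint_centre:
  assumes "\<not> colourable k E" "edge_set E"
  shows "pec (E - {{x, z}}) k c \<Longrightarrow> fan E k c x (z # zs) \<Longrightarrow>
    missing (E - {{x, z}}) k c x \<inter> missing (E - {{x, z}}) k c (last (z # zs)) = {}"
proof (induction zs arbitrary: z c)
  case Nil
  then show ?case using pec_insert[of E x z k c] assms(1) unfolding colourable_def by auto
next
  case (Cons w zs)
  let ?E0 = "E - {{x, z}}" and ?E1 = "E - {{x, w}}"
  define i where "i = c {x, w}"
  define c' where "c' = c({x, z} := i)"
  have xw: "{x, w} \<in> E" "w \<noteq> z" "{x, z} \<in> E" and dist: "distinct (z # w # zs)"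
    and iz: "i \<in> missing ?E0 k c z"
    and succ: "successively (\<lambda>u v. c {x, v} \<in> missing ?E0 k c u) (w # zs)"
    and mem: "\<forall>v\<in>set (z # w # zs). {x, v} \<in> E"
    using Cons.prems(2) unfolding fan_def i_def by auto
  have xne: "x \<noteq> v" if "v \<in> set (z # w # zs)" for v
    using edge_set_neq[OF assms(2)] bspec[OF mem that] .
  have "{x, w} \<noteq> {x, z}" using xw(2) by (auto simp: doubleton_eq_iff)
  then have xw0: "{x, w} \<in> ?E0" using xw(1) by simp
  have sub: "?E1 - {{x, z}} \<subseteq> ?E0" by blast
  have c1: "pec (?E1 - {{x, z}}) k c" by (rule pec_subset[OF Cons.prems(1) sub])
  have ix: "i \<in> missing (?E1 - {{x, z}}) k c x"
  proof (rule missingI)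
    show "i < k" using missing_less[OF iz] .
    show "c e \<noteq> i" if "e \<in> ?E1 - {{x, z}}" "x \<in> e" for e
      using that pecD[OF Cons.prems(1), of e "{x, w}" x] xw0 unfolding i_def by blast
  qed
  have iz': "i \<in> missing (?E1 - {{x, z}}) k c z"
    using iz sub unfolding missing_def by blast
  have c': "pec ?E1 k c'"
    unfolding c'_def by (rule pec_insert[OF c1 ix iz'])
  \<comment> \<open>Only \<open>z\<close> loses a missing colour: at \<open>x\<close> the colour
    \<open>i\<close> was already present on the edge \<open>xw\<close>, which is now the uncoloured
    one.\<close>
  have mono: "missing ?E0 k c v \<subseteq> missing ?E1 k c' v" if "v \<noteq> z" for v
  proof
    fix j assume j: "j \<in> missing ?E0 k c v"
    show "j \<in> missing ?E1 k c' v"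
    proof (rule missingI)
      show "j < k" using missing_less[OF j] .
      fix e assume e: "e \<in> ?E1" "v \<in> e"
      show "c' e \<noteq> j"
      proof (cases "e = {x, z}")
        case True
        then have "v = x" using e(2) that by auto
        then show ?thesis using missingD[OF j xw0] True by (simp add: c'_def i_def)
      next
        case False
        then show ?thesis using missingD[OF j, of e] e by (simp add: c'_def)
      qed
    qed
  qed
  have "fan E k c' x (w # zs)"
    unfolding fan_def
  proof (intro conjI)
    show "successively (\<lambda>u v. c' {x, v} \<in> missing (E - {{x, hd (w # zs)}}) k c' u) (w # zs)"
    proof (rule successively_mono[OF succ, of "\<lambda>u v. c' {x, v} \<in> missing (E - {{x, hd (w # zs)}}) k c' u"])
      fix u v assume uv: "u \<in> set (w # zs)" "v \<in> set (w # zs)" "c {x, v} \<in> missing ?E0 k c u"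
      have "u \<noteq> z" "v \<noteq> z" using uv dist by auto
      then have "{x, v} \<noteq> {x, z}" by (auto simp: doubleton_eq_iff)
      then show "c' {x, v} \<in> missing (E - {{x, hd (w # zs)}}) k c' u"
        using mono[OF \<open>u \<noteq> z\<close>] uv(3) by (auto simp: c'_def)
    qed
  qed (use dist mem in auto)
  from Cons.IH[OF c' this] have "missing ?E1 k c' x \<inter> missing ?E1 k c' (last (w # zs)) = {}" .
  moreover have "last (w # zs) \<noteq> z" using dist by (metis distinct.simps(2) last_in_set list.distinct(1))
  moreover have "x \<noteq> z" using xne[of z] by simp
  ultimately have "missing ?E0 k c x \<inter> missing ?E0 k c (last (w # zs)) = {}"
    using Int_mono[OF mono[of x] mono[of "last (w # zs)"]] by simp
  then show ?case by simp
qed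

lemma fan_prefix:
  assumes "fan E k c x (zs @ ws)" "zs \<noteq> []"
  shows "fan E k c x zs"
  using assms unfolding fan_def by (auto simp: successively_append_iff)

text \<open>Otherwise a swap on the chain of the last vertex leaves \<open>x\<close> alone and makes
  \<open>a\<close> missing at both, against \<open>fan_disjoint_centre\<close>. The induction on the
  length is needed to see that the fan survives the swap: it could only break after a vertex
  \<open>v\<close> of the chain that misses \<open>b\<close>, and then the shorter fan ending in
  \<open>v\<close> links \<open>v\<close>, and so the whole chain, to \<open>x\<close>.\<close>

lemma fan_linked:
  assumes nc: "\<not> colourable k E" and E: "edge_set E"
    and c: "pec (E - {{x, z}}) k c"
    and a: "a \<in> missing (E - {{x, z}}) k c x"
  shows "fan E k c x (z # zs) \<Longrightarrow> b \<in> missing (E - {{x, z}}) k c (last (z # zs)) \<Longrightarrow>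
    linked (E - {{x, z}}) c a b (last (z # zs)) x"
proof (induction "length zs" arbitrary: zs rule: less_induct)
  case less
  let ?E0 = "E - {{x, z}}"
  define u where "u = last (z # zs)"
  define c' where "c' = kswap ?E0 c a b u"
  have E0: "edge_set ?E0" using edge_set_subset[OF E] by blast
  have ab: "a < k" "b < k" using missing_less[OF a] missing_less[OF less.prems(2)] .
  show ?case
  proof (rule ccontr)
    assume *: "\<not> linked ?E0 c a b (last (z # zs)) x"
    then have nl: "\<not> linked ?E0 c a b u x" by (simp add: u_def)
    have c': "pec ?E0 k c'" unfolding c'_def by (rule pec_kswap[OF E0 c ab])
    have mx: "missing ?E0 k c' x = missing ?E0 k c x"
      unfolding c'_def using missing_kswap[OF E0 ab] nl by simp
    have mu: "a \<in> missing ?E0 k c' u"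
    proof -
      have "missing ?E0 k c' u = flip a b ` missing ?E0 k c u"
        unfolding c'_def using missing_kswap[OF E0 ab, of c u u] by simp
      moreover have "flip a b b = a" by (simp add: flip_def)
      ultimately show ?thesis using less.prems(2) unfolding u_def by force
    qed
    have fan: "distinct (z # zs)" "\<forall>v\<in>set (z # zs). {x, v} \<in> E"
      "successively (\<lambda>u v. c {x, v} \<in> missing ?E0 k c u) (z # zs)"
      using less.prems(1) unfolding fan_def by auto
    have cx: "c' {x, v} = c {x, v}" if "v \<in> set zs" for v
    proof -
      have "{x, v} \<in> ?E0" using that fan(1,2) by (auto simp: doubleton_eq_iff)
      then show ?thesis unfolding c'_def using kswap_at[OF E0, of "{x, v}" x c a b u] nl by simp
    qed
    have succ': "c' {x, w} \<in> missing ?E0 k c' v"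
      if eq: "z # zs = ps @ v # w # qs" for ps v w qs
    proof -
      have cv: "c {x, w} \<in> missing ?E0 k c v"
        using fan(3) unfolding eq by (auto simp: successively_append_iff)
      have w: "w \<in> set zs" using eq by (cases ps) auto
      have xw: "{x, w} \<in> ?E0" using w fan(1,2) by (auto simp: doubleton_eq_iff)
      have na: "c {x, w} \<noteq> a" using missingD[OF a xw] by simp
      show ?thesis
      proof (cases "linked ?E0 c a b u v")
        case False
        then show ?thesis unfolding c'_def using missing_kswap[OF E0 ab, of c u v] cv cx[OF w]
          by (simp add: c'_def)
      next
        case True
        have nb: "c {x, w} \<noteq> b"
        proof
          assume b: "c {x, w} = b"
          define ys where "ys = tl (ps @ [v])"
          have ys: "z # ys = ps @ [v]" using eq by (cases ps) (auto simp: ys_def)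
          have eq2: "z # zs = (z # ys) @ w # qs" using eq ys by simp
          have "fan E k c x (z # ys)"
            by (rule fan_prefix[of _ _ _ _ "z # ys" "w # qs"]) (use less.prems(1) eq2 in auto)
          moreover have "length ys < length zs" using eq2 by simp
          moreover have "last (z # ys) = v" using ys by simp
          ultimately have "linked ?E0 c a b v x"
            using less.hyps[of ys] cv b by simp
          then show False using nl True linked_trans by metis
        qed
        then have "flip a b (c {x, w}) = c {x, w}" using na by (simp add: flip_def)
        then have "c {x, w} \<in> flip a b ` missing ?E0 k c v" using cv by (metis imageI)
        then show ?thesis unfolding c'_def using missing_kswap[OF E0 ab, of c u v] cx[OF w] True
          by (simp add: c'_def)
      qed
    qed
    have "successively (\<lambda>u v. c' {x, v} \<in> missing ?E0 k c' u) (z # zs)"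
      unfolding successively_conv_nth
    proof (intro allI impI)
      fix i assume i: "Suc i < length (z # zs)"
      show "c' {x, (z # zs) ! Suc i} \<in> missing ?E0 k c' ((z # zs) ! i)"
        by (rule succ'[of "take i (z # zs)" _ _ "drop (Suc (Suc i)) (z # zs)"])
          (use i in \<open>metis Cons_nth_drop_Suc Suc_lessD append_take_drop_id\<close>)
    qed
    then have "fan E k c' x (z # zs)" using fan by (simp add: fan_def)
    from fan_disjoint_centre[OF nc E c' this] show False
      using a mx mu unfolding u_def by auto
  qed
qed

text \<open>\<open>X\<close> consists of the last vertices of all fans that start with
  \<open>z\<close>. Their sets of missing colours are pairwise disjoint, since a common colour would
  give a chain from \<open>x\<close> with two further ends. Each of these colours occurs on an edge
  from \<open>x\<close> to \<open>X - {z}\<close>, since otherwise the fan could be prolonged. So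
  there are fewer of them than vertices in \<open>X\<close>.\<close>

lemma fan_sum_missing:
  assumes nc: "\<not> colourable k E" and E: "edge_set E" and xz: "{x, z} \<in> E"
    and c: "pec (E - {{x, z}}) k c"
    and nonempty: "missing (E - {{x, z}}) k c x \<noteq> {}"
  obtains X where "finite X" "z \<in> X" "\<forall>v\<in>X. {x, v} \<in> E"
    "(\<Sum>v\<in>X. card (missing (E - {{x, z}}) k c v)) < card X"
proof -
  let ?E0 = "E - {{x, z}}"
  let ?M = "missing ?E0 k c"
  have E0: "edge_set ?E0" using edge_set_subset[OF E] by blast
  obtain a where a: "a \<in> ?M x" using nonempty by blast
  define X where "X = {v. \<exists>zs. fan E k c x (z # zs) \<and> last (z # zs) = v}"
  have XI: "last (z # zs) \<in> X" if "fan E k c x (z # zs)" for zs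
    using that unfolding X_def by blast
  have XE: "\<forall>v\<in>X. {x, v} \<in> E"
    unfolding X_def fan_def using last_in_set by blast
  have "inj_on (\<lambda>v. {x, v}) X" by (auto simp: inj_on_def doubleton_eq_iff)
  moreover have "(\<lambda>v. {x, v}) ` X \<subseteq> E" using XE by blast
  ultimately have fin: "finite X" using finite_edge_set[OF E] by (metis finite_imageD finite_subset)
  have "fan E k c x [z]" using xz by (simp add: fan_def)
  then have zX: "z \<in> X" using XI[of "[]"] by simp
  have disj: "?M u \<inter> ?M v = {}" if "u \<in> X" "v \<in> X" "u \<noteq> v" for u v
  proof (rule ccontr)
    assume "?M u \<inter> ?M v \<noteq> {}"
    then obtain b where b: "b \<in> ?M u" "b \<in> ?M v" by blast
    have "linked ?E0 c a b u x" "linked ?E0 c a b v x"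
      using that b fan_linked[OF nc E c a] unfolding X_def by blast+
    then have l: "linked ?E0 c a b x u" "linked ?E0 c a b x v" using linked_sym by metis+
    have "u = v"
      by (rule linked_ends[OF E0 c l])
        (use a b XE that edge_set_neq[OF E] in auto)
    then show False using that by simp
  qed
  have cover: "\<exists>w\<in>X - {z}. c {x, w} = b" if v: "v \<in> X" and b: "b \<in> ?M v" for v b
  proof -
    obtain zs where zs: "fan E k c x (z # zs)" "last (z # zs) = v" using v unfolding X_def by blast
    have "b \<notin> ?M x" using fan_disjoint_centre[OF nc E c zs(1)] zs(2) b by auto
    then obtain e where e: "e \<in> ?E0" "x \<in> e" "c e = b"
      using missing_less[OF b] unfolding missing_def by auto
    obtain w where w: "e = {x, w}" using edge_setE[OF E0 e(1,2)] by metis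
    have "w \<noteq> z" using e w by auto
    moreover have "w \<in> X"
    proof (cases "w \<in> set (z # zs)")
      case True
      then obtain ps qs where "z # zs = ps @ w # qs" by (meson split_list)
      then have *: "z # zs = (ps @ [w]) @ qs" by simp
      then have "fan E k c x (ps @ [w])" using zs(1) fan_prefix by (metis snoc_eq_iff_butlast)
      moreover have "ps @ [w] = z # tl (ps @ [w])" using * by (cases ps) auto
      ultimately show ?thesis using XI[of "tl (ps @ [w])"] by (metis last_snoc)
    next
      case False
      have "fan E k c x (z # (zs @ [w]))"
        using zs(1) False e b w zs(2) unfolding fan_def by (auto simp: successively_append_iff successively_Cons split: if_splits)
      then show ?thesis using XI[of "zs @ [w]"] by simp
    qed
    ultimately show ?thesis using e w by blast
  qed
  have sub: "(\<Union>v\<in>X. ?M v) \<subseteq> (\<lambda>w. c {x, w}) ` (X - {z})"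
  proof
    fix b assume "b \<in> (\<Union>v\<in>X. ?M v)"
    then obtain v where "v \<in> X" "b \<in> ?M v" by blast
    from cover[OF this] show "b \<in> (\<lambda>w. c {x, w}) ` (X - {z})" by blast
  qed
  have "(\<Sum>v\<in>X. card (?M v)) = card (\<Union>v\<in>X. ?M v)"
    by (rule card_UN_disjoint[symmetric]) (use fin disj in auto)
  also have "\<dots> \<le> card ((\<lambda>w. c {x, w}) ` (X - {z}))"
    by (rule card_mono) (use fin sub in auto)
  also have "\<dots> \<le> card (X - {z})" by (rule card_image_le) (use fin in auto)
  also have "\<dots> < card X" using zX fin by (metis card_Diff1_less)
  finally show thesis using that[OF fin zX XE] by blast
qed

section \<open>Vizing's theorem, the adjacency lemma and cut vertices\<close>

section \<open>Critical graphs\<close>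

lemma deg_remove:
  assumes "edge_set E" "{x, z} \<in> E"
  shows "deg E v = deg (E - {{x, z}}) v + (if v = x \<or> v = z then 1 else 0)"
proof (cases "v = x \<or> v = z")
  case True
  then have "{e \<in> E. v \<in> e} = insert {x, z} {e \<in> E - {{x, z}}. v \<in> e}" using assms(2) by auto
  moreover have "finite {e \<in> E - {{x, z}}. v \<in> e}" using finite_edge_set[OF assms(1)] by simp
  ultimately show ?thesis unfolding deg_def using True by simp
next
  case False
  then have "{e \<in> E. v \<in> e} = {e \<in> E - {{x, z}}. v \<in> e}" by auto
  then show ?thesis unfolding deg_def using False by simp
qed

text \<open>Edges are inserted one at a time. With \<open>Suc d\<close> colours every vertex misses
  at least one, which makes the sum in \<open>fan_sum_missing\<close> too large.\<close>

theorem vizing: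
  assumes "edge_set E" "\<And>v. deg E v \<le> d"
  shows "colourable (Suc d) E"
proof -
  have "finite E" by (rule finite_edge_set[OF assms(1)])
  then show ?thesis using assms
  proof (induction E rule: finite_induct)
    case empty
    then show ?case by (simp add: colourable_def pec_def)
  next
    case (insert e F)
    let ?E = "insert e F"
    have F: "edge_set F" by (rule edge_set_subset[OF insert.prems(1)]) blast
    have "deg F v \<le> d" for v
    proof -
      have "deg F v \<le> deg ?E v" unfolding deg_def by (rule card_mono) (use insert.hyps in auto)
      then show ?thesis using insert.prems(2)[of v] by linarith
    qed
    then obtain c where c: "pec F (Suc d) c" using insert.IH F unfolding colourable_def by blast
    obtain x z where e: "e = {x, z}" using insert.prems(1) unfolding edge_set_def
      by (metis card_2_iff insertI1)
    have F': "?E - {{x, z}} = F" using insert.hyps e by simp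
    show ?case
    proof (rule ccontr)
      assume nc: "\<not> colourable (Suc d) ?E"
      have pos: "1 \<le> card (missing F (Suc d) c v)" for v
        using card_missing[OF c insert.hyps(1), of v] \<open>deg F v \<le> d\<close> by linarith
      have "{x, z} \<in> ?E" using e by simp
      moreover have "missing F (Suc d) c x \<noteq> {}" using pos[of x] by auto
      ultimately obtain X where X: "finite X" "(\<Sum>v\<in>X. card (missing F (Suc d) c v)) < card X"
        using fan_sum_missing[OF nc insert.prems(1), of x z c] c unfolding F' by metis
      have "card X \<le> (\<Sum>v\<in>X. card (missing F (Suc d) c v))"
        using sum_mono[of X "\<lambda>_. 1", OF pos] by simp
      then show False using X(2) by simp
    qed
  qed
qed

text \<open>Criticality for a fixed number of colours, in terms of the edge set alone; chromatic
  numbers and isolated vertices no longer occur.\<close>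

definition critical_edges :: "nat \<Rightarrow> 'a set set \<Rightarrow> bool" where
  "critical_edges k E \<longleftrightarrow> edge_set E \<and> (\<forall>v. deg E v \<le> k) \<and> \<not> colourable k E \<and>
     (\<forall>E'. E' \<subset> E \<longrightarrow> colourable k E')"

text \<open>Count in the set \<open>X\<close> of \<open>fan_sum_missing\<close>. The vertex
  \<open>z\<close> misses \<open>k - deg E z + 1\<close> colours, one more than its degree suggests
  because \<open>xz\<close> is uncoloured, and every other vertex of degree below \<open>k\<close>
  misses at least one. As the sum stays below \<open>card X\<close>, more than
  \<open>k - deg E z\<close> vertices of \<open>X\<close> must have degree \<open>k\<close>.\<close>

theorem vizing_adjacency:
  assumes cr: "critical_edges k E" and xz: "{x, z} \<in> E"
  shows "k - deg E z < card {v. {x, v} \<in> E \<and> v \<noteq> z \<and> deg E v = k}"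
proof -
  have E: "edge_set E" and nc: "\<not> colourable k E" and dk: "deg E v \<le> k" for v
    using cr unfolding critical_edges_def by auto
  let ?E0 = "E - {{x, z}}"
  have E0: "edge_set ?E0" by (rule edge_set_subset[OF E]) blast
  have "?E0 \<subset> E" using xz by blast
  then obtain c where c: "pec ?E0 k c" using cr unfolding critical_edges_def colourable_def by blast
  have cm: "card (missing ?E0 k c v) = k - deg ?E0 v" "deg ?E0 v \<le> k" for v
    using card_missing[OF c finite_edge_set[OF E0], of v] by simp_all
  note dr = deg_remove[OF E xz]
  have "missing ?E0 k c x \<noteq> {}"
    using cm[of x] dr[of x] dk[of x] by fastforce
  then obtain X where X: "finite X" "z \<in> X" "\<forall>v\<in>X. {x, v} \<in> E"
    "(\<Sum>v\<in>X. card (missing ?E0 k c v)) < card X"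
    using fan_sum_missing[OF nc E xz c] by blast
  define D where "D = {v \<in> X - {z}. deg E v = k}"
  have "finite {v. {x, v} \<in> E}"
  proof -
    have "inj_on (\<lambda>v. {x, v}) {v. {x, v} \<in> E}" by (auto simp: inj_on_def doubleton_eq_iff)
    moreover have "(\<lambda>v. {x, v}) ` {v. {x, v} \<in> E} \<subseteq> E" by blast
    ultimately show ?thesis using finite_edge_set[OF E] by (metis finite_imageD finite_subset)
  qed
  then have "finite {v. {x, v} \<in> E \<and> v \<noteq> z \<and> deg E v = k}" by (rule rev_finite_subset) blast
  then have D: "card D \<le> card {v. {x, v} \<in> E \<and> v \<noteq> z \<and> deg E v = k}"
    by (rule card_mono) (use X(3) D_def in auto)
  have "card (X - {z} - D) = (\<Sum>v\<in>X - {z} - D. 1)" by simp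
  also have "\<dots> \<le> (\<Sum>v\<in>X - {z} - D. card (missing ?E0 k c v))"
  proof (rule sum_mono)
    fix v assume v: "v \<in> X - {z} - D"
    then have "deg E v \<noteq> k" unfolding D_def by blast
    then have "deg ?E0 v < k" using dr[of v] dk[of v] by linarith
    then show "1 \<le> card (missing ?E0 k c v)" using cm[of v] by simp
  qed
  also have "\<dots> \<le> (\<Sum>v\<in>X - {z}. card (missing ?E0 k c v))"
    by (rule sum_mono2) (use X(1) in auto)
  finally have 1: "card (X - {z} - D) \<le> (\<Sum>v\<in>X - {z}. card (missing ?E0 k c v))" .
  have "(\<Sum>v\<in>X. card (missing ?E0 k c v)) =
      card (missing ?E0 k c z) + (\<Sum>v\<in>X - {z}. card (missing ?E0 k c v))"
    using X(1,2) by (simp add: sum.remove)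
  moreover have "card (missing ?E0 k c z) = k - deg E z + 1"
    using cm[of z] dr[of z] dk[of z] by simp
  moreover have "card (X - {z} - D) = card X - 1 - card D"
  proof -
    have "D \<subseteq> X - {z}" "finite D" using X(1) unfolding D_def by auto
    then show ?thesis using X(1,2) by (simp add: card_Diff_subset)
  qed
  ultimately show ?thesis using X(4) 1 D by linarith
qed

text \<open>Meant as a renaming of colours: \<open>A\<close> is matched with a part of
  \<open>B\<close>, and the complements with each other, so \<open>f\<close> permutes
  \<open>U\<close>.\<close>

lemma bij_betw_extend:
  assumes "A \<subseteq> U" "B \<subseteq> U" "finite U" "card A \<le> card B"
  obtains f where "inj_on f U" "f ` U \<subseteq> U" "f ` A \<subseteq> (B :: 'b set)"
proof -
  have fin: "finite A" "finite B" using assms finite_subset by blast+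
  obtain B' where B': "B' \<subseteq> B" "card B' = card A" using obtain_subset_with_card_n[OF assms(4)] by metis
  have fB': "finite B'" using B' fin finite_subset by blast
  obtain g where g: "bij_betw g A B'" using finite_same_card_bij[OF fin(1) fB'] B' by metis
  have "card (U - A) = card (U - B')"
    using assms fin fB' B' by (simp add: card_Diff_subset subset_trans[OF B'(1) assms(2)])
  then obtain h where h: "bij_betw h (U - A) (U - B')"
    using finite_same_card_bij[of "U - A" "U - B'"] assms(3) by auto
  define f where "f x = (if x \<in> A then g x else h x)" for x
  have fA: "bij_betw f A B'" using g by (rule bij_betw_cong[THEN iffD1, rotated]) (simp add: f_def)
  have fU: "bij_betw f (U - A) (U - B')"
    using h by (rule bij_betw_cong[THEN iffD1, rotated]) (simp add: f_def)
  have "bij_betw f (A \<union> (U - A)) (B' \<union> (U - B'))"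
    by (rule bij_betw_combine[OF fA fU]) blast
  moreover have "A \<union> (U - A) = U" "B' \<union> (U - B') = U" using assms B' by auto
  ultimately have "bij_betw f U U" by simp
  then show thesis using that[of f] fA B' unfolding bij_betw_def by auto
qed

definition avoid_adj :: "'a set set \<Rightarrow> 'a \<Rightarrow> 'a \<Rightarrow> 'a \<Rightarrow> bool" where
  "avoid_adj E u p q \<longleftrightarrow> {p, q} \<in> E \<and> p \<noteq> u \<and> q \<noteq> u"

text \<open>The two sides of a cut vertex \<open>u\<close> are coloured separately; permuting the colours on one side makes
  the colours at \<open>u\<close> disjoint.\<close>

theorem critical_no_cutvertex:
  assumes cr: "critical_edges k E" and v: "v \<in> \<Union>E" "v \<noteq> u" and t: "t \<in> \<Union>E" "t \<noteq> u"
  shows "(avoid_adj E u)\<^sup>*\<^sup>* v t"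
proof (rule ccontr)
  assume nr: "\<not> (avoid_adj E u)\<^sup>*\<^sup>* v t"
  have E: "edge_set E" and nc: "\<not> colourable k E" and dk: "\<And>v. deg E v \<le> k"
    and cr': "\<And>E'. E' \<subset> E \<Longrightarrow> colourable k E'"
    using cr unfolding critical_edges_def by auto
  define B where "B = {w. (avoid_adj E u)\<^sup>*\<^sup>* v w}"
  have uB: "u \<notin> B"
  proof
    assume "u \<in> B"
    then have "(avoid_adj E u)\<^sup>*\<^sup>* v u" by (simp add: B_def)
    then show False by (cases rule: rtranclp.cases) (use v in \<open>auto simp: avoid_adj_def\<close>)
  qed
  define E1 where "E1 = {e \<in> E. e \<inter> B \<noteq> {}}"
  define E2 where "E2 = E - E1"
  have closed: "q \<in> B" if "p \<in> B" "{p, q} \<in> E" "q \<noteq> u" for p q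
  proof -
    have "avoid_adj E u p q" using that uB unfolding avoid_adj_def by auto
    then show ?thesis using that(1) unfolding B_def by auto
  qed
  have E1B: "e \<subseteq> insert u B" if "e \<in> E1" for e
  proof -
    obtain p where p: "p \<in> e" "p \<in> B" "e \<in> E" using \<open>e \<in> E1\<close> unfolding E1_def by blast
    obtain q where q: "e = {p, q}" using edge_setE[OF E p(3,1)] by metis
    show ?thesis using closed[of p q] p q by auto
  qed
  have meet: "w = u" if "e \<in> E1" "e' \<in> E2" "w \<in> e" "w \<in> e'" for e e' w
    using E1B[OF that(1)] that unfolding E2_def E1_def by auto
  have "v \<in> B" by (simp add: B_def)
  then have E1ne: "E1 \<noteq> {}" using v(1) unfolding E1_def by auto
  have tB: "t \<notin> B" using nr by (simp add: B_def)
  have E2ne: "E2 \<noteq> {}"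
  proof -
    obtain e where e: "e \<in> E" "t \<in> e" using t by blast
    have "e \<notin> E1" using E1B[of e] tB t(2) e by auto
    then show ?thesis using e unfolding E2_def by blast
  qed
  have sub: "E1 \<subset> E" "E2 \<subset> E" using E1ne E2ne unfolding E2_def E1_def by auto
  obtain c1 c2 where c1: "pec E1 k c1" and c2: "pec E2 k c2"
    using cr'[OF sub(1)] cr'[OF sub(2)] unfolding colourable_def by blast
  have fin: "finite E1" "finite E2" using sub finite_edge_set[OF E] finite_subset by blast+
  \<comment> \<open>The two degrees at \<open>u\<close> add up to at most \<open>k\<close>, so the
    colours missing at \<open>u\<close> on one side have room for those used there on the
    other.\<close>
  have "deg E u = deg E1 u + deg E2 u"
  proof -
    have "{e \<in> E. u \<in> e} = {e \<in> E1. u \<in> e} \<union> {e \<in> E2. u \<in> e}" unfolding E2_def E1_def by blast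
    moreover have "{e \<in> E1. u \<in> e} \<inter> {e \<in> E2. u \<in> e} = {}" unfolding E2_def by blast
    ultimately show ?thesis unfolding deg_def using fin by (simp add: card_Un_disjoint)
  qed
  then have le: "deg E2 u \<le> card (missing E1 k c1 u)"
    using card_missing[OF c1 fin(1), of u] dk[of u] by linarith
  define A where "A = c2 ` {e \<in> E2. u \<in> e}"
  have "card A \<le> deg E2 u" unfolding A_def deg_def by (rule card_image_le) (use fin in simp)
  then have "card A \<le> card (missing E1 k c1 u)" using le by linarith
  moreover have "A \<subseteq> {..<k}" unfolding A_def using pec_range[OF c2] by auto
  moreover have "missing E1 k c1 u \<subseteq> {..<k}" unfolding missing_def by auto
  ultimately obtain f where f: "inj_on f {..<k}" "f ` {..<k} \<subseteq> {..<k}" "f ` A \<subseteq> missing E1 k c1 u"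
    using bij_betw_extend[of A "{..<k}" "missing E1 k c1 u"] by blast
  define c where "c e = (if e \<in> E1 then c1 e else f (c2 e))" for e
  have mixed: "c e \<noteq> c e'" if "e \<in> E1" "e' \<in> E2" "w \<in> e" "w \<in> e'" for e e' w
  proof -
    have w: "w = u" using meet that by blast
    then have "c2 e' \<in> A" using that unfolding A_def by blast
    then have "f (c2 e') \<in> missing E1 k c1 u" using f(3) by blast
    then have "c1 e \<noteq> f (c2 e')" using missingD that(1,3) w by metis
    moreover have "e' \<notin> E1" using that(2) unfolding E2_def by blast
    ultimately show ?thesis using that(1) unfolding c_def by simp
  qed
  have "pec E k c"
  proof (rule pecI)
    show "c e < k" if "e \<in> E" for e
    proof (cases "e \<in> E1")
      case True
      then show ?thesis using pec_range[OF c1] by (simp add: c_def)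
    next
      case False
      then have "e \<in> E2" using that unfolding E2_def by blast
      then have "c2 e \<in> {..<k}" using pec_range[OF c2] by simp
      then show ?thesis using f(2) False unfolding c_def by auto
    qed
    fix e e' w assume *: "e \<in> E" "e' \<in> E" "w \<in> e" "w \<in> e'" "c e = c e'"
    consider "e \<in> E1" "e' \<in> E1" | "e \<in> E1" "e' \<in> E2" | "e \<in> E2" "e' \<in> E1" | "e \<in> E2" "e' \<in> E2"
      using * unfolding E2_def by blast
    then show "e = e'"
    proof cases
      case 1
      then show ?thesis using pecD[OF c1, of e e' w] * by (simp add: c_def)
    next
      case 2
      then show ?thesis using mixed *(3-5) by metis
    next
      case 3
      then show ?thesis using mixed *(3-5) by metis
    next
      case 4
      then have "e \<notin> E1" "e' \<notin> E1" unfolding E2_def by auto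
      then have "f (c2 e) = f (c2 e')" using * by (simp add: c_def)
      then have "c2 e = c2 e'" using f(1) pec_range[OF c2 4(1)] pec_range[OF c2 4(2)]
        by (simp add: inj_on_eq_iff)
      then show ?thesis using pecD[OF c2 4 *(3,4)] by blast
    qed
  qed
  then show False using nc unfolding colourable_def by blast
qed

section \<open>From chromatic numbers of graphs to colourings of edge sets\<close>

lemma pec_graph: "proper_edge_colouring (Graph V E) k c \<longleftrightarrow> pec E k c"
  by (simp add: proper_edge_colouring_def pec_def)

text \<open>Giving every edge its own colour shows that the \<open>LEAST\<close> in the chromatic
  number is attained.\<close>

lemma chromatic_number_le_iff:
  assumes "finite E"
  shows "edge_chromatic_number (Graph V E) \<le> k \<longleftrightarrow> colourable k E"
proof
  define n where "n = edge_chromatic_number (Graph V E)"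
  have "pec E (card E) c" if "bij_betw c E {..<card E}" for c
    using that unfolding bij_betw_def pec_def inj_on_def by auto
  then have "\<exists>k c. pec E k c" using assms by (metis bij_betw_iff_card card_lessThan finite_lessThan)
  then have n: "\<exists>c. pec E n c"
    unfolding n_def edge_chromatic_number_def pec_graph by (rule LeastI_ex)
  {
    assume "edge_chromatic_number (Graph V E) \<le> k"
    then have nk: "n \<le> k" by (simp add: n_def)
    obtain c where "pec E n c" using n by blast
    then have "pec E k c" unfolding pec_def using nk by (auto dest!: subsetD[of "c ` E"])
    then show "colourable k E" unfolding colourable_def by blast
  }
  show "edge_chromatic_number (Graph V E) \<le> k" if "colourable k E"
    using that unfolding edge_chromatic_number_def pec_graph colourable_def by (rule Least_le)
qed

text \<open>By Vizing's theorem the chromatic number is at most \<open>k + 1\<close>, so every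
  proper subgraph has a \<open>k\<close>-colouring. Dropping isolated vertices would yield a proper
  subgraph with the same edges, so there are none.\<close>

lemma critical_critical_edges:
  assumes "critical k G" "k > 0"
  shows "critical_edges k (edges G)" "verts G = \<Union>(edges G)" "edges G \<noteq> {}"
proof -
  obtain V E where G: "G = Graph V E" by (cases G)
  have s: "finite V" "\<And>e. e \<in> E \<Longrightarrow> e \<subseteq> V \<and> card e = 2" and m: "max_degree G = k"
    and ne: "edge_chromatic_number G \<noteq> k"
    and cr: "\<And>H. proper_subgraph H G \<Longrightarrow> edge_chromatic_number H < edge_chromatic_number G"
    using assms(1) unfolding critical_def simple_graph_def class2_def class1_def G by auto
  have fE: "finite E" using s by (meson PowI finite_Pow_iff finite_subset subsetI)
  have E: "edge_set E" using fE s(2) by (simp add: edge_set_def)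
  have dV: "deg E v \<le> k" if "v \<in> V" for v
  proof -
    have "vertex_degree G v \<le> max_degree G"
      unfolding max_degree_def G by (rule Max_ge) (use s that in auto)
    then show ?thesis using m by (simp add: vertex_degree_def deg_def G)
  qed
  have d: "deg E v \<le> k" for v
  proof (cases "v \<in> V")
    case False
    then have "{e \<in> E. v \<in> e} = {}" using s(2) by blast
    then show ?thesis unfolding deg_def by (metis card.empty zero_le)
  qed (use dV in auto)
  have "max_degree G \<in> insert 0 (vertex_degree G ` V)"
    unfolding max_degree_def G using Max_in[of "insert 0 (vertex_degree (Graph V E) ` V)"] s by simp
  then obtain w where w: "deg E w = k" using m assms(2) by (auto simp: vertex_degree_def deg_def G)
  \<comment> \<open>\<open>class2\<close> says only that the chromatic number differs from
    \<open>k\<close>; a smaller value is impossible because of the vertex \<open>w\<close> of degree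
    \<open>k\<close>.\<close>
  have not: "\<not> colourable j E" if "j \<le> k" for j
  proof
    assume "colourable j E"
    then obtain c where c: "pec E j c" unfolding colourable_def by blast
    have "k \<le> j" using card_missing[OF c fE, of w] w by linarith
    then have "j = k" using that by simp
    then have "edge_chromatic_number G \<le> k" using chromatic_number_le_iff[OF fE] c unfolding G colourable_def by blast
    then have "edge_chromatic_number G < k" using ne by simp
    then have "edge_chromatic_number (Graph V E) \<le> k - 1" unfolding G by linarith
    then have "colourable (k - 1) E" using chromatic_number_le_iff[OF fE] by blast
    then obtain c' where c': "pec E (k - 1) c'" unfolding colourable_def by blast
    show False using card_missing[OF c' fE, of w] w assms(2) by linarith
  qed
  have viz: "edge_chromatic_number G \<le> Suc k"
    using chromatic_number_le_iff[OF fE] vizing[OF E d] unfolding G by blast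
  have col: "colourable k E'" if "V' \<subseteq> V" "E' \<subseteq> E" "\<And>e. e \<in> E' \<Longrightarrow> e \<subseteq> V'" "Graph V' E' \<noteq> G" for V' E'
  proof -
    have "proper_subgraph (Graph V' E') G"
      unfolding proper_subgraph_def subgraph_def simple_graph_def G
      using that s finite_subset[of V' V] by (auto simp: G)
    then have "edge_chromatic_number (Graph V' E') \<le> k" using cr viz by fastforce
    then show ?thesis using chromatic_number_le_iff finite_subset[OF that(2) fE] by blast
  qed
  have "colourable k E'" if "E' \<subset> E" for E'
    by (rule col[of V]) (use that s in \<open>auto simp: G\<close>)
  then show "critical_edges k (edges G)"
    unfolding critical_edges_def G using E d not by auto
  show "verts G = \<Union>(edges G)"
  proof (rule ccontr)
    assume ne: "verts G \<noteq> \<Union>(edges G)"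
    have "colourable k E"
      by (rule col[of "\<Union>E"]) (use ne s in \<open>auto simp: G\<close>)
    then show False using not by blast
  qed
  show "edges G \<noteq> {}" using w assms(2) unfolding deg_def G by auto
qed

section \<open>Extending colourings over two vertices of degree 2\<close>

section \<open>Adjacent neighbours of vertices of degree 2\<close>

text \<open>Restores a vertex of degree 2: its edges take colours missing at their other ends. The
  second conclusion keeps track of vertices elsewhere, so that this can be done for \<open>x\<close>
  after \<open>w\<close>.\<close>

lemma pec_divalent:
  assumes c: "pec F k c" and x: "\<forall>e\<in>F. x \<notin> e" and dist: "y \<noteq> y'" "x \<noteq> y" "x \<noteq> y'"
    and a: "a \<in> missing F k c y" "a' \<in> missing F k c y'" "a \<noteq> a'"
  obtains c' where "pec (insert {x, y} (insert {x, y'} F)) k c'"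
    "\<And>v m. v \<notin> {x, y, y'} \<Longrightarrow> m \<in> missing F k c v \<Longrightarrow> m \<in> missing (insert {x, y} (insert {x, y'} F)) k c' v"
proof -
  define c' where "c' = c({x, y} := a, {x, y'} := a')"
  have new: "{x, y} \<notin> F" "{x, y'} \<notin> F" "{x, y} \<noteq> {x, y'}" using x dist by (auto simp: doubleton_eq_iff)
  have cF: "c' e = c e" if "e \<in> F" for e using that new unfolding c'_def by auto
  have cy: "c' {x, y} = a" "c' {x, y'} = a'" using new(3) unfolding c'_def by auto
  have ny: "c e \<noteq> a" if "e \<in> F" "v \<in> e" "v \<in> {x, y}" for e v
    using that x missingD[OF a(1)] by auto
  have ny': "c e \<noteq> a'" if "e \<in> F" "v \<in> e" "v \<in> {x, y'}" for e v
    using that x missingD[OF a(2)] by auto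
  show thesis
  proof (rule that[of c'])
    show "pec (insert {x, y} (insert {x, y'} F)) k c'"
    proof (rule pecI)
      show "c' e < k" if "e \<in> insert {x, y} (insert {x, y'} F)" for e
        using that cF cy pec_range[OF c] missing_less[OF a(1)] missing_less[OF a(2)] by auto
      fix e e' v assume *: "e \<in> insert {x, y} (insert {x, y'} F)" "e' \<in> insert {x, y} (insert {x, y'} F)"
        "v \<in> e" "v \<in> e'" "c' e = c' e'"
      show "e = e'"
      proof (cases "e \<in> F")
        case True
        show ?thesis
        proof (cases "e' \<in> F")
          case F': True
          then show ?thesis using pecD[OF c, of e e' v] True * cF by simp
        next
          case False
          then have "e' = {x, y} \<or> e' = {x, y'}" using * by blast
          then show ?thesis using ny[OF True *(3)] ny'[OF True *(3)] *(4,5) cF[OF True] cy by auto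
        qed
      next
        case False
        then have e: "e = {x, y} \<or> e = {x, y'}" using * by blast
        show ?thesis
        proof (cases "e' \<in> F")
          case True
          then show ?thesis using e ny[OF True *(4)] ny'[OF True *(4)] *(3,5) cF[OF True] cy by auto
        next
          case False
          then have "e' = {x, y} \<or> e' = {x, y'}" using * by blast
          then show ?thesis using e cy a(3) *(5) by auto
        qed
      qed
    qed
    show "m \<in> missing (insert {x, y} (insert {x, y'} F)) k c' v"
      if v: "v \<notin> {x, y, y'}" and m: "m \<in> missing F k c v" for v m
    proof (rule missingI)
      show "m < k" using missing_less[OF m] .
      fix e assume e: "e \<in> insert {x, y} (insert {x, y'} F)" "v \<in> e"
      then have "e \<in> F" using v by auto
      then show "c' e \<noteq> m" using cF missingD[OF m _ e(2)] by simp
    qed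
  qed
qed

text \<open>Vertices \<open>x\<close>, \<open>w\<close> of degree 2 with neighbours \<open>y\<close>, \<open>y'\<close> and \<open>z\<close>, \<open>z'\<close>, where \<open>y\<close> and \<open>z\<close> are adjacent.
  A colouring of the graph without \<open>x\<close> and \<open>w\<close> leaves exactly one colour missing at each of the four
  neighbours, and it extends iff these colours differ at \<open>y\<close>, \<open>y'\<close> and at \<open>z\<close>, \<open>z'\<close>. Kempe changes together
  with recolouring the edge \<open>yz\<close> always reach such a colouring.\<close>

locale two_divalent =
  fixes E :: "'a set set" and k :: nat and x y y' w z z' :: 'a
  assumes E: "edge_set E" and not_colourable: "\<not> colourable k E" and k4: "4 \<le> k"
    and dist: "distinct [x, y, y', w, z, z']"
    and x_edges: "{e \<in> E. x \<in> e} = {{x, y}, {x, y'}}"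
    and w_edges: "{e \<in> E. w \<in> e} = {{w, z}, {w, z'}}"
    and degs: "deg E y = k" "deg E y' = k" "deg E z = k" "deg E z' = k"
    and yz: "{y, z} \<in> E"
begin

definition H :: "'a set set" where
  "H = {e \<in> E. x \<notin> e \<and> w \<notin> e}"

lemma H: "edge_set H"
  by (rule edge_set_subset[OF E]) (auto simp: H_def)

lemma neqs: "y \<noteq> y'" "y \<noteq> z" "y \<noteq> z'" "y' \<noteq> z" "y' \<noteq> z'" "z \<noteq> z'"
  "y' \<noteq> y" "z \<noteq> y" "z' \<noteq> y" "z \<noteq> y'" "z' \<noteq> y'" "z' \<noteq> z"
  using dist by auto

lemma yz_H: "{y, z} \<in> H"
  using yz dist by (auto simp: H_def)

lemma E_eq: "E = insert {x, y} (insert {x, y'} (insert {w, z} (insert {w, z'} H)))"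
proof -
  have "E = {e \<in> E. x \<in> e} \<union> {e \<in> E. w \<in> e} \<union> H" unfolding H_def by blast
  also have "\<dots> = {{x, y}, {x, y'}} \<union> {{w, z}, {w, z'}} \<union> H" by (simp only: x_edges w_edges)
  finally show ?thesis by (simp only: insert_is_Un[symmetric] Un_insert_left Un_empty_left)
qed

lemma in_E: "e \<in> E \<longleftrightarrow> e = {x, y} \<or> e = {x, y'} \<or> e = {w, z} \<or> e = {w, z'} \<or> e \<in> H"
  using arg_cong[OF E_eq, of "\<lambda>S. e \<in> S"] by (simp only: insert_iff)

lemma missing_singleton:
  assumes "pec H k c" "v \<in> {y, y', z, z'}"
  shows "\<exists>a. missing H k c v = {a}"
proof -
  define f where "f = (if v \<in> {y, y'} then {x, v} else {w, v})"
  have "{e \<in> E. v \<in> e} = insert f {e \<in> H. v \<in> e}"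
    unfolding in_E f_def using assms(2) dist by auto
  moreover have "f \<notin> H" unfolding f_def H_def by auto
  moreover have "finite {e \<in> H. v \<in> e}" using finite_edge_set[OF H] by simp
  ultimately have "deg E v = Suc (deg H v)" unfolding deg_def by simp
  moreover have "deg E v = k" using assms(2) degs by auto
  ultimately have "card (missing H k c v) = 1"
    using card_missing[OF assms(1) finite_edge_set[OF H], of v] by linarith
  then show ?thesis by (rule card_1_singletonE) blast
qed

text \<open>These five colours decide whether \<open>c\<close> extends. The argument below never
  looks at more of the colouring than they and the chains between the four neighbours.\<close>

definition state :: "('a set \<Rightarrow> nat) \<Rightarrow> nat \<Rightarrow> nat \<Rightarrow> nat \<Rightarrow> nat \<Rightarrow> nat \<Rightarrow> bool" where
  "state c i a a' b b' \<longleftrightarrow> pec H k c \<and> c {y, z} = i \<and> a \<in> missing H k c y \<and> a' \<in> missing H k c y' \<and>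
     b \<in> missing H k c z \<and> b' \<in> missing H k c z'"

lemma state_less:
  "state c i a a' b b' \<Longrightarrow> i < k \<and> a < k \<and> a' < k \<and> b < k \<and> b' < k"
  using missing_less pec_range yz_H unfolding state_def by metis

lemma state_neq:
  assumes "state c i a a' b b'" shows "i \<noteq> a" "i \<noteq> b"
  using assms missingD[of a H k c y "{y, z}"] missingD[of b H k c z "{y, z}"] yz_H
  unfolding state_def by auto

lemma not_extendable:
  assumes s: "state c i a a' b b'" and "a \<noteq> a'" "b \<noteq> b'"
  shows False
proof -
  have m: "pec H k c" "a \<in> missing H k c y" "a' \<in> missing H k c y'" "b \<in> missing H k c z" "b' \<in> missing H k c z'"
    using s unfolding state_def by auto
  let ?F = "insert {w, z} (insert {w, z'} H)"
  have "\<forall>e\<in>H. w \<notin> e" by (simp add: H_def)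
  then obtain c1 where c1: "pec ?F k c1"
    "\<And>v m. v \<notin> {w, z, z'} \<Longrightarrow> m \<in> missing H k c v \<Longrightarrow> m \<in> missing ?F k c1 v"
    by (rule pec_divalent[OF m(1) _ _ _ _ m(4,5) assms(3)]) (use dist in auto)
  have xF: "\<forall>e\<in>?F. x \<notin> e" using dist by (auto simp: H_def)
  have aF: "a \<in> missing ?F k c1 y" "a' \<in> missing ?F k c1 y'" using c1(2) m(2,3) dist by auto
  obtain c2 where "pec (insert {x, y} (insert {x, y'} ?F)) k c2"
    by (rule pec_divalent[OF c1(1) xF _ _ _ aF assms(2)]) (use dist in auto)
  then have "pec E k c2" by (simp only: E_eq[symmetric])
  then show False using not_colourable unfolding colourable_def by blast
qed

text \<open>If \<open>y\<close> and \<open>z\<close> miss the same colour, the edge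
  \<open>yz\<close> can take it and sets its old colour free at both ends.\<close>

lemma recolour:
  assumes s: "state c i a a' a b'"
  shows "\<exists>c. state c a i a' i b'"
proof -
  define c' where "c' = c({y, z} := a)"
  have m: "pec H k c" "c {y, z} = i" "a \<in> missing H k c y" "a' \<in> missing H k c y'" "a \<in> missing H k c z" "b' \<in> missing H k c z'"
    using s unfolding state_def by auto
  have sub: "H - {{y, z}} \<subseteq> H" by blast
  have "pec H k c'"
    unfolding c'_def by (rule pec_insert[OF pec_subset[OF m(1) sub]]) (use m in \<open>auto simp: missing_def\<close>)
  moreover have "i \<in> missing H k c' v" if v: "v \<in> {y, z}" for v
  proof (rule missingI)
    show "i < k" using state_less[OF s] by simp
    fix e assume e: "e \<in> H" "v \<in> e"
    show "c' e \<noteq> i"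
    proof (cases "e = {y, z}")
      case True
      then show ?thesis using state_neq[OF s] by (simp add: c'_def)
    next
      case False
      then show ?thesis using pecD[OF m(1) e(1) yz_H e(2) v] m(2) by (auto simp: c'_def)
    qed
  qed
  moreover have "n \<in> missing H k c' v" if "v \<notin> {y, z}" "n \<in> missing H k c v" for v n
    using that unfolding missing_def c'_def by auto
  ultimately have "state c' a i a' i b'" unfolding state_def using m neqs by (simp add: c'_def)
  then show ?thesis by blast
qed

text \<open>The effect of a Kempe change on the state, where \<open>L\<close> is the chain through
  \<open>p\<close>. An edge \<open>yz\<close> of one of the two colours keeps \<open>y\<close> and
  \<open>z\<close> on a common chain, and a chain with end \<open>p\<close> has at most one other
  end.\<close>

lemma swap:
  assumes s: "state c i a a' b b'" and al: "\<alpha> < k" "\<beta> < k"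
  obtains L c' where "L p" "i \<in> {\<alpha>, \<beta>} \<Longrightarrow> L y \<longleftrightarrow> L z"
    "state c' (if L y then flip \<alpha> \<beta> i else i) (if L y then flip \<alpha> \<beta> a else a) (if L y' then flip \<alpha> \<beta> a' else a')
      (if L z then flip \<alpha> \<beta> b else b) (if L z' then flip \<alpha> \<beta> b' else b')"
    "\<And>u v. L u \<Longrightarrow> L v \<Longrightarrow> u \<noteq> p \<Longrightarrow> v \<noteq> p \<Longrightarrow> missing H k c p \<inter> {\<alpha>, \<beta>} \<noteq> {} \<Longrightarrow>
      missing H k c u \<inter> {\<alpha>, \<beta>} \<noteq> {} \<Longrightarrow> missing H k c v \<inter> {\<alpha>, \<beta>} \<noteq> {} \<Longrightarrow> u = v"
proof -
  define L where "L = linked H c \<alpha> \<beta> p"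
  define c' where "c' = kswap H c \<alpha> \<beta> p"
  have m: "pec H k c" "c {y, z} = i" "a \<in> missing H k c y" "a' \<in> missing H k c y'" "b \<in> missing H k c z" "b' \<in> missing H k c z'"
    using s unfolding state_def by auto
  have mem: "(if L v then flip \<alpha> \<beta> n else n) \<in> missing H k c' v" if "n \<in> missing H k c v" for v n
    unfolding c'_def L_def using missing_kswap[OF H al, of c p v] that by simp
  show thesis
  proof (rule that[of L c'])
    show "L p" by (simp add: L_def)
    show "L y \<longleftrightarrow> L z" if "i \<in> {\<alpha>, \<beta>}"
    proof -
      have "kadj H c \<alpha> \<beta> y z" using yz_H m(2) that by (simp add: kadj_def)
      then have yz: "linked H c \<alpha> \<beta> y z" by (simp add: linked_def r_into_rtranclp)
      show ?thesis unfolding L_def using linked_trans[OF _ yz] linked_trans[OF _ linked_sym[OF yz]] by metis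
    qed
    have "c' {y, z} = (if L y then flip \<alpha> \<beta> i else i)"
      unfolding c'_def L_def using kswap_at[OF H yz_H, of y c \<alpha> \<beta> p] m(2) by simp
    then show "state c' (if L y then flip \<alpha> \<beta> i else i) (if L y then flip \<alpha> \<beta> a else a) (if L y' then flip \<alpha> \<beta> a' else a')
      (if L z then flip \<alpha> \<beta> b else b) (if L z' then flip \<alpha> \<beta> b' else b')"
      unfolding state_def using pec_kswap[OF H m(1) al] mem m by (simp add: c'_def)
    show "u = v" if "L u" "L v" "u \<noteq> p" "v \<noteq> p" "missing H k c p \<inter> {\<alpha>, \<beta>} \<noteq> {}"
      "missing H k c u \<inter> {\<alpha>, \<beta>} \<noteq> {}" "missing H k c v \<inter> {\<alpha>, \<beta>} \<noteq> {}" for u v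
      by (rule linked_ends[OF H m(1) that(1,2)[unfolded L_def]]) (use that in auto)
  qed
qed

lemma state_missing:
  assumes "state c i a a' b b'"
  shows "a \<in> {\<alpha>, \<beta>} \<Longrightarrow> missing H k c y \<inter> {\<alpha>, \<beta>} \<noteq> {}" "a' \<in> {\<alpha>, \<beta>} \<Longrightarrow> missing H k c y' \<inter> {\<alpha>, \<beta>} \<noteq> {}"
    "b \<in> {\<alpha>, \<beta>} \<Longrightarrow> missing H k c z \<inter> {\<alpha>, \<beta>} \<noteq> {}" "b' \<in> {\<alpha>, \<beta>} \<Longrightarrow> missing H k c z' \<inter> {\<alpha>, \<beta>} \<noteq> {}"
  using assms unfolding state_def by blast+

text \<open>The chain starts in \<open>y\<close>, which misses \<open>a\<close>, so at most one of
  those among \<open>y'\<close>, \<open>z\<close>, \<open>z'\<close> that miss \<open>a\<close> or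
  \<open>\<beta>\<close> lies on it. The colour of \<open>yz\<close> is neither of the two and
  stays.\<close>

lemma swap_y:
  assumes s: "state c i a a' b b'" and be: "\<beta> < k" "a \<noteq> \<beta>" "i \<noteq> \<beta>"
  obtains L c' where
    "state c' i \<beta> (if L y' then flip a \<beta> a' else a') (if L z then flip a \<beta> b else b) (if L z' then flip a \<beta> b' else b')"
    "\<not> (L y' \<and> L z \<and> a' \<in> {a, \<beta>} \<and> b \<in> {a, \<beta>})" "\<not> (L y' \<and> L z' \<and> a' \<in> {a, \<beta>} \<and> b' \<in> {a, \<beta>})"
    "\<not> (L z \<and> L z' \<and> b \<in> {a, \<beta>} \<and> b' \<in> {a, \<beta>})"
proof -
  have a: "a < k" using state_less[OF s] by simp
  obtain L c' where L: "L y"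
    "state c' (if L y then flip a \<beta> i else i) (if L y then flip a \<beta> a else a) (if L y' then flip a \<beta> a' else a')
      (if L z then flip a \<beta> b else b) (if L z' then flip a \<beta> b' else b')"
    "\<And>u v. L u \<Longrightarrow> L v \<Longrightarrow> u \<noteq> y \<Longrightarrow> v \<noteq> y \<Longrightarrow> missing H k c y \<inter> {a, \<beta>} \<noteq> {} \<Longrightarrow>
      missing H k c u \<inter> {a, \<beta>} \<noteq> {} \<Longrightarrow> missing H k c v \<inter> {a, \<beta>} \<noteq> {} \<Longrightarrow> u = v"
    using swap[OF s a be(1), of y] by metis
  have "flip a \<beta> i = i" "flip a \<beta> a = \<beta>" using state_neq[OF s] be by (auto simp: flip_def)
  note st = L(2)[unfolded this if_P[OF L(1)]]
  have my: "missing H k c y \<inter> {a, \<beta>} \<noteq> {}" using state_missing(1)[OF s] by simp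
  note mis = state_missing(2-4)[OF s, of a \<beta>]
  show thesis
    by (rule that[OF st]) (use L(3)[OF _ _ _ _ my] mis neqs in metis)+
qed

lemma flipped: "two_divalent E k w z z' x y y'"
proof
  show "{z, y} \<in> E" using yz by (simp add: insert_commute)
qed (use E not_colourable k4 dist x_edges w_edges degs in auto)

lemma state_flipped:
  "two_divalent.state E k w z z' x y y' c i b b' a a' \<longleftrightarrow> state c i a a' b b'"
proof -
  interpret f: two_divalent E k w z z' x y y' by (rule flipped)
  have "f.H = H" unfolding f.H_def H_def by auto
  then show ?thesis unfolding f.state_def state_def by (auto simp: insert_commute)
qed

text \<open>A swap of \<open>a\<close> and \<open>b\<close> on the chain of \<open>y\<close> does
  not change \<open>b'\<close>. If \<open>y'\<close> is on the chain, then \<open>y\<close>,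
  \<open>y'\<close> and \<open>z\<close> all miss \<open>b\<close> afterwards, and recolouring
  \<open>yz\<close> separates both pairs; otherwise both pairs differ at once.\<close>

lemma third_colour:
  assumes s: "state c i a a b b'" and ne: "b \<noteq> b'" "a \<noteq> b" "b' \<noteq> i" "b' \<noteq> a"
  shows False
proof -
  note n = state_neq[OF s] state_less[OF s]
  obtain L c' where L: "state c' i b (if L y' then flip a b a else a) (if L z then flip a b b else b) (if L z' then flip a b b' else b')"
    "\<not> (L y' \<and> L z \<and> a \<in> {a, b} \<and> b \<in> {a, b})"
    using swap_y[OF s, of b] n ne by metis
  have f: "flip a b a = b" "flip a b b = a" "flip a b b' = b'" using ne by (auto simp: flip_def)
  note st = L(1)[unfolded f]
  consider "L y'" "\<not> L z" | "\<not> L y'" "L z" | "\<not> L y'" "\<not> L z" using L(2) by blast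
  then show False
  proof cases
    case 1
    then have "state c' i b b b b'" using st by simp
    then obtain c'' where "state c'' b i b i b'" using recolour by blast
    then show ?thesis using not_extendable n(2) ne(3) by metis
  next
    case 2
    then show ?thesis using not_extendable[OF st] ne by simp
  next
    case 3
    then show ?thesis using not_extendable[OF st] ne by simp
  qed
qed

text \<open>A fourth colour \<open>d\<close>, which exists because \<open>k\<close> is at least 4,
  is swapped with \<open>a\<close> on the chain of \<open>y'\<close>. Unless the result extends,
  \<open>z\<close> and \<open>z'\<close> keep \<open>a\<close>, and with the two sides exchanged
  this is the situation of \<open>third_colour\<close>.\<close>

lemma no_three_equal:
  assumes s: "state c i b a a a" and ne: "a \<noteq> b"
  shows False
proof -
  interpret f: two_divalent E k w z z' x y y' by (rule flipped)
  note n = state_neq[OF s] state_less[OF s]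
  have "card {a, b, i} < card {..<k}" using k4 card_insert_le_m1[of 3 "{b, i}" a] card_insert_le_m1[of 2 "{i}" b] by simp
  then obtain d where d: "d < k" "d \<notin> {a, b, i}"
    by (metis card_mono finite.emptyI finite_insert lessThan_iff not_le subsetI)
  obtain L c' where L: "L y'"
    "state c' (if L y then flip a d i else i) (if L y then flip a d b else b) (if L y' then flip a d a else a)
      (if L z then flip a d a else a) (if L z' then flip a d a else a)"
    "\<And>u v. L u \<Longrightarrow> L v \<Longrightarrow> u \<noteq> y' \<Longrightarrow> v \<noteq> y' \<Longrightarrow> missing H k c y' \<inter> {a, d} \<noteq> {} \<Longrightarrow>
      missing H k c u \<inter> {a, d} \<noteq> {} \<Longrightarrow> missing H k c v \<inter> {a, d} \<noteq> {} \<Longrightarrow> u = v"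
    using swap[OF s, of a d y'] n d by metis
  have f: "flip a d a = d" "flip a d b = b" "flip a d i = i" using ne d n by (auto simp: flip_def)
  note st = L(2)[unfolded f if_P[OF L(1)] if_cancel]
  have "\<not> (L z \<and> L z')"
    using L(3) state_missing(2-4)[OF s, of a d] neqs by blast
  then consider "L z" "\<not> L z'" | "\<not> L z" "L z'" | "\<not> L z" "\<not> L z'" by blast
  then show False
  proof cases
    case 1
    then show ?thesis using not_extendable[OF st] d by simp
  next
    case 2
    then show ?thesis using not_extendable[OF st] d by simp
  next
    case 3
    then have "f.state c' i a a b d" using st state_flipped by simp
    then show ?thesis using f.third_colour[of c' i a b d] d ne by auto
  qed
qed

text \<open>By \<open>third_colour\<close> the only alternative is \<open>b' = a\<close>. The chain
  of \<open>y\<close> for \<open>a\<close> and \<open>b\<close> then reaches at most one of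
  \<open>y'\<close>, \<open>z\<close>, \<open>z'\<close>; each of the four outcomes extends,
  possibly after recolouring \<open>yz\<close>, or shows three equal colours.\<close>

lemma only_colour:
  assumes s: "state c i a a b b'" and ne: "b \<noteq> b'" "a \<noteq> b"
  shows "b' = i"
proof (rule ccontr)
  assume nei: "b' \<noteq> i"
  then have [simp]: "b' = a" using third_colour[OF s ne] by blast
  note n = state_neq[OF s] state_less[OF s]
  obtain L c' where L: "state c' i b (if L y' then flip a b a else a) (if L z then flip a b b else b) (if L z' then flip a b a else a)"
    "\<not> (L y' \<and> L z \<and> a \<in> {a, b} \<and> b \<in> {a, b})" "\<not> (L y' \<and> L z' \<and> a \<in> {a, b} \<and> a \<in> {a, b})"
      "\<not> (L z \<and> L z' \<and> b \<in> {a, b} \<and> a \<in> {a, b})"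
    using swap_y[OF s[unfolded \<open>b' = a\<close>], of b] n ne by metis
  have f: "flip a b a = b" "flip a b b = a" using ne by (auto simp: flip_def)
  note st = L(1)[unfolded f]
  consider "L y'" "\<not> L z" "\<not> L z'" | "\<not> L y'" "L z" "\<not> L z'" | "\<not> L y'" "\<not> L z" "L z'" | "\<not> L y'" "\<not> L z" "\<not> L z'"
    using L(2-4) by blast
  then show False
  proof cases
    case 1
    then have "state c' i b b b a" using st by simp
    then obtain c'' where "state c'' b i b i a" using recolour by blast
    then show ?thesis using not_extendable n(1,2) by metis
  next
    case 2
    then have "state c' i b a a a" using st by simp
    then show ?thesis using no_three_equal ne by metis
  next
    case 3
    then have "state c' i b a b b" using st by simp
    then obtain c'' where "state c'' b i a i b" using recolour by blast
    then show ?thesis using not_extendable n(1,2) by metis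
  next
    case 4
    then show ?thesis using not_extendable[OF st] ne by simp
  qed
qed

text \<open>Now \<open>b' = i\<close>, the colour of \<open>yz\<close>, so a chain for
  \<open>a\<close> and \<open>i\<close> contains \<open>y\<close> and \<open>z\<close> together or
  not at all. After a swap on the chain of \<open>z'\<close> the state extends if the chain contains
  one of \<open>y\<close>, \<open>y'\<close>; it cannot contain both, and if it contains neither,
  \<open>only_colour\<close> would force \<open>a = i\<close>.\<close>

lemma no_state_distinct:
  assumes s: "state c i a a b b'" and ne: "b \<noteq> b'" "a \<noteq> b"
  shows False
proof -
  have b': "b' = i" by (rule only_colour[OF assms])
  note n = state_neq[OF s] state_less[OF s]
  obtain L c' where L: "L z'" "L y \<longleftrightarrow> L z"
    "state c' (if L y then flip a i i else i) (if L y then flip a i a else a) (if L y' then flip a i a else a)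
      (if L z then flip a i b else b) (if L z' then flip a i i else i)"
    "\<And>u v. L u \<Longrightarrow> L v \<Longrightarrow> u \<noteq> z' \<Longrightarrow> v \<noteq> z' \<Longrightarrow> missing H k c z' \<inter> {a, i} \<noteq> {} \<Longrightarrow>
      missing H k c u \<inter> {a, i} \<noteq> {} \<Longrightarrow> missing H k c v \<inter> {a, i} \<noteq> {} \<Longrightarrow> u = v"
    using swap[OF s[unfolded b'], of a i z'] n by (metis insertI1 insertI2)
  have f: "flip a i a = i" "flip a i i = a" "flip a i b = b" using ne b' n by (auto simp: flip_def)
  note st = L(3)[unfolded f if_P[OF L(1)] if_cancel]
  have "\<not> (L y \<and> L y')"
    using L(4)[of y y'] state_missing[OF s, of a i] neqs b' by auto
  then consider "L y" "\<not> L y'" | "\<not> L y" "L y'" | "\<not> L y" "\<not> L y'" by blast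
  then show False
  proof cases
    case 1
    then show ?thesis using not_extendable[OF st] n ne by auto
  next
    case 2
    then show ?thesis using not_extendable[OF st] n ne by auto
  next
    case 3
    then have "state c' i a a b a" using st by simp
    then show ?thesis using only_colour[of c' i a b a] n ne by auto
  qed
qed

text \<open>The new case is \<open>a = b\<close>. Recolouring \<open>yz\<close> shows
  \<open>b' = i\<close>; then swapping \<open>a\<close> with a further colour \<open>d\<close> on
  the chain of \<open>z\<close> gives a state that extends or falls under
  \<open>no_state_distinct\<close>.\<close>

lemma no_state:
  assumes s: "state c i a a b b'" and ne: "b \<noteq> b'"
  shows False
proof (cases "a = b")
  case True
  note n = state_neq[OF s] state_less[OF s]
  have b': "b' = i"
  proof (rule ccontr)
    assume "b' \<noteq> i"
    moreover obtain c' where "state c' a i a i b'" using recolour s True by blast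
    ultimately show False using not_extendable n(1) by metis
  qed
  have "card {a, i} < card {..<k}" using k4 card_insert_le_m1[of 2 "{i}" a] by simp
  then obtain d where d: "d < k" "d \<notin> {a, i}"
    by (metis card_mono finite.emptyI finite_insert lessThan_iff not_le subsetI)
  obtain L c' where L: "L z"
    "state c' (if L y then flip a d i else i) (if L y then flip a d a else a) (if L y' then flip a d a else a)
      (if L z then flip a d a else a) (if L z' then flip a d i else i)"
    "\<And>u v. L u \<Longrightarrow> L v \<Longrightarrow> u \<noteq> z \<Longrightarrow> v \<noteq> z \<Longrightarrow> missing H k c z \<inter> {a, d} \<noteq> {} \<Longrightarrow>
      missing H k c u \<inter> {a, d} \<noteq> {} \<Longrightarrow> missing H k c v \<inter> {a, d} \<noteq> {} \<Longrightarrow> u = v"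
    using swap[OF s[unfolded b' True[symmetric]], of a d z] n d by metis
  have f: "flip a d a = d" "flip a d i = i" using d n by (auto simp: flip_def)
  note st = L(2)[unfolded f if_P[OF L(1)] if_cancel]
  have "\<not> (L y \<and> L y')"
    using L(3)[of y y'] state_missing[OF s, of a d] neqs True by auto
  then consider "L y" "\<not> L y'" | "\<not> L y" "L y'" | "\<not> L y" "\<not> L y'" by blast
  then show False
  proof cases
    case 1
    then show ?thesis using not_extendable[OF st] d by auto
  next
    case 2
    then show ?thesis using not_extendable[OF st] d by auto
  next
    case 3
    then have "state c' i a a d i" using st by simp
    then show ?thesis using no_state_distinct[of c' i a d i] d by auto
  qed
qed (use no_state_distinct[OF s ne] in simp)

text \<open>Criticality is applied to the deletion of \<open>x\<close> alone: in the resulting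
  colouring the two edges at \<open>w\<close> have different colours, and these become missing at
  \<open>z\<close> and \<open>z'\<close> when \<open>w\<close> is deleted as well. So a state with
  different colours at \<open>z\<close> and \<open>z'\<close> exists.\<close>

theorem not_critical: "\<not> critical_edges k E"
proof
  assume cr: "critical_edges k E"
  have "{x, y} \<in> E" using in_E[of "{x, y}"] by simp
  have "{x, y} \<notin> {e \<in> E. x \<notin> e}" by simp
  with \<open>{x, y} \<in> E\<close> have "{e \<in> E. x \<notin> e} \<noteq> E" by (rule_tac notI) simp
  then have "{e \<in> E. x \<notin> e} \<subset> E" by (rule psubsetI[OF Collect_restrict])
  then have "colourable k {e \<in> E. x \<notin> e}" using cr by (simp add: critical_edges_def)
  then obtain c where c: "pec {e \<in> E. x \<notin> e} k c"
    unfolding colourable_def by (rule exE)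
  let ?F = "{e \<in> E. x \<notin> e}"
  have cH: "pec H k c" by (rule pec_subset[OF c]) (auto simp: H_def)
  have wz: "{w, z} \<in> ?F" "{w, z'} \<in> ?F" unfolding in_E mem_Collect_eq using dist by auto
  have mis: "c {w, v} \<in> missing H k c v" if "{w, v} \<in> ?F" for v
  proof (rule missingI)
    show "c {w, v} < k" by (rule pec_range[OF c that])
    fix e assume e: "e \<in> H" "v \<in> e"
    then have "e \<in> ?F" "e \<noteq> {w, v}" by (auto simp: H_def)
    then show "c e \<noteq> c {w, v}" using pecD[OF c _ that e(2)] by auto
  qed
  have ne: "c {w, z} \<noteq> c {w, z'}"
  proof
    assume "c {w, z} = c {w, z'}"
    then have "{w, z} = {w, z'}" using pecD[OF c wz, of w] by simp
    then show False using dist by (auto simp: doubleton_eq_iff)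
  qed
  obtain a where a: "missing H k c y = {a}"
    using missing_singleton[OF cH, of y] by auto
  obtain a' where a': "missing H k c y' = {a'}"
    using missing_singleton[OF cH, of y'] by auto
  from a a' have s: "state c (c {y, z}) a a' (c {w, z}) (c {w, z'})"
    unfolding state_def using cH mis[OF wz(1)] mis[OF wz(2)] by simp
  show False
  proof (cases "a = a'")
    case True
    show ?thesis by (rule no_state[OF s[folded True] ne])
  qed (use not_extendable[OF s] ne in simp)
qed

end

section \<open>Components of the complement of a theta curve; cross-cuts\<close>

section \<open>Theta curves\<close>

text \<open>A connected set that meets both \<open>A\<close> and its complement meets
  \<open>frontier A\<close>, so \<open>A\<close> cannot grow inside \<open>U\<close>.\<close>

lemma componentsI_frontier:
  fixes A U :: "'a::topological_space set"
  assumes "connected A" "A \<noteq> {}" "A \<subseteq> U" "frontier A \<inter> U = {}"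
  shows "A \<in> components U"
  unfolding in_components_maximal
proof (intro conjI allI impI)
  fix D assume D: "D \<noteq> {} \<and> A \<subseteq> D \<and> D \<subseteq> U \<and> connected D"
  show "D = A"
  proof (rule ccontr)
    assume "D \<noteq> A"
    then have "D \<inter> A \<noteq> {}" "D - A \<noteq> {}" using D assms(2) by auto
    then have "D \<inter> frontier A \<noteq> {}" using connected_Int_frontier D by blast
    then show False using D assms(4) by blast
  qed
qed (use assms in auto)

lemma components_eqI:
  assumes "\<And>A. A \<in> \<A> \<Longrightarrow> A \<in> components U" "U \<subseteq> \<Union>\<A>"
  shows "components U = \<A>"
proof
  show "\<A> \<subseteq> components U" using assms(1) by blast
  show "components U \<subseteq> \<A>"
  proof
    fix C assume C: "C \<in> components U"
    then obtain x where x: "x \<in> C" "x \<in> U" using in_components_nonempty in_components_subset by blast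
    then obtain A where A: "A \<in> \<A>" "x \<in> A" using assms(2) by blast
    then have "A = C" using components_eq[OF assms(1)[OF A(1)] C] x by blast
    then show "C \<in> \<A>" using A by simp
  qed
qed

text \<open>Arcs as point sets with given ends: without a parametrization, joining and splitting are
  just unions and reversal is an exchange of the ends.\<close>

definition arc_between :: "complex \<Rightarrow> complex \<Rightarrow> complex set \<Rightarrow> bool" where
  "arc_between a b P \<longleftrightarrow> (\<exists>g. arc g \<and> pathstart g = a \<and> pathfinish g = b \<and> path_image g = P)"

lemma arc_between_sym: "arc_between a b P \<Longrightarrow> arc_between b a P"
  unfolding arc_between_def by (metis arc_reversepath path_image_reversepath pathfinish_reversepath pathstart_reversepath)

lemma arc_betweenD:
  assumes "arc_between a b P"
  shows "a \<in> P" "b \<in> P" "a \<noteq> b" "connected P" "compact P" "closed P"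
    "connected (P - {a, b})" "P - {a, b} \<noteq> {}"
proof -
  obtain g where g: "arc g" "pathstart g = a" "pathfinish g = b" "path_image g = P"
    using assms unfolding arc_between_def by blast
  show "a \<in> P" "b \<in> P" using g by auto
  show "a \<noteq> b" using g arc_distinct_ends by blast
  show "connected P" "compact P" "closed P"
    using g connected_arc_image compact_arc_image closed_arc_image by blast+
  show "connected (P - {a, b})" "P - {a, b} \<noteq> {}"
    using connected_simple_path_endless[of g] nonempty_simple_path_endless[of g] arc_imp_simple_path[OF g(1)] g
    by auto
qed

lemma arc_between_join:
  assumes "arc_between a b P" "arc_between b c Q" "P \<inter> Q \<subseteq> {b}"
  shows "arc_between a c (P \<union> Q)"
proof -
  obtain g where g: "arc g" "pathstart g = a" "pathfinish g = b" "path_image g = P"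
    using assms unfolding arc_between_def by blast
  obtain h where h: "arc h" "pathstart h = b" "pathfinish h = c" "path_image h = Q"
    using assms unfolding arc_between_def by blast
  have "arc (g +++ h)" by (rule arc_join) (use g h assms in auto)
  then show ?thesis unfolding arc_between_def using g h
    by (intro exI[of _ "g +++ h"]) (simp add: path_image_join)
qed

lemma arc_between_closure:
  assumes "arc_between a b P"
  shows "P \<subseteq> closure (P - {a, b})"
proof
  note P = arc_betweenD[OF assms]
  fix x assume "x \<in> P"
  moreover have "\<nexists>c. P = {c}" using P(1-3) by blast
  ultimately have "x islimpt P" using connected_imp_perfect[OF P(4)] by blast
  then have "x islimpt (insert a (insert b (P - {a, b})))" by (rule islimpt_subset) auto
  then have "x islimpt (P - {a, b})" by (simp add: islimpt_insert)
  then show "x \<in> closure (P - {a, b})" unfolding closure_def by blast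
qed

lemma jordan_two_arcs:
  assumes P: "arc_between a b P" and Q: "arc_between a b Q" and PQ: "P \<inter> Q = {a, b}"
  obtains I J where "components (- (P \<union> Q)) = {I, J}" "I \<noteq> J" "I \<inter> J = {}" "I \<union> J = - (P \<union> Q)"
    "frontier I = P \<union> Q" "frontier J = P \<union> Q" "open I" "open J" "connected I" "connected J" "I \<noteq> {}" "J \<noteq> {}"
proof -
  obtain g where g: "arc g" "pathstart g = a" "pathfinish g = b" "path_image g = P"
    using P unfolding arc_between_def by blast
  obtain h where h: "arc h" "pathstart h = b" "pathfinish h = a" "path_image h = Q"
    using arc_between_sym[OF Q] unfolding arc_between_def by blast
  have "simple_path (g +++ h)" by (rule simple_path_join_loop) (use g h PQ in auto)
  moreover have "pathfinish (g +++ h) = pathstart (g +++ h)" using g h by simp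
  moreover have im: "path_image (g +++ h) = P \<union> Q" using g h by (simp add: path_image_join)
  ultimately obtain I J where IJ: "I \<noteq> {}" "open I" "connected I" "J \<noteq> {}" "open J" "connected J"
    "I \<inter> J = {}" "I \<union> J = - (P \<union> Q)" "frontier I = P \<union> Q" "frontier J = P \<union> Q"
    using Jordan_curve[of "g +++ h"] by metis
  have "components (- (P \<union> Q)) = {I, J}"
  proof (rule components_eqI)
    fix A assume "A \<in> {I, J}"
    then have A: "connected A" "A \<noteq> {}" "A \<subseteq> - (P \<union> Q)" "frontier A \<inter> - (P \<union> Q) = {}" using IJ by auto
    show "A \<in> components (- (P \<union> Q))" by (rule componentsI_frontier[OF A])
  qed (use IJ in auto)
  moreover have "I \<noteq> J" using IJ by auto
  ultimately show thesis using that IJ by blast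
qed

text \<open>The open arc \<open>R - {a, b}\<close> is connected and therefore lies on one side of
  the closed curve \<open>P \<union> Q\<close>. The other side keeps its frontier and so remains a
  component when \<open>R\<close> is added.\<close>

lemma theta_side:
  assumes P: "arc_between a b P" and Q: "arc_between a b Q" and R: "arc_between a b R"
    and PQ: "P \<inter> Q = {a, b}" and PR: "P \<inter> R = {a, b}" and QR: "Q \<inter> R = {a, b}"
  obtains A B where "components (- (P \<union> Q)) = {A, B}" "A \<inter> B = {}" "A \<union> B = - (P \<union> Q)"
    "frontier A = P \<union> Q" "frontier B = P \<union> Q" "open B" "connected A" "connected B"
    "R - {a, b} \<subseteq> B" "A \<in> components (- (P \<union> Q \<union> R))"
proof -
  note goal = that
  have R': "connected (R - {a, b})" "R - {a, b} \<noteq> {}" "R - {a, b} \<subseteq> - (P \<union> Q)"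
    using arc_betweenD[OF R] PR QR by auto
  have main: thesis if IJ: "components (- (P \<union> Q)) = {I, J}" "I \<noteq> J" "I \<inter> J = {}" "I \<union> J = - (P \<union> Q)"
    "frontier I = P \<union> Q" "frontier J = P \<union> Q" "open J" "connected I" "connected J" "I \<noteq> {}"
    and RJ: "(R - {a, b}) \<inter> J \<noteq> {}" for I J
  proof -
    have J: "J \<in> components (- (P \<union> Q))" using IJ(1) by simp
    have "R - {a, b} \<subseteq> J"
      by (rule components_maximal[OF J R'(1,3)]) (simp only: Int_commute[of J] RJ not_False_eq_True)
    moreover have "{a, b} \<subseteq> P" using PQ by blast
    ultimately have "I \<inter> R = {}" using IJ(3,4) by blast
    then have "I \<subseteq> - (P \<union> Q \<union> R)" using IJ(4) by blast
    moreover have "frontier I \<inter> - (P \<union> Q \<union> R) = {}" using IJ(5) by blast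
    ultimately have "I \<in> components (- (P \<union> Q \<union> R))"
      using componentsI_frontier[OF IJ(8) IJ(10)] by blast
    with IJ \<open>R - {a, b} \<subseteq> J\<close> show thesis using goal[of I J] by simp
  qed
  obtain I J where IJ: "components (- (P \<union> Q)) = {I, J}" "I \<noteq> J" "I \<inter> J = {}" "I \<union> J = - (P \<union> Q)"
    "frontier I = P \<union> Q" "frontier J = P \<union> Q" "open I" "open J" "connected I" "connected J" "I \<noteq> {}" "J \<noteq> {}"
    by (rule jordan_two_arcs[OF P Q PQ])
  consider "(R - {a, b}) \<inter> J \<noteq> {}" | "(R - {a, b}) \<inter> I \<noteq> {}" using R' IJ(4) by blast
  then show thesis
  proof cases
    case 1
    then show thesis by (intro main[of I J]) (use IJ in auto)
  next
    case 2
    then show thesis by (intro main[of J I]) (use IJ in \<open>auto simp: insert_commute\<close>)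
  qed
qed

text \<open>Applied to frontiers, in order to tell the components of the complement apart.\<close>

lemma Un_neq:
  assumes "X - S \<noteq> {}" "X \<inter> Y = S" "X \<inter> Z = S" "X \<subseteq> L"
  shows "L \<noteq> Y \<union> Z"
proof -
  obtain x where "x \<in> X" "x \<notin> S" using assms(1) by blast
  then have "x \<in> L" "x \<notin> Y \<union> Z" using assms(2-4) by blast+
  then show ?thesis by blast
qed

text \<open>If a fourth component existed, neither of the closed curves \<open>P \<union> R\<close>, \<open>Q \<union> R\<close> would separate it
  from the component bounded by \<open>P \<union> Q\<close>; by Janiszewski's theorem their union does not either.\<close>

theorem theta_components:
  assumes P: "arc_between a b P" and Q: "arc_between a b Q" and R: "arc_between a b R"
    and PQ: "P \<inter> Q = {a, b}" and PR: "P \<inter> R = {a, b}" and QR: "Q \<inter> R = {a, b}"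
  obtains A B C where "components (- (P \<union> Q \<union> R)) = {A, B, C}"
    "frontier A = Q \<union> R" "frontier B = P \<union> R" "frontier C = P \<union> Q" "C \<in> components (- (P \<union> Q))"
proof -
  let ?U = "- (P \<union> Q \<union> R)"
  obtain C C' where C: "components (- (P \<union> Q)) = {C, C'}" "C \<inter> C' = {}" "C \<union> C' = - (P \<union> Q)"
    "frontier C = P \<union> Q" "frontier C' = P \<union> Q" "open C'" "connected C" "connected C'" "R - {a, b} \<subseteq> C'" "C \<in> components ?U"
    using theta_side[OF P Q R PQ PR QR] .
  obtain B B' where B: "components (- (P \<union> R)) = {B, B'}" "B \<inter> B' = {}" "B \<union> B' = - (P \<union> R)"
    "frontier B = P \<union> R" "frontier B' = P \<union> R" "open B'" "connected B" "connected B'" "Q - {a, b} \<subseteq> B'" "B \<in> components (- (P \<union> R \<union> Q))"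
    using theta_side[OF P R Q PR PQ] QR by (metis inf_commute)
  obtain A A' where A: "components (- (Q \<union> R)) = {A, A'}" "A \<inter> A' = {}" "A \<union> A' = - (Q \<union> R)"
    "frontier A = Q \<union> R" "frontier A' = Q \<union> R" "open A'" "connected A" "connected A'" "P - {a, b} \<subseteq> A'" "A \<in> components (- (Q \<union> R \<union> P))"
    using theta_side[OF Q R P QR] PQ PR by (metis inf_commute)
  have Bc: "B \<in> components ?U" using B(10) by (simp add: Un_ac)
  have Ac: "A \<in> components ?U" using A(10) by (simp add: Un_ac)
  have ne: "P - {a, b} \<noteq> {}" "Q - {a, b} \<noteq> {}" "R - {a, b} \<noteq> {}"
    using arc_betweenD(8) P Q R by blast+
  have PQ': "Q \<inter> P = {a, b}" using PQ by (simp add: Int_commute)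
  have "frontier C \<noteq> frontier B" unfolding C(4) B(4) by (rule Un_neq[OF ne(2) PQ' QR]) blast
  then have CB: "C \<noteq> B" by blast
  have "frontier C \<noteq> frontier A" unfolding C(4) A(4) by (rule Un_neq[OF ne(1) PQ PR]) blast
  then have CA: "C \<noteq> A" by blast
  have "?U \<subseteq> \<Union>{A, B, C}"
  proof
    fix p assume p: "p \<in> ?U"
    show "p \<in> \<Union>{A, B, C}"
    proof (rule ccontr)
      assume np: "p \<notin> \<Union>{A, B, C}"
      obtain q where q: "q \<in> C" using in_components_nonempty[OF C(10)] by blast
      have qU: "q \<in> ?U" using in_components_subset[OF C(10)] q by blast
      have "C \<inter> B = {}" "C \<inter> A = {}" using components_nonoverlap[OF C(10)] Bc Ac CB CA by blast+
      then have "q \<in> B'" "q \<in> A'" using q qU B(3) A(3) by blast+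
      moreover have "p \<in> B'" "p \<in> A'" using p np B(3) A(3) by blast+
      ultimately have 1: "connected_component (- (P \<union> R)) p q" "connected_component (- (Q \<union> R)) p q"
        unfolding connected_component_def using A(3,8) B(3,8) by blast+
      \<comment> \<open>Janiszewski's theorem requires a connected intersection of the two closed
        curves; here it is the arc \<open>R\<close>.\<close>
      have cR: "(P \<union> R) \<inter> (Q \<union> R) = R" using PQ PR QR by blast
      have "connected_component (- ((P \<union> R) \<union> (Q \<union> R))) p q"
      proof (rule Janiszewski[OF _ _ _ 1])
        show "compact (P \<union> R)" "closed (Q \<union> R)" using arc_betweenD(5,6) P Q R by (blast intro: compact_Un closed_Un)+
        show "connected ((P \<union> R) \<inter> (Q \<union> R))" unfolding cR using arc_betweenD(4)[OF R] .
      qed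
      moreover have "(P \<union> R) \<union> (Q \<union> R) = P \<union> Q \<union> R" by blast
      ultimately obtain T where T: "connected T" "T \<subseteq> ?U" "p \<in> T" "q \<in> T"
        unfolding connected_component_def by auto
      have "T \<subseteq> C" by (rule components_maximal[OF C(10) T(1,2)]) (use q T in blast)
      then show False using T np by blast
    qed
  qed
  then have "components ?U = {A, B, C}" by (rule components_eqI[rotated]) (use Ac Bc C(10) in blast)
  moreover have "C \<in> components (- (P \<union> Q))" using C(1) by simp
  ultimately show thesis by (rule that[OF _ A(4) B(4) C(4)])
qed

text \<open>As its frontier is the closed curve \<open>P \<union> Q\<close>, the face
  \<open>F\<close> is one side of that curve. Of the three components of the theta curve,
  \<open>C\<close> is the other side, and the two others lie in \<open>F\<close> and replace it;
  they are new because their frontiers contain \<open>R\<close>. The remaining components of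
  \<open>- D\<close> are disjoint from \<open>R\<close> and survive.\<close>

theorem crosscut_components:
  assumes P: "arc_between a b P" and Q: "arc_between a b Q" and R: "arc_between a b R"
    and PQ: "P \<inter> Q = {a, b}" and D: "closed D" and PQD: "P \<union> Q \<subseteq> D"
    and F: "F \<in> components (- D)" "frontier F = P \<union> Q" and RF: "R - {a, b} \<subseteq> F"
  obtains A B where "components (- (D \<union> R)) = insert A (insert B (components (- D) - {F}))"
    "frontier A = Q \<union> R" "frontier B = P \<union> R" "A \<notin> components (- D)" "B \<notin> components (- D)" "A \<noteq> B"
proof -
  have FD: "F \<subseteq> - D" "connected F" "F \<noteq> {}"
    using in_components_subset[OF F(1)] in_components_connected[OF F(1)] in_components_nonempty[OF F(1)] by auto
  have ab: "a \<in> D" "b \<in> D" using PQ PQD by blast+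
  have PR: "P \<inter> R = {a, b}" and QR: "Q \<inter> R = {a, b}"
    using RF FD PQD arc_betweenD(1,2)[OF R] PQ by blast+
  obtain A B C where ABC: "components (- (P \<union> Q \<union> R)) = {A, B, C}"
    "frontier A = Q \<union> R" "frontier B = P \<union> R" "frontier C = P \<union> Q" "C \<in> components (- (P \<union> Q))"
    by (rule theta_components[OF P Q R PQ PR QR])
  have ne: "P - {a, b} \<noteq> {}" "Q - {a, b} \<noteq> {}" "R - {a, b} \<noteq> {}"
    using arc_betweenD(8) P Q R by blast+
  have comp: "A \<in> components (- (P \<union> Q \<union> R))" "B \<in> components (- (P \<union> Q \<union> R))" "C \<in> components (- (P \<union> Q \<union> R))"
    using ABC(1) by auto
  have PQ': "Q \<inter> P = {a, b}" and PR': "R \<inter> P = {a, b}" and QR': "R \<inter> Q = {a, b}"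
    using PQ PR QR by (simp_all add: Int_commute)
  have "frontier A \<noteq> frontier B" unfolding ABC(2,3) by (rule Un_neq[OF ne(2) PQ' QR]) blast
  moreover have "frontier A \<noteq> frontier C" unfolding ABC(2,4) by (rule Un_neq[OF ne(3) PR' QR']) blast
  moreover have "frontier B \<noteq> frontier C" unfolding ABC(3,4) by (rule Un_neq[OF ne(3) PR' QR']) blast
  ultimately have neq: "A \<noteq> B" "A \<noteq> C" "B \<noteq> C" by blast+
  have Fc: "F \<in> components (- (P \<union> Q))"
    by (rule componentsI_frontier) (use FD F(2) PQD in auto)
  have "C \<inter> R = {}" using in_components_subset[OF comp(3)] by blast
  then have "C \<noteq> F" using RF ne by blast
  obtain I J where IJ: "components (- (P \<union> Q)) = {I, J}" "I \<union> J = - (P \<union> Q)"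
    using jordan_two_arcs[OF P Q PQ] by metis
  have "F = I \<or> F = J" "C = I \<or> C = J" using Fc ABC(5) unfolding IJ(1) by simp_all
  then have FC: "F \<union> C = - (P \<union> Q)" using IJ(2) \<open>C \<noteq> F\<close> by (metis sup_commute)
  have CF: "C \<inter> F = {}" using components_nonoverlap[OF ABC(5) Fc] \<open>C \<noteq> F\<close> by blast
  have sub: "X \<subseteq> F" if "X \<in> {A, B}" for X
  proof -
    have X: "X \<in> components (- (P \<union> Q \<union> R))" "X \<noteq> C" using that comp neq by auto
    have "X \<inter> C = {}" using components_nonoverlap[OF X(1) comp(3)] X(2) by simp
    moreover have "X \<subseteq> - (P \<union> Q \<union> R)" using in_components_subset[OF X(1)] .
    ultimately show ?thesis using FC by blast
  qed
  have RD: "R - {a, b} \<noteq> {}" "R - {a, b} \<subseteq> - D" using ne RF FD by blast+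
  have new: "X \<in> components (- (D \<union> R))" if X: "X \<in> {A, B}" for X
  proof (rule componentsI_frontier)
    have Xc: "X \<in> components (- (P \<union> Q \<union> R))" using that comp by auto
    show "connected X" "X \<noteq> {}" using in_components_connected[OF Xc] in_components_nonempty[OF Xc] by auto
    show "X \<subseteq> - (D \<union> R)" using sub[OF X] FD(1) in_components_subset[OF Xc] by blast
    have "frontier X \<subseteq> D \<union> R" using X ABC(2,3) PQD by auto
    then show "frontier X \<inter> - (D \<union> R) = {}" by blast
  qed
  have old: "X \<in> components (- (D \<union> R))" if X: "X \<in> components (- D) - {F}" for X
  proof (rule componentsI_frontier)
    have Xc: "X \<in> components (- D)" using that by blast
    show "connected X" "X \<noteq> {}" using in_components_connected[OF Xc] in_components_nonempty[OF Xc] by auto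
    have "X \<inter> F = {}" using components_nonoverlap[OF Xc F(1)] X by blast
    then show "X \<subseteq> - (D \<union> R)" using in_components_subset[OF Xc] RF ab by blast
    have "frontier X \<subseteq> D" using frontier_of_components_closed_complement[OF D Xc] .
    then show "frontier X \<inter> - (D \<union> R) = {}" by blast
  qed
  have cover: "- (D \<union> R) \<subseteq> \<Union>(insert A (insert B (components (- D) - {F})))"
  proof
    fix x assume x: "x \<in> - (D \<union> R)"
    then have "x \<in> \<Union>(components (- D))" by simp
    then obtain X where X: "X \<in> components (- D)" "x \<in> X" by blast
    show "x \<in> \<Union>(insert A (insert B (components (- D) - {F})))"
    proof (cases "X = F")
      case True
      have "x \<in> \<Union>(components (- (P \<union> Q \<union> R)))" using x PQD by auto
      then have "x \<in> A \<union> B \<union> C" unfolding ABC(1) by blast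
      then show ?thesis using CF True X by blast
    qed (use X in blast)
  qed
  have eq: "components (- (D \<union> R)) = insert A (insert B (components (- D) - {F}))"
  proof (rule components_eqI[OF _ cover])
    fix X assume "X \<in> insert A (insert B (components (- D) - {F}))"
    then consider "X \<in> {A, B}" | "X \<in> components (- D) - {F}" by auto
    then show "X \<in> components (- (D \<union> R))" using new old by cases
  qed
  have nD: "X \<notin> components (- D)" if X: "X \<in> {A, B}" for X
  proof
    assume "X \<in> components (- D)"
    from frontier_of_components_closed_complement[OF D this] have "frontier X \<subseteq> D" .
    moreover have "R \<subseteq> frontier X" using X ABC(2,3) by auto
    ultimately have "R \<subseteq> D" by (rule subset_trans[rotated])
    then show False using RD by blast
  qed
  show thesis by (rule that[OF eq ABC(2,3) nD nD neq(1)]) simp_all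
qed

text \<open>The ends of an arc are limits of its inner points, which lie in \<open>F\<close>. This
  puts the ends of an ear on the boundary of the face that it crosses.\<close>

lemma crosscut_ends:
  assumes R: "arc_between a b R" and F: "F \<in> components (- D)" and RF: "R - {a, b} \<subseteq> F" and ab: "a \<in> D" "b \<in> D"
  shows "a \<in> frontier F" "b \<in> frontier F"
proof -
  have "R \<subseteq> closure F" using arc_between_closure[OF R] closure_mono[OF RF] by blast
  then have "a \<in> closure F" "b \<in> closure F" using arc_betweenD(1,2)[OF R] by blast+
  moreover have "a \<notin> F" "b \<notin> F" using in_components_subset[OF F] ab by blast+
  ultimately show "a \<in> frontier F" "b \<in> frontier F"
    unfolding frontier_def using interior_subset by blast+
qed

section \<open>Cutting and joining circuits\<close>

section \<open>Paths and circuits as vertex lists\<close>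

fun path_edges :: "'a list \<Rightarrow> 'a set set" where
  "path_edges (x # y # xs) = insert {x, y} (path_edges (y # xs))"
| "path_edges _ = {}"

lemma path_edges_append: "path_edges (xs @ v # ys) = path_edges (xs @ [v]) \<union> path_edges (v # ys)"
proof (induction xs)
  case Nil
  then show ?case by simp
next
  case (Cons x xs)
  then show ?case by (cases xs) auto
qed

lemma path_edges_snoc: "path_edges (xs @ [v, w]) = insert {v, w} (path_edges (xs @ [v]))"
  using path_edges_append[of xs v "[w]"] by simp

lemma path_edges_rev: "path_edges (rev xs) = path_edges xs"
proof (induction xs rule: path_edges.induct)
  case (1 x y xs)
  then show ?case using path_edges_snoc[of "rev xs" y x] by (simp add: insert_commute)
qed auto

lemma path_edges_subset: "e \<in> path_edges xs \<Longrightarrow> e \<subseteq> set xs"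
  by (induction xs rule: path_edges.induct) auto

lemma Union_path_edges: "2 \<le> length xs \<Longrightarrow> \<Union>(path_edges xs) = set xs"
proof (induction xs rule: path_edges.induct)
  case (1 x y xs)
  then show ?case by (cases xs) auto
qed auto

lemma finite_path_edges [simp]: "finite (path_edges xs)"
  by (induction xs rule: path_edges.induct) auto

lemma card_path_edges: "distinct xs \<Longrightarrow> card (path_edges xs) = length xs - 1"
proof (induction xs rule: path_edges.induct)
  case (1 x y xs)
  then have "{x, y} \<notin> path_edges (y # xs)" using path_edges_subset[of "{x, y}" "y # xs"] by auto
  then show ?case using 1 by simp
qed auto

text \<open>Consequences: the closing edge of a circuit is not an edge of the path that it closes,
  and two otherwise disjoint paths with common ends share no edge unless both are that single
  edge.\<close>

lemma path_edges_ends: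
  assumes "distinct xs" "{hd xs, last xs} \<in> path_edges xs"
  shows "length xs = 2"
proof (cases xs rule: path_edges.cases)
  case (1 x y ys)
  show ?thesis
  proof (cases ys)
    case (Cons z zs)
    have "{x, last (z # zs)} \<noteq> {x, y}"
      using assms(1) 1 Cons by (metis distinct.simps(2) doubleton_eq_iff last_in_set list.distinct(1))
    moreover have "{x, last (z # zs)} \<notin> path_edges (y # ys)"
      using path_edges_subset[of "{x, last (z # zs)}" "y # ys"] assms(1) 1 by auto
    ultimately show ?thesis using assms(2) 1 Cons by simp
  qed (use 1 in simp)
qed (use assms in auto)

lemma path_edges_successively:
  "successively (\<lambda>u v. {u, v} \<in> F) xs \<longleftrightarrow> path_edges xs \<subseteq> F"
  by (induction xs rule: path_edges.induct) auto

lemma path_edges_conv_nth: "path_edges xs = {{xs ! i, xs ! Suc i} | i. Suc i < length xs}"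
proof (induction xs rule: path_edges.induct)
  case (1 x y xs)
  have "{{(x # y # xs) ! i, (x # y # xs) ! Suc i} | i. Suc i < length (x # y # xs)} =
    insert {x, y} {{(y # xs) ! i, (y # xs) ! Suc i} | i. Suc i < length (y # xs)}" (is "?L = ?R")
  proof
    show "?L \<subseteq> ?R"
    proof
      fix e assume "e \<in> ?L"
      then obtain i where "e = {(x # y # xs) ! i, (x # y # xs) ! Suc i}" "Suc i < length (x # y # xs)" by blast
      then show "e \<in> ?R" by (cases i) auto
    qed
    show "?R \<subseteq> ?L"
    proof
      fix e assume "e \<in> ?R"
      then consider "e = {x, y}" | i where "e = {(y # xs) ! i, (y # xs) ! Suc i}" "Suc i < length (y # xs)" by blast
      then show "e \<in> ?L"
      proof cases
        case 1
        then show ?thesis by (intro CollectI exI[of _ 0]) simp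
      next
        case (2 i)
        then show ?thesis by (intro CollectI exI[of _ "Suc i"]) simp
      qed
    qed
  qed
  then show ?case using 1 by simp
qed auto

lemma circuit_edges_path: "C \<noteq> [] \<Longrightarrow> circuit_edges C = path_edges (C @ [hd C])"
proof -
  assume C: "C \<noteq> []"
  have "(C @ [hd C]) ! i = C ! i" "(C @ [hd C]) ! Suc i = C ! (Suc i mod length C)" if "i < length C" for i
    using that C by (auto simp: nth_append hd_conv_nth dest: less_antisym)
  moreover have "Suc i < length (C @ [hd C]) \<longleftrightarrow> i < length C" for i by simp
  ultimately show ?thesis unfolding circuit_edges_def path_edges_conv_nth by (metis (no_types, lifting))
qed

lemma circuit_edges_rotate: "circuit_edges (xs @ ys) = circuit_edges (ys @ xs)"
proof (cases "xs = [] \<or> ys = []")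
  case False
  then obtain x xs' y ys' where [simp]: "xs = x # xs'" "ys = y # ys'" by (meson neq_Nil_conv)
  have "path_edges ((xs @ ys) @ [x]) = path_edges (xs @ [y]) \<union> path_edges (ys @ [x])"
    using path_edges_append[of xs y "ys' @ [x]"] by simp
  moreover have "path_edges ((ys @ xs) @ [y]) = path_edges (ys @ [x]) \<union> path_edges (xs @ [y])"
    using path_edges_append[of ys x "xs' @ [y]"] by simp
  ultimately show ?thesis by (simp add: circuit_edges_path Un_commute)
qed auto

lemma circuit_rotate_to:
  assumes "v \<in> set C" "distinct C"
  obtains Y where "circuit_edges C = path_edges (v # Y @ [v])" "distinct (v # Y)" "set C = insert v (set Y)" "length C = Suc (length Y)"
proof -
  obtain xs ys where C: "C = xs @ v # ys" using assms(1) by (meson split_list)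
  have "circuit_edges C = circuit_edges ((v # ys) @ xs)" unfolding C by (rule circuit_edges_rotate)
  then have "circuit_edges C = path_edges (v # (ys @ xs) @ [v])" by (simp add: circuit_edges_path)
  then show thesis by (rule that) (use assms(2) C in auto)
qed

lemma circuit_edges_at_vertex:
  assumes "v \<in> set C" "distinct C" "3 \<le> length C"
  shows "card {e \<in> circuit_edges C. v \<in> e} = 2"
proof -
  obtain Y where Y: "circuit_edges C = path_edges (v # Y @ [v])" "distinct (v # Y)" "length C = Suc (length Y)"
    using circuit_rotate_to[OF assms(1,2)] by metis
  obtain y ys where ys: "Y = y # ys" using Y(3) assms(3) by (cases Y) auto
  have "ys \<noteq> []" using Y(3) assms(3) ys by auto
  then obtain zs z where zs: "ys = zs @ [z]" by (metis rev_exhaust)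
  have "path_edges (v # Y @ [v]) = insert {v, y} (insert {z, v} (path_edges Y))"
    using path_edges_snoc[of "y # zs" z v] by (simp add: ys zs)
  moreover have "v \<notin> e" if "e \<in> path_edges Y" for e using path_edges_subset[OF that] Y(2) by auto
  ultimately have "{e \<in> circuit_edges C. v \<in> e} = {{v, y}, {z, v}}" using Y(1) by auto
  moreover have "{v, y} \<noteq> {z, v}" using Y(2) unfolding ys zs by (auto simp: doubleton_eq_iff)
  ultimately show ?thesis by simp
qed

lemma card_circuit_edges:
  assumes "distinct C" "3 \<le> length C"
  shows "card (circuit_edges C) = length C"
proof -
  have ne: "C \<noteq> []" using assms by auto
  then obtain zs z where zs: "C = zs @ [z]" by (metis rev_exhaust)
  have *: "circuit_edges C = insert {last C, hd C} (path_edges C)"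
    using circuit_edges_path[OF ne] path_edges_snoc[of zs z "hd C"] by (simp add: zs)
  have "{hd C, last C} \<notin> path_edges C" using path_edges_ends[OF assms(1)] assms(2) by auto
  then show ?thesis unfolding * using card_path_edges[OF assms(1)] assms(2)
    by (simp add: insert_commute)
qed

lemma Union_circuit_edges: "3 \<le> length C \<Longrightarrow> \<Union>(circuit_edges C) = set C"
  using circuit_edges_path[of C] Union_path_edges[of "C @ [hd C]"] by (cases C) auto

text \<open>The two paths have \<open>length C + 2\<close> entries together. The bound 5 records
  that they are not both the single edge \<open>uv\<close>, which is what
  \<open>join_circuit\<close> asks for.\<close>

lemma split_circuit:
  assumes "u \<in> set C" "v \<in> set C" "u \<noteq> v" "distinct C" "3 \<le> length C"
  obtains p q where "hd p = u" "last p = v" "hd q = u" "last q = v" "distinct p" "distinct q"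
    "2 \<le> length p" "2 \<le> length q" "set p \<inter> set q = {u, v}" "circuit_edges C = path_edges p \<union> path_edges q"
    "5 \<le> length p + length q"
proof -
  obtain Y where Y: "circuit_edges C = path_edges (u # Y @ [u])" "distinct (u # Y)" "set C = insert u (set Y)"
    "length C = Suc (length Y)"
    by (rule circuit_rotate_to[OF assms(1,4)])
  then obtain A B where AB: "Y = A @ v # B" using assms(2,3) by (metis insertE split_list)
  have "path_edges (u # Y @ [u]) = path_edges (u # A @ [v]) \<union> path_edges (v # B @ [u])"
    using path_edges_append[of "u # A" v "B @ [u]"] unfolding AB by simp
  also have "path_edges (v # B @ [u]) = path_edges (u # rev B @ [v])"
    using path_edges_rev[of "v # B @ [u]"] by simp
  finally have "circuit_edges C = path_edges (u # A @ [v]) \<union> path_edges (u # rev B @ [v])" using Y(1) by simp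
  then show thesis
    by (intro that[of "u # A @ [v]" "u # rev B @ [v]"]) (use Y(2,4) AB assms(5) in auto)
qed

lemma join_circuit:
  assumes "hd p = u" "last p = v" "hd q = u" "last q = v" "distinct p" "distinct q"
    "2 \<le> length p" "2 \<le> length q" "set p \<inter> set q = {u, v}" "5 \<le> length p + length q"
  obtains C where "circuit_edges C = path_edges p \<union> path_edges q" "distinct C" "3 \<le> length C"
proof -
  obtain p' where p: "p = p' @ [v]" using assms(2,7) by (metis append_butlast_last_id list.size(3) not_numeral_le_zero)
  obtain q1 where q1: "q = q1 @ [v]" using assms(4,8) by (metis append_butlast_last_id list.size(3) not_numeral_le_zero)
  obtain M where q: "q = u # M @ [v]" using q1 assms(3,8) by (cases q1) auto
  have pne: "p \<noteq> []" using p by simp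
  have C: "circuit_edges (p @ rev M) = path_edges ((p @ rev M) @ [u])"
    using circuit_edges_path[of "p @ rev M"] pne assms(1) by simp
  also have "\<dots> = path_edges (p' @ [v]) \<union> path_edges (v # rev M @ [u])"
    using path_edges_append[of p' v "rev M @ [u]"] p by simp
  also have "path_edges (v # rev M @ [u]) = path_edges q"
    using path_edges_rev[of q] q by simp
  finally have "circuit_edges (p @ rev M) = path_edges p \<union> path_edges q" using p by simp
  moreover have "set M \<inter> set p = {}" using assms(6,9) q by auto
  then have "distinct (p @ rev M)" using assms(5,6) q by auto
  moreover have "3 \<le> length (p @ rev M)" using assms(7,10) q by auto
  ultimately show thesis by (rule that)
qed

text \<open>The ends of a common edge lie in \<open>{u, v}\<close>, so it joins the ends of both
  paths, and then each path consists of that edge alone.\<close>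

lemma path_edges_disjoint:
  assumes "hd p = u" "last p = v" "hd q = u" "last q = v" "distinct p" "distinct q"
    "set p \<inter> set q = {u, v}" "5 \<le> length p + length q"
    and 2: "\<And>e. e \<in> path_edges p \<Longrightarrow> card e = 2" and uv: "u \<noteq> v"
  shows "path_edges p \<inter> path_edges q = {}"
proof (rule ccontr)
  assume "path_edges p \<inter> path_edges q \<noteq> {}"
  then obtain e where e: "e \<in> path_edges p" "e \<in> path_edges q" by blast
  then have "e \<subseteq> {u, v}" using path_edges_subset assms(7) by blast
  then have "e = {u, v}" using 2[OF e(1)] uv by (metis card_2_iff card_subset_eq finite.emptyI finite_insert)
  then have "length p = 2" "length q = 2"
    using path_edges_ends[of p] path_edges_ends[of q] e assms by auto
  then show False using assms(8) by simp
qed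

section \<open>Drawings as point sets; the effect of an ear on the faces\<close>

section \<open>Faces of a plane graph without cut vertices\<close>

locale plane =
  fixes G :: "'a graph" and S :: "'a embedding"
  assumes plane: "plane_graph G S"
begin

abbreviation "E \<equiv> edges G"
abbreviation "pt \<equiv> point S"

text \<open>Only edges are drawn, so this agrees with \<open>drawing\<close> if every vertex lies on
  an edge.\<close>

definition Dr :: "'a set set \<Rightarrow> complex set" where
  "Dr F = (\<Union>e\<in>F. path_image (curve S e))"

lemma edges_simple: "finite (verts G)" "e \<in> E \<Longrightarrow> e \<subseteq> verts G" "e \<in> E \<Longrightarrow> card e = 2"
  using plane unfolding plane_graph_def simple_graph_def by auto

lemma edge_set_E: "edge_set E"
proof -
  have "E \<subseteq> Pow (verts G)" using edges_simple(2) by blast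
  then have "finite E" using edges_simple(1) by (meson finite_Pow_iff finite_subset)
  then show ?thesis using edges_simple(3) by (simp add: edge_set_def)
qed

lemma finite_E: "finite E"
  by (rule finite_edge_set[OF edge_set_E])

lemma finite_sub: "F \<subseteq> E \<Longrightarrow> finite F"
  using finite_E finite_subset by blast

lemma inj_pt: "inj_on pt (verts G)"
  using plane unfolding plane_graph_def by blast

lemma curve_facts:
  assumes "e \<in> E"
  shows "arc (curve S e)" "{pathstart (curve S e), pathfinish (curve S e)} = pt ` e"
    "path_image (curve S e) \<inter> pt ` verts G = pt ` e"
  using plane assms unfolding plane_graph_def by blast+

lemma curves_meet:
  "e \<in> E \<Longrightarrow> e' \<in> E \<Longrightarrow> e \<noteq> e' \<Longrightarrow> path_image (curve S e) \<inter> path_image (curve S e') = pt ` (e \<inter> e')"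
  using plane unfolding plane_graph_def by blast

lemma pt_eq: "u \<in> verts G \<Longrightarrow> v \<in> verts G \<Longrightarrow> pt u = pt v \<Longrightarrow> u = v"
  using inj_pt by (rule inj_onD)

lemma edge_arc:
  assumes "{u, v} \<in> E"
  shows "arc_between (pt u) (pt v) (path_image (curve S {u, v}))"
proof -
  let ?g = "curve S {u, v}"
  have "{pathstart ?g, pathfinish ?g} = {pt u, pt v}" using curve_facts(2)[OF assms] by simp
  then consider "pathstart ?g = pt u" "pathfinish ?g = pt v" | "pathstart ?g = pt v" "pathfinish ?g = pt u"
    by (auto simp: doubleton_eq_iff)
  then show ?thesis
  proof cases
    case 1
    then show ?thesis unfolding arc_between_def using curve_facts(1)[OF assms] by blast
  next
    case 2
    then have "arc_between (pt v) (pt u) (path_image ?g)"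
      unfolding arc_between_def using curve_facts(1)[OF assms] by blast
    then show ?thesis by (rule arc_between_sym)
  qed
qed

lemma pt_in_curve: "e \<in> E \<Longrightarrow> v \<in> e \<Longrightarrow> pt v \<in> path_image (curve S e)"
  using curve_facts(3) by blast

lemma in_curve_pt: "e \<in> E \<Longrightarrow> v \<in> verts G \<Longrightarrow> pt v \<in> path_image (curve S e) \<Longrightarrow> v \<in> e"
proof -
  assume *: "e \<in> E" "v \<in> verts G" "pt v \<in> path_image (curve S e)"
  then have "pt v \<in> pt ` e" using curve_facts(3)[OF *(1)] by blast
  then obtain u where "u \<in> e" "pt v = pt u" by blast
  then show "v \<in> e" using pt_eq[of v u] * edges_simple(2)[OF *(1)] by blast
qed

lemma Dr_Un: "Dr (F \<union> F') = Dr F \<union> Dr F'"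
  by (simp add: Dr_def)

lemma Dr_mono: "F \<subseteq> F' \<Longrightarrow> Dr F \<subseteq> Dr F'"
  by (auto simp: Dr_def)

lemma closed_Dr: "F \<subseteq> E \<Longrightarrow> closed (Dr F)"
  unfolding Dr_def using finite_sub curve_facts(1) closed_arc_image by (intro closed_UN) blast+

lemma Dr_Int:
  assumes "F \<subseteq> E" "F' \<subseteq> E" "F \<inter> F' = {}"
  shows "Dr F \<inter> Dr F' = pt ` (\<Union>F \<inter> \<Union>F')"
proof
  show "Dr F \<inter> Dr F' \<subseteq> pt ` (\<Union>F \<inter> \<Union>F')"
  proof
    fix x assume "x \<in> Dr F \<inter> Dr F'"
    then obtain e e' where e: "e \<in> F" "e' \<in> F'" "x \<in> path_image (curve S e) \<inter> path_image (curve S e')"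
      unfolding Dr_def by blast
    then have "x \<in> pt ` (e \<inter> e')" using curves_meet[of e e'] assms by blast
    then show "x \<in> pt ` (\<Union>F \<inter> \<Union>F')" using e(1,2) by blast
  qed
  show "pt ` (\<Union>F \<inter> \<Union>F') \<subseteq> Dr F \<inter> Dr F'"
    unfolding Dr_def using pt_in_curve assms by blast
qed

lemma pt_in_Dr: "F \<subseteq> E \<Longrightarrow> v \<in> \<Union>F \<Longrightarrow> pt v \<in> Dr F"
  unfolding Dr_def using pt_in_curve by blast

lemma in_Dr_pt: "F \<subseteq> E \<Longrightarrow> v \<in> verts G \<Longrightarrow> pt v \<in> Dr F \<Longrightarrow> v \<in> \<Union>F"
  unfolding Dr_def using in_curve_pt by blast

text \<open>The curve of an edge outside \<open>F\<close> meets \<open>Dr F\<close> at most in its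
  ends, but it also has inner points. Thus the edges of a boundary can be recovered from the
  frontier as a point set.\<close>

lemma curve_subset_Dr:
  assumes "e \<in> E" "F \<subseteq> E"
  shows "path_image (curve S e) \<subseteq> Dr F \<longleftrightarrow> e \<in> F"
proof
  assume sub: "path_image (curve S e) \<subseteq> Dr F"
  show "e \<in> F"
  proof (rule ccontr)
    assume "e \<notin> F"
    then have "Dr {e} \<inter> Dr F = pt ` (\<Union>{e} \<inter> \<Union>F)" by (intro Dr_Int) (use assms in auto)
    moreover have "Dr {e} = path_image (curve S e)" by (simp add: Dr_def)
    ultimately have "path_image (curve S e) = pt ` (e \<inter> \<Union>F)" using sub by (simp add: Int_absorb2)
    then have 1: "path_image (curve S e) \<subseteq> pt ` e" by blast
    obtain u v where e: "e = {u, v}" using edges_simple(3)[OF assms(1)] by (metis card_2_iff)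
    then have "path_image (curve S {u, v}) - {pt u, pt v} \<noteq> {}"
      using arc_betweenD(8)[OF edge_arc[of u v]] assms(1) by simp
    then show False using 1 e by auto
  qed
qed (auto simp: Dr_def)

lemma path_arc:
  assumes "distinct xs" "2 \<le> length xs" "path_edges xs \<subseteq> E"
  shows "arc_between (pt (hd xs)) (pt (last xs)) (Dr (path_edges xs))"
  using assms
proof (induction xs rule: path_edges.induct)
  case (1 x y ys)
  have xy: "{x, y} \<in> E" using 1(4) by simp
  show ?case
  proof (cases ys)
    case Nil
    then show ?thesis using edge_arc[OF xy] by (simp add: Dr_def)
  next
    case (Cons z zs)
    let ?F = "path_edges (y # ys)"
    have F: "arc_between (pt y) (pt (last (y # ys))) (Dr ?F)"
      using 1 Cons by auto
    have sub: "?F \<subseteq> E" using 1(4) by auto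
    have xF: "x \<notin> \<Union>?F" using path_edges_subset 1(2) by fastforce
    then have "{x, y} \<notin> ?F" by blast
    then have "Dr {{x, y}} \<inter> Dr ?F \<subseteq> pt ` ({x, y} \<inter> \<Union>?F)" using Dr_Int[of "{{x, y}}" ?F] xy sub by simp
    also have "\<dots> \<subseteq> {pt y}" using xF by blast
    finally have "Dr {{x, y}} \<inter> Dr ?F \<subseteq> {pt y}" .
    moreover have "arc_between (pt x) (pt y) (Dr {{x, y}})" using edge_arc[OF xy] by (simp add: Dr_def)
    ultimately have "arc_between (pt x) (pt (last (y # ys))) (Dr {{x, y}} \<union> Dr ?F)"
      using arc_between_join F by blast
    then show ?thesis by (simp add: Dr_def)
  qed
qed auto

definition face_circuit :: "'a set set \<Rightarrow> complex set \<Rightarrow> bool" where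
  "face_circuit F f \<longleftrightarrow> (\<exists>C. distinct C \<and> 3 \<le> length C \<and> circuit_edges C \<subseteq> F \<and> frontier f = Dr (circuit_edges C))"

definition faces_at :: "'a set set \<Rightarrow> 'a set \<Rightarrow> complex set set" where
  "faces_at F e = {f \<in> components (- Dr F). path_image (curve S e) \<subseteq> frontier f}"

text \<open>The invariant of the ear construction. The circuits around the faces make the next ear a
  cross-cut; the number of faces at an edge and Euler's formula are carried along for the
  discharging.\<close>

definition well_drawn :: "'a set set \<Rightarrow> bool" where
  "well_drawn F \<longleftrightarrow> F \<subseteq> E \<and> F \<noteq> {} \<and> finite (components (- Dr F)) \<and>
     (\<forall>f\<in>components (- Dr F). face_circuit F f) \<and> (\<forall>e\<in>F. card (faces_at F e) = 2) \<and>
     card (components (- Dr F)) + card (\<Union>F) = card F + 2"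

lemma split_circuit_arcs:
  assumes C: "distinct C" "3 \<le> length C" "circuit_edges C \<subseteq> E" and uv: "u \<in> set C" "v \<in> set C" "u \<noteq> v"
  obtains p q where "hd p = u" "last p = v" "hd q = u" "last q = v" "distinct p" "distinct q"
    "2 \<le> length p" "2 \<le> length q" "set p \<inter> set q = {u, v}" "circuit_edges C = path_edges p \<union> path_edges q"
    "path_edges p \<inter> path_edges q = {}" "arc_between (pt u) (pt v) (Dr (path_edges p))"
    "arc_between (pt u) (pt v) (Dr (path_edges q))"
    "Dr (path_edges p) \<inter> Dr (path_edges q) = {pt u, pt v}"
proof -
  obtain p q where pq: "hd p = u" "last p = v" "hd q = u" "last q = v" "distinct p" "distinct q"
    "2 \<le> length p" "2 \<le> length q" "set p \<inter> set q = {u, v}" "circuit_edges C = path_edges p \<union> path_edges q"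
    "5 \<le> length p + length q"
    by (rule split_circuit[OF uv C(1,2)])
  have sub: "path_edges p \<subseteq> E" "path_edges q \<subseteq> E" using C(3) unfolding pq(10) by auto
  have dis: "path_edges p \<inter> path_edges q = {}"
    by (rule path_edges_disjoint[OF pq(1-6,9,11) edges_simple(3) uv(3)]) (use sub in auto)
  have "Dr (path_edges p) \<inter> Dr (path_edges q) = {pt u, pt v}"
    unfolding Dr_Int[OF sub dis] Union_path_edges[OF pq(7)] Union_path_edges[OF pq(8)] pq(9) by simp
  moreover note path_arc[OF pq(5,7) sub(1)] path_arc[OF pq(6,8) sub(2)]
  ultimately show thesis using that[OF pq(1-10) dis] pq(1-4) by simp
qed

lemma well_drawn_circuit:
  assumes C: "distinct C" "3 \<le> length C" "circuit_edges C \<subseteq> E"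
  shows "well_drawn (circuit_edges C)"
proof -
  obtain u v C' where C': "C = u # v # C'" using C(2) by (cases C rule: path_edges.cases) auto
  then have "u \<in> set C" "v \<in> set C" "u \<noteq> v" using C(1) by auto
  then obtain p q where pq: "circuit_edges C = path_edges p \<union> path_edges q"
    "arc_between (pt u) (pt v) (Dr (path_edges p))"
    "arc_between (pt u) (pt v) (Dr (path_edges q))"
    "Dr (path_edges p) \<inter> Dr (path_edges q) = {pt u, pt v}"
    using split_circuit_arcs[OF C, of u v] by metis
  have D: "Dr (circuit_edges C) = Dr (path_edges p) \<union> Dr (path_edges q)" unfolding pq(1) Dr_Un ..
  obtain I J where IJ: "components (- Dr (circuit_edges C)) = {I, J}" "I \<noteq> J"
    "frontier I = Dr (circuit_edges C)" "frontier J = Dr (circuit_edges C)"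
    using jordan_two_arcs[OF pq(2-4)] unfolding D by metis
  have "faces_at (circuit_edges C) e = {I, J}" if "e \<in> circuit_edges C" for e
    unfolding faces_at_def IJ(1) using IJ(3,4) that unfolding Dr_def by auto
  moreover have "card {I, J} = 2" using IJ(2) by simp
  moreover have "circuit_edges C \<noteq> {}" using card_circuit_edges[OF C(1,2)] C(2) by auto
  moreover have "card (\<Union>(circuit_edges C)) = card (circuit_edges C)"
    using card_circuit_edges[OF C(1,2)] Union_circuit_edges[OF C(2)] distinct_card[OF C(1)] by simp
  moreover have "face_circuit (circuit_edges C) f" if "f \<in> {I, J}" for f
    unfolding face_circuit_def using that IJ(3,4) C by blast
  ultimately show ?thesis unfolding well_drawn_def using C(3) IJ(1) by simp
qed

text \<open>The inner part of the ear lies in a face \<open>f\<close> whose circuit passes through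
  both ends of the ear. By \<open>crosscut_components\<close>, \<open>f\<close> is replaced by two
  faces, each bounded by the ear and one half of the circuit. An ear with \<open>l\<close> vertices
  adds \<open>l - 2\<close> vertices, \<open>l - 1\<close> edges and one face.\<close>

lemma well_drawn_ear:
  assumes F: "well_drawn F"
    and xs: "distinct xs" "2 \<le> length xs" "path_edges xs \<subseteq> E" "set xs \<inter> \<Union>F = {hd xs, last xs}"
      "path_edges xs \<inter> F = {}"
  shows "well_drawn (F \<union> path_edges xs)"
proof -
  define R where "R = Dr (path_edges xs)"
  define K where "K = components (- Dr F)"
  have FE: "F \<subseteq> E" and finK: "finite K" and fc: "\<And>f. f \<in> K \<Longrightarrow> face_circuit F f"
    and two: "\<And>e. e \<in> F \<Longrightarrow> card (faces_at F e) = 2" and euler: "card K + card (\<Union>F) = card F + 2"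
    using F unfolding well_drawn_def K_def by auto
  let ?u = "hd xs" and ?v = "last xs"
  have arcR: "arc_between (pt ?u) (pt ?v) R" unfolding R_def by (rule path_arc[OF xs(1-3)])
  have RD: "R \<inter> Dr F = {pt ?u, pt ?v}"
    unfolding R_def Dr_Int[OF xs(3) FE xs(5)] Union_path_edges[OF xs(2)] xs(4) by simp
  have "R - {pt ?u, pt ?v} \<subseteq> - Dr F" using RD by blast
  moreover have "- Dr F \<noteq> {}" using calculation arc_betweenD(8)[OF arcR] by blast
  ultimately obtain f where f: "f \<in> K" "R - {pt ?u, pt ?v} \<subseteq> f"
    using exists_component_superset arc_betweenD(7)[OF arcR] unfolding K_def by metis
  obtain C where C: "distinct C" "3 \<le> length C" "circuit_edges C \<subseteq> F" "frontier f = Dr (circuit_edges C)"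
    using fc[OF f(1)] unfolding face_circuit_def by blast
  have CE: "circuit_edges C \<subseteq> E" using C(3) FE by blast
  have uvF: "?u \<in> \<Union>F" "?v \<in> \<Union>F" using xs(4) by blast+
  have uvV: "?u \<in> verts G" "?v \<in> verts G" using uvF FE edges_simple(2) by blast+
  have ptD: "pt ?u \<in> Dr F" "pt ?v \<in> Dr F" using pt_in_Dr[OF FE] uvF by blast+
  have "pt ?u \<in> Dr (circuit_edges C)" "pt ?v \<in> Dr (circuit_edges C)"
    using crosscut_ends[OF arcR f(1)[unfolded K_def] f(2) ptD] C(4) by auto
  then have uvC: "?u \<in> set C" "?v \<in> set C"
    using in_Dr_pt[OF CE] uvV Union_circuit_edges[OF C(2)] by blast+
  have uv: "?u \<noteq> ?v" using arc_betweenD(3)[OF arcR] by auto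
  obtain p q where pq: "hd p = ?u" "last p = ?v" "hd q = ?u" "last q = ?v" "distinct p" "distinct q"
    "2 \<le> length p" "2 \<le> length q" "set p \<inter> set q = {?u, ?v}" "circuit_edges C = path_edges p \<union> path_edges q"
    "path_edges p \<inter> path_edges q = {}" "arc_between (pt ?u) (pt ?v) (Dr (path_edges p))"
    "arc_between (pt ?u) (pt ?v) (Dr (path_edges q))"
    "Dr (path_edges p) \<inter> Dr (path_edges q) = {pt ?u, pt ?v}"
    by (rule split_circuit_arcs[OF C(1,2) CE uvC uv])
  have pqF: "path_edges p \<subseteq> F" "path_edges q \<subseteq> F" using C(3) unfolding pq(10) by auto
  have fr: "frontier f = Dr (path_edges p) \<union> Dr (path_edges q)" unfolding C(4) pq(10) Dr_Un ..
  obtain A B where AB: "components (- (Dr F \<union> R)) = insert A (insert B (K - {f}))"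
    "frontier A = Dr (path_edges q) \<union> R" "frontier B = Dr (path_edges p) \<union> R" "A \<notin> K" "B \<notin> K" "A \<noteq> B"
    using crosscut_components[OF pq(12,13) arcR pq(14) closed_Dr[OF FE] _ f(1)[unfolded K_def] fr f(2)]
      Dr_mono[OF pqF(1)] Dr_mono[OF pqF(2)] unfolding K_def by (metis Un_least)
  let ?F = "F \<union> path_edges xs"
  have DF: "Dr ?F = Dr F \<union> R" by (simp add: Dr_Un R_def)
  have comp: "components (- Dr ?F) = insert A (insert B (K - {f}))" unfolding DF by (rule AB(1))
  have FE': "?F \<subseteq> E" using FE xs(3) by blast
  have circ: "face_circuit ?F X"
    if "r = p \<or> r = q" and X: "frontier X = Dr (path_edges r) \<union> R" for X r
  proof -
    have r: "hd r = ?u" "last r = ?v" "distinct r" "2 \<le> length r" "path_edges r \<subseteq> F"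
      using that(1) pq pqF by auto
    have "set r \<subseteq> \<Union>F" using Union_path_edges[OF r(4)] r(5) by blast
    then have "set r \<inter> set xs \<subseteq> {?u, ?v}" using xs(4) by blast
    moreover have "?u \<in> set r" "?v \<in> set r" "?u \<in> set xs" "?v \<in> set xs"
      using r(1,2,4) xs(2) by (metis hd_in_set last_in_set list.size(3) not_numeral_le_zero)+
    ultimately have int: "set r \<inter> set xs = {?u, ?v}" by blast
    \<comment> \<open>The ear and half of the circuit cannot both be the same single edge, because
      the edges of the ear are not in \<open>F\<close>.\<close>
    have len: "5 \<le> length r + length xs"
    proof (rule ccontr)
      assume "\<not> 5 \<le> length r + length xs"
      then have l: "length r = 2" "length xs = 2" using r(4) xs(2) by auto
      have "path_edges ys = {{hd ys, last ys}}" if "length ys = 2" for ys :: "'a list"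
        using that by (cases ys rule: path_edges.cases) auto
      from this[OF l(1)] this[OF l(2)] have "path_edges r = path_edges xs" "path_edges xs \<noteq> {}" using r by auto
      then show False using r(5) xs(5) by blast
    qed
    obtain C' where "circuit_edges C' = path_edges r \<union> path_edges xs" "distinct C'" "3 \<le> length C'"
      by (rule join_circuit[OF r(1,2) refl refl r(3) xs(1) r(4) xs(2) int len])
    then show ?thesis unfolding face_circuit_def using X r(5) by (intro exI[of _ C']) (auto simp: Dr_Un R_def)
  qed
  have circs: "face_circuit ?F X" if "X \<in> components (- Dr ?F)" for X
  proof -
    consider "X = A" | "X = B" | "X \<in> K" using \<open>X \<in> components (- Dr ?F)\<close> unfolding comp by blast
    then show ?thesis
    proof cases
      case 3
      then show ?thesis using fc[of X] unfolding face_circuit_def by blast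
    qed (use circ AB(2,3) in blast)+
  qed
  have frA: "path_image (curve S e) \<subseteq> frontier A \<longleftrightarrow> e \<in> path_edges q \<union> path_edges xs" if "e \<in> E" for e
    using curve_subset_Dr[OF that, of "path_edges q \<union> path_edges xs"] AB(2) pqF(2) FE xs(3)
    by (simp add: Dr_Un R_def subset_trans)
  have frB: "path_image (curve S e) \<subseteq> frontier B \<longleftrightarrow> e \<in> path_edges p \<union> path_edges xs" if "e \<in> E" for e
    using curve_subset_Dr[OF that, of "path_edges p \<union> path_edges xs"] AB(3) pqF(1) FE xs(3)
    by (simp add: Dr_Un R_def subset_trans)
  have frf: "path_image (curve S e) \<subseteq> frontier f \<longleftrightarrow> e \<in> path_edges p \<union> path_edges q" if "e \<in> E" for e
    using curve_subset_Dr[OF that CE] C(4) pq(10) by simp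
  have frK: "e \<in> F" if "X \<in> K" "e \<in> E" "path_image (curve S e) \<subseteq> frontier X" for X e
    using fc[OF that(1)] curve_subset_Dr[OF that(2)] that(3) FE unfolding face_circuit_def by (metis subset_iff)
  have "card (faces_at ?F e) = 2" if e: "e \<in> ?F" for e
  proof -
    have eE: "e \<in> E" using e FE' by blast
    define N where "N = {X \<in> K - {f}. path_image (curve S e) \<subseteq> frontier X}"
    have finN: "finite N" "A \<notin> N" "B \<notin> N" "f \<notin> N" using finK AB(4,5) unfolding N_def by auto
    have at: "faces_at ?F e = {X \<in> {A, B}. path_image (curve S e) \<subseteq> frontier X} \<union> N"
      unfolding faces_at_def comp N_def by blast
    have at0: "faces_at F e = {X \<in> {f}. path_image (curve S e) \<subseteq> frontier X} \<union> N"
      unfolding faces_at_def K_def[symmetric] N_def using f(1) by blast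
    \<comment> \<open>Edges of the ear see \<open>A\<close> and \<open>B\<close>; an edge of
      \<open>p\<close> sees \<open>B\<close> in place of \<open>f\<close>, an edge of
      \<open>q\<close> sees \<open>A\<close>; for the other edges nothing changes.\<close>
    consider "e \<in> path_edges xs" "e \<notin> F" | "e \<in> path_edges p" "e \<notin> path_edges q" "e \<in> F" "e \<notin> path_edges xs"
      | "e \<in> path_edges q" "e \<notin> path_edges p" "e \<in> F" "e \<notin> path_edges xs"
      | "e \<notin> path_edges p" "e \<notin> path_edges q" "e \<in> F" "e \<notin> path_edges xs"
      using e xs(5) pq(11) pqF by blast
    then show ?thesis
    proof cases
      case 1
      then have "N = {}" using frK[OF _ eE] unfolding N_def by blast
      moreover have s: "{X \<in> {A, B}. path_image (curve S e) \<subseteq> frontier X} = {A, B}"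
        using frA[OF eE] frB[OF eE] 1 by auto
      ultimately show ?thesis using AB(6) unfolding at s by simp
    next
      case 2
      have s: "{X \<in> {A, B}. path_image (curve S e) \<subseteq> frontier X} = {B}"
        using frA[OF eE] frB[OF eE] 2 by auto
      have s0: "{X \<in> {f}. path_image (curve S e) \<subseteq> frontier X} = {f}" using frf[OF eE] 2 by auto
      show ?thesis using two[OF 2(3)] finN unfolding at at0 s s0 by simp
    next
      case 3
      have s: "{X \<in> {A, B}. path_image (curve S e) \<subseteq> frontier X} = {A}"
        using frA[OF eE] frB[OF eE] 3 by auto
      have s0: "{X \<in> {f}. path_image (curve S e) \<subseteq> frontier X} = {f}" using frf[OF eE] 3 by auto
      show ?thesis using two[OF 3(3)] finN unfolding at at0 s s0 by simp
    next
      case 4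
      have s: "{X \<in> {A, B}. path_image (curve S e) \<subseteq> frontier X} = {}"
        using frA[OF eE] frB[OF eE] 4 by auto
      have s0: "{X \<in> {f}. path_image (curve S e) \<subseteq> frontier X} = {}" using frf[OF eE] 4 by auto
      show ?thesis using two[OF 4(3)] finN unfolding at at0 s s0 by simp
    qed
  qed
  moreover have "card (components (- Dr ?F)) + card (\<Union>?F) = card ?F + 2"
  proof -
    have "card (components (- Dr ?F)) = Suc (Suc (card (K - {f})))"
      unfolding comp using AB(4-6) finK by simp
    moreover have "card K = Suc (card (K - {f}))" using f(1) finK by (metis card.remove)
    ultimately have cF: "card (components (- Dr ?F)) = Suc (card K)" by simp
    have "card ?F = card F + card (path_edges xs)"
      using finite_sub[OF FE] xs(5) by (subst card_Un_disjoint) auto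
    then have cE: "card ?F + 1 = card F + length xs" using card_path_edges[OF xs(1)] xs(2) by simp
    have finU: "finite (\<Union>F)" using finite_sub[OF FE] FE edges_simple(1,2) by (meson Union_least finite_subset subsetD)
    have "\<Union>?F = \<Union>F \<union> set xs" using Union_path_edges[OF xs(2)] by auto
    moreover have "card (\<Union>F \<union> set xs) + card (\<Union>F \<inter> set xs) = card (\<Union>F) + card (set xs)"
      using card_Un_Int[OF finU, of "set xs"] by simp
    moreover have "card (\<Union>F \<inter> set xs) = 2" using xs(4) uv by (simp add: Int_commute)
    ultimately have "card (\<Union>?F) + 2 = card (\<Union>F) + length xs" using distinct_card[OF xs(1)] by simp
    then show ?thesis using cF cE euler by linarith
  qed
  moreover have "finite (components (- Dr ?F))" unfolding comp using finK by simp
  moreover have "?F \<noteq> {}" using F unfolding well_drawn_def by blast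
  ultimately show ?thesis unfolding well_drawn_def using FE' circs by blast
qed

end

section \<open>Ears of a graph without cut vertices\<close>

definition no_cutvertex :: "'a set set \<Rightarrow> bool" where
  "no_cutvertex F \<longleftrightarrow> (\<forall>u. \<forall>v\<in>\<Union>F - {u}. \<forall>t\<in>\<Union>F - {u}. (avoid_adj F u)\<^sup>*\<^sup>* v t)"

lemma no_cutvertexD:
  "no_cutvertex F \<Longrightarrow> v \<in> \<Union>F \<Longrightarrow> t \<in> \<Union>F \<Longrightarrow> v \<noteq> u \<Longrightarrow> t \<noteq> u \<Longrightarrow> (avoid_adj F u)\<^sup>*\<^sup>* v t"
  unfolding no_cutvertex_def by simp

lemma rtranclp_enters:
  "R\<^sup>*\<^sup>* v t \<Longrightarrow> v \<notin> T \<Longrightarrow> t \<in> T \<Longrightarrow> \<exists>x y. R x y \<and> x \<notin> T \<and> y \<in> T"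
  by (induction rule: rtranclp_induct) auto

lemma path_edges_butlast: "e \<in> path_edges xs \<Longrightarrow> e \<inter> set (butlast xs) \<noteq> {}"
  by (induction xs rule: path_edges.induct) (auto split: if_splits)

lemma avoiding_path:
  assumes "(avoid_adj F u)\<^sup>*\<^sup>* p t" "t \<in> T" "p \<notin> T"
  obtains ys where "distinct ys" "2 \<le> length ys" "hd ys = p" "last ys \<in> T" "set (butlast ys) \<inter> T = {}"
    "u \<notin> set ys" "path_edges ys \<subseteq> F"
proof -
  obtain ys where ys: "successively (avoid_adj F u) ys" "distinct ys" "ys \<noteq> []" "hd ys = p" "last ys \<in> T"
    "set (butlast ys) \<inter> T = {}"
    using simple_path_to[OF assms(1,2)] by blast
  have len: "2 \<le> length ys"
    using ys(3-5) assms(3) by (cases ys rule: path_edges.cases) auto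
  have "successively (\<lambda>p q. {p, q} \<in> {e \<in> F. u \<notin> e}) ys"
    using ys(1) by (rule successively_mono) (auto simp: avoid_adj_def)
  then have pe: "path_edges ys \<subseteq> {e \<in> F. u \<notin> e}" unfolding path_edges_successively .
  have "u \<notin> \<Union>(path_edges ys)" using pe by blast
  then have "u \<notin> set ys" using Union_path_edges[OF len] by simp
  moreover have "path_edges ys \<subseteq> F" using pe by blast
  ultimately show thesis by (rule that[OF ys(2) len ys(4-6)])
qed

context plane
begin

text \<open>A missing edge between drawn vertices is an ear itself. Otherwise some edge joins a
  drawn vertex \<open>y\<close> to an undrawn \<open>x\<close>. As \<open>y\<close> is not a cut
  vertex, a path from \<open>x\<close> that avoids \<open>y\<close> returns to the drawn part;
  together with \<open>yx\<close> it is an ear with two different ends.\<close>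

lemma well_drawn_extend:
  assumes conn: "no_cutvertex E"
    and F: "well_drawn F" "F \<noteq> E"
  shows "\<exists>F'. well_drawn F' \<and> F \<subset> F'"
proof -
  have FE: "F \<subseteq> E" "F \<noteq> {}" using F unfolding well_drawn_def by auto
  have ear: ?thesis if xs: "distinct xs" "2 \<le> length xs" "path_edges xs \<subseteq> E" "set xs \<inter> \<Union>F = {hd xs, last xs}"
      "path_edges xs \<inter> F = {}" for xs
  proof -
    have "path_edges xs \<noteq> {}" using xs(2) by (cases xs rule: path_edges.cases) auto
    then have "F \<subset> F \<union> path_edges xs" using xs(5) by blast
    then show ?thesis using well_drawn_ear[OF F(1) xs] by blast
  qed
  obtain e where e: "e \<in> E" "e \<notin> F" using F(2) FE by blast
  obtain a b where ab: "e = {a, b}" "a \<noteq> b" using edges_simple(3)[OF e(1)] by (metis card_2_iff)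
  show ?thesis
  proof (cases "a \<in> \<Union>F \<and> b \<in> \<Union>F")
    case True
    show ?thesis by (rule ear[of "[a, b]"]) (use ab e True in auto)
  next
    case False
    have "a \<in> \<Union>E" "b \<in> \<Union>E" using e(1) ab(1) by auto
    then obtain v where v: "v \<in> \<Union>E" "v \<notin> \<Union>F" using False by metis
    \<comment> \<open>\<open>no_cutvertex\<close> provides only walks that avoid a vertex, so a walk
      into \<open>F\<close> needs one drawn vertex as target and another to avoid. The ends of an
      edge of \<open>F\<close> serve, and one of them later differs from \<open>y\<close>.\<close>
    obtain f where f: "f \<in> F" using FE by blast
    then obtain t1 t2 where t: "f = {t1, t2}" "t1 \<noteq> t2" using edges_simple(3) FE by (metis card_2_iff subsetD)
    have tF: "t1 \<in> \<Union>F" "t2 \<in> \<Union>F" using f t by auto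
    have UFE: "\<Union>F \<subseteq> \<Union>E" using FE(1) by (rule Union_mono)
    have "v \<noteq> t1" using v(2) tF(1) by metis
    then have "(avoid_adj E t1)\<^sup>*\<^sup>* v t2"
      using no_cutvertexD[OF conn v(1) subsetD[OF UFE tF(2)], of t1] t(2) by simp
    from rtranclp_enters[OF this v(2) tF(2)]
    obtain x y where xy: "avoid_adj E t1 x y" "x \<notin> \<Union>F" "y \<in> \<Union>F" by (elim exE conjE)
    have xyE: "{x, y} \<in> E" using xy(1) by (simp add: avoid_adj_def)
    have "t1 \<in> \<Union>F - {y} \<or> t2 \<in> \<Union>F - {y}" using tF t(2) by auto
    then obtain t where t': "t \<in> \<Union>F - {y}" by metis
    have "x \<noteq> y" using xy(2,3) by metis
    moreover have "x \<in> \<Union>E" using xyE by (rule UnionI) simp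
    moreover have "t \<in> \<Union>E" "t \<noteq> y" using t' UFE by auto
    ultimately have "(avoid_adj E y)\<^sup>*\<^sup>* x t" by (intro no_cutvertexD[OF conn])
    moreover have "x \<notin> \<Union>F - {y}" using xy(2) by simp
    ultimately obtain ys where ys: "distinct ys" "2 \<le> length ys" "hd ys = x" "last ys \<in> \<Union>F - {y}"
      "set (butlast ys) \<inter> (\<Union>F - {y}) = {}" "y \<notin> set ys" "path_edges ys \<subseteq> E"
      by (rule avoiding_path[OF _ t'])
    obtain z zs where zs: "ys = x # z # zs" using ys(2,3) by (cases ys rule: path_edges.cases) auto
    have pe: "path_edges (y # ys) = insert {y, x} (path_edges ys)" by (simp add: zs)
    have bl: "set (butlast ys) \<inter> \<Union>F = {}" using ys(5,6) by (auto dest: in_set_butlastD)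
    have "ys = butlast ys @ [last ys]" using zs by simp
    then have "set ys = insert (last ys) (set (butlast ys))" by (metis Un_insert_right list.set(1) list.simps(15) set_append sup_bot_right)
    then have int: "set (y # ys) \<inter> \<Union>F = {y, last ys}" using bl ys(4) xy(3) by auto
    have dis: "path_edges (y # ys) \<inter> F = {}"
    proof (rule ccontr)
      assume "path_edges (y # ys) \<inter> F \<noteq> {}"
      then obtain g where g: "g \<in> F" "g = {y, x} \<or> g \<in> path_edges ys" unfolding pe by blast
      show False using g(2)
      proof
        assume "g = {y, x}"
        then show False using g(1) xy(2) by auto
      next
        assume "g \<in> path_edges ys"
        then have "g \<inter> set (butlast ys) \<noteq> {}" by (rule path_edges_butlast)
        then show False using g(1) bl by blast
      qed
    qed
    show ?thesis
      by (rule ear[of "y # ys"]) (use ys(1,6,7) pe xyE int dis zs in \<open>auto simp: insert_commute\<close>)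
  qed
qed

lemma well_drawn_all:
  assumes conn: "no_cutvertex E"
  shows "well_drawn F \<Longrightarrow> well_drawn E"
proof (induction "card (E - F)" arbitrary: F rule: less_induct)
  case less
  show ?case
  proof (cases "F = E")
    case False
    from well_drawn_extend[OF conn less.prems False]
    obtain F' where F': "well_drawn F'" "F \<subset> F'" by (elim exE conjE)
    have "F' \<subseteq> E" using F'(1) unfolding well_drawn_def by blast
    then have "E - F' \<subset> E - F" using F'(2) by blast
    then have "card (E - F') < card (E - F)" by (rule psubset_card_mono[rotated]) (simp add: finite_E)
    then show ?thesis by (rule less.hyps[OF _ F'(1)])
  qed (use less.prems in simp)
qed

text \<open>The construction starts with the circuit through \<open>u\<close> that a path from
  \<open>p\<close> to \<open>q\<close> avoiding \<open>u\<close> closes.\<close>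

lemma well_drawn_E:
  assumes conn: "no_cutvertex E"
    and pq: "{u, p} \<in> E" "{u, q} \<in> E" "p \<noteq> q"
  shows "well_drawn E"
proof -
  have ne: "p \<noteq> u" "q \<noteq> u"
    using edge_set_neq[OF edge_set_E pq(1)] edge_set_neq[OF edge_set_E pq(2)] by simp_all
  have "p \<in> \<Union>E" "q \<in> \<Union>E" using UnionI[OF pq(1)] UnionI[OF pq(2)] by simp_all
  then have "(avoid_adj E u)\<^sup>*\<^sup>* p q" using ne by (rule no_cutvertexD[OF conn])
  then obtain ys where ys: "distinct ys" "2 \<le> length ys" "hd ys = p" "last ys \<in> {q}"
    "set (butlast ys) \<inter> {q} = {}" "u \<notin> set ys" "path_edges ys \<subseteq> E"
    using avoiding_path[of E u p q "{q}"] pq(3) by auto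
  obtain z zs where zs: "ys = p # z # zs" using ys(2,3) by (cases ys rule: path_edges.cases) auto
  obtain ws where ws: "ys = ws @ [q]" using ys(2,4) by (metis append_butlast_last_id list.size(3) not_numeral_le_zero singletonD)
  have "circuit_edges (u # ys) = path_edges ((u # ws) @ [q, u])" using ws by (simp add: circuit_edges_path)
  also have "\<dots> = insert {q, u} (path_edges (u # ys))" using path_edges_snoc[of "u # ws" q u] ws by simp
  also have "path_edges (u # ys) = insert {u, p} (path_edges ys)" by (simp add: zs)
  finally have "circuit_edges (u # ys) \<subseteq> E" using pq ys(7) by (simp add: insert_commute)
  then have "well_drawn (circuit_edges (u # ys))"
    by (intro well_drawn_circuit) (use ys in auto)
  then show ?thesis by (rule well_drawn_all[OF conn])
qed

lemma drawing_Dr: "verts G = \<Union>E \<Longrightarrow> drawing G S = Dr E"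
  unfolding drawing_def Dr_def using pt_in_curve by auto

end

section \<open>Charges, their bounds and their redistribution\<close>

section \<open>Discharging\<close>

definition nbrs :: "'a set set \<Rightarrow> 'a \<Rightarrow> 'a set" where
  "nbrs E v = {u. {v, u} \<in> E}"

lemma nbrs_sym: "u \<in> nbrs E v \<longleftrightarrow> v \<in> nbrs E u"
  by (simp add: nbrs_def insert_commute)

lemma edges_at: "edge_set E \<Longrightarrow> {e \<in> E. v \<in> e} = (\<lambda>u. {v, u}) ` nbrs E v"
  unfolding nbrs_def by (auto elim: edge_setE)

lemma inj_edge: "inj_on (\<lambda>u. {v, u}) A"
  by (auto simp: inj_on_def doubleton_eq_iff)

lemma deg_nbrs: "edge_set E \<Longrightarrow> deg E v = card (nbrs E v)"
  unfolding deg_def by (simp add: edges_at card_image inj_edge)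

lemma finite_nbrs: "edge_set E \<Longrightarrow> finite (nbrs E v)"
proof -
  assume E: "edge_set E"
  have "finite ((\<lambda>u. {v, u}) ` nbrs E v)"
    using finite_edge_set[OF E] by (simp flip: edges_at[OF E])
  then show ?thesis by (rule finite_imageD[OF _ inj_edge])
qed

lemma finite_vertices: "edge_set E \<Longrightarrow> finite (\<Union>E)"
  unfolding edge_set_def by (metis card.infinite finite_Union zero_neq_numeral)

lemma sum_at_vertices:
  fixes g :: "'a set \<Rightarrow> int"
  assumes E: "edge_set E"
  shows "(\<Sum>v\<in>\<Union>E. \<Sum>e | e \<in> E \<and> v \<in> e. g e) = 2 * (\<Sum>e\<in>E. g e)"
proof -
  have fin: "finite (\<Union>E)" "finite E" using finite_vertices[OF E] finite_edge_set[OF E] by auto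
  have "(\<Sum>v\<in>\<Union>E. \<Sum>e | e \<in> E \<and> v \<in> e. g e) = (\<Sum>e\<in>E. \<Sum>v | v \<in> \<Union>E \<and> v \<in> e. g e)"
    by (rule sum.swap_restrict[OF fin])
  also have "\<dots> = (\<Sum>e\<in>E. 2 * g e)"
  proof (rule sum.cong[OF refl])
    fix e assume e: "e \<in> E"
    then have "{v. v \<in> \<Union>E \<and> v \<in> e} = e" by auto
    moreover have "card e = 2" using E e unfolding edge_set_def by simp
    ultimately show "(\<Sum>v | v \<in> \<Union>E \<and> v \<in> e. g e) = 2 * g e" by simp
  qed
  finally show ?thesis by (simp add: sum_distrib_left)
qed

lemma sum_by_class:
  fixes f :: "nat \<Rightarrow> int"
  assumes "finite N" "\<And>u. u \<in> N \<Longrightarrow> d u \<in> {2, 3, 4, 5}"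
  shows "(\<Sum>u\<in>N. f (d u)) = f 2 * card {u \<in> N. d u = 2} + f 3 * card {u \<in> N. d u = 3}
    + f 4 * card {u \<in> N. d u = 4} + f 5 * card {u \<in> N. d u = 5}"
  using assms
proof (induction N rule: finite_induct)
  case (insert x N)
  have "{u \<in> insert x N. d u = k} = (if d x = k then insert x {u \<in> N. d u = k} else {u \<in> N. d u = k})" for k
    by auto
  then have "card {u \<in> insert x N. d u = k} = (if d x = k then 1 else 0) + card {u \<in> N. d u = k}" for k
    using insert.hyps by simp
  then show ?case using insert by (auto simp: algebra_simps)
qed simp

text \<open>The interface between topology and counting: faces are abstract objects known only
  through the edges of their boundary. \<open>no_pair\<close> is the denial of the theorem.\<close>

locale discharging =
  fixes E :: "'a set set" and K :: "'f set" and bd :: "'f \<Rightarrow> 'a set set"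
  assumes crit: "critical_edges 5 E"
    and finite_K: "finite K"
    and bd_E: "f \<in> K \<Longrightarrow> bd f \<subseteq> E"
    and bd_3: "f \<in> K \<Longrightarrow> 3 \<le> card (bd f)"
    and bd_at: "f \<in> K \<Longrightarrow> e \<in> bd f \<Longrightarrow> v \<in> e \<Longrightarrow> card {e \<in> bd f. v \<in> e} = 2"
    and two_faces: "e \<in> E \<Longrightarrow> card {f \<in> K. e \<in> bd f} = 2"
    and euler: "card K + card (\<Union>E) = card E + 2"
    and no_pair: "f \<in> K \<Longrightarrow> g \<in> K \<Longrightarrow> f \<noteq> g \<Longrightarrow> e \<in> bd f \<Longrightarrow> e \<in> bd g \<Longrightarrow> card (bd f) = 3 \<Longrightarrow> 5 \<le> card (bd g)"
begin

abbreviation "V \<equiv> \<Union>E"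
abbreviation "d \<equiv> deg E"
abbreviation "N \<equiv> nbrs E"

definition nd :: "nat \<Rightarrow> 'a \<Rightarrow> nat" where
  "nd k v = card {u \<in> N v. d u = k}"

lemma edge_set: "edge_set E" using crit unfolding critical_edges_def by blast
lemma finE: "finite E" using finite_edge_set[OF edge_set] .
lemma finV: "finite V" using finite_vertices[OF edge_set] .
lemma finN [simp]: "finite (N v)" using finite_nbrs[OF edge_set] .
lemma d_le: "d v \<le> 5" using crit unfolding critical_edges_def by blast
lemma d_card: "d v = card (N v)" by (rule deg_nbrs[OF edge_set])

lemma N_V: "u \<in> N v \<Longrightarrow> u \<in> V \<and> v \<in> V"
  unfolding nbrs_def by auto

lemma N_irrefl: "u \<in> N v \<Longrightarrow> u \<noteq> v"
  using edge_set_neq[OF edge_set] unfolding nbrs_def by auto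

lemma adjacency: "u \<in> N v \<Longrightarrow> 5 - d u < card {w \<in> N v. w \<noteq> u \<and> d w = 5}"
  using vizing_adjacency[OF crit, of v u] unfolding nbrs_def by simp

lemma adjacency_nd: "u \<in> N v \<Longrightarrow> d u \<noteq> 5 \<Longrightarrow> 5 - d u < nd 5 v"
proof -
  assume u: "u \<in> N v" "d u \<noteq> 5"
  have "{w \<in> N v. w \<noteq> u \<and> d w = 5} \<subseteq> {w \<in> N v. d w = 5}" by blast
  then have "card {w \<in> N v. w \<noteq> u \<and> d w = 5} \<le> nd 5 v" unfolding nd_def by (intro card_mono) auto
  then show ?thesis using adjacency[OF u(1)] by linarith
qed

text \<open>Seen from a neighbour \<open>u\<close> of \<open>v\<close>, the adjacency lemma asks for
  more than \<open>5 - d v\<close> neighbours of degree 5 besides \<open>v\<close>, and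
  \<open>u\<close> has at most four neighbours besides \<open>v\<close>.\<close>

lemma d_ge:
  assumes "v \<in> V" shows "2 \<le> d v"
proof -
  obtain e where "e \<in> E" "v \<in> e" using assms by blast
  then obtain u where "{v, u} \<in> E" using edge_setE[OF edge_set] by metis
  then have v: "v \<in> N u" by (simp add: nbrs_def insert_commute)
  have "{w \<in> N u. w \<noteq> v \<and> d w = 5} \<subseteq> N u - {v}" by blast
  then have "card {w \<in> N u. w \<noteq> v \<and> d w = 5} \<le> card (N u - {v})" by (intro card_mono) auto
  also have "\<dots> = card (N u) - 1" using v by simp
  also have "\<dots> \<le> 4" using d_le[of u] d_card[of u] by simp
  finally show ?thesis using adjacency[OF v] by linarith
qed

lemma d_in: "v \<in> V \<Longrightarrow> d v \<in> {2, 3, 4, 5}"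
  using d_ge[of v] d_le[of v] by auto

lemma sum_nbrs:
  fixes f :: "nat \<Rightarrow> int"
  shows "(\<Sum>u\<in>N v. f (d u)) = f 2 * nd 2 v + f 3 * nd 3 v + f 4 * nd 4 v + f 5 * nd 5 v"
  unfolding nd_def by (rule sum_by_class[OF finN]) (simp only: d_in N_V)

lemma d_split: "d v = nd 2 v + nd 3 v + nd 4 v + nd 5 v"
proof -
  have "(\<Sum>u\<in>N v. 1) = int (nd 2 v + nd 3 v + nd 4 v + nd 5 v)"
    using sum_nbrs[of "\<lambda>_. 1" v] by simp
  then show ?thesis using d_card[of v] by simp
qed

lemma nd_pos: "0 < nd k v \<Longrightarrow> \<exists>u\<in>N v. d u = k"
  unfolding nd_def by (metis (mono_tags, lifting) card.empty empty_Collect_eq less_irrefl)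

lemma nd_posI: "u \<in> N v \<Longrightarrow> d u = k \<Longrightarrow> 0 < nd k v"
  unfolding nd_def by (auto simp: card_gt_0_iff)

text \<open>One neighbour of degree 2 and, by the adjacency lemma, more than three of degree 5 fill
  all five places at \<open>v\<close>.\<close>

lemma nd2: "0 < nd 2 v \<Longrightarrow> d v = 5 \<and> nd 2 v = 1 \<and> nd 3 v = 0 \<and> nd 4 v = 0 \<and> nd 5 v = 4"
proof -
  assume "0 < nd 2 v"
  then obtain u where "u \<in> N v" "d u = 2" by (rule bexE[OF nd_pos])
  then have "3 < nd 5 v" using adjacency_nd[of u v] by simp
  then show ?thesis using \<open>0 < nd 2 v\<close> d_split[of v] d_le[of v] by auto
qed

lemma nd3: "0 < nd 3 v \<Longrightarrow> 3 \<le> nd 5 v"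
proof -
  assume "0 < nd 3 v"
  then obtain u where "u \<in> N v" "d u = 3" by (rule bexE[OF nd_pos])
  then show ?thesis using adjacency_nd[of u v] by simp
qed

lemma nd4: "0 < nd 4 v \<Longrightarrow> 2 \<le> nd 5 v"
proof -
  assume "0 < nd 4 v"
  then obtain u where "u \<in> N v" "d u = 4" by (rule bexE[OF nd_pos])
  then show ?thesis using adjacency_nd[of u v] by simp
qed

definition near2 :: "'a \<Rightarrow> bool" where
  "near2 v \<longleftrightarrow> 0 < nd 2 v"

lemma unique_divalent_nbr: "x \<in> N v \<Longrightarrow> w \<in> N v \<Longrightarrow> d x = 2 \<Longrightarrow> d w = 2 \<Longrightarrow> x = w"
proof -
  assume *: "x \<in> N v" "w \<in> N v" "d x = 2" "d w = 2"
  have "nd 2 v = 1" using nd2[OF nd_posI[OF *(1,3)]] by simp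
  then obtain a where "{u \<in> N v. d u = 2} = {a}" unfolding nd_def by (rule card_1_singletonE)
  moreover have "x \<in> {u \<in> N v. d u = 2}" "w \<in> {u \<in> N v. d u = 2}" using * by simp_all
  ultimately show "x = w" by simp
qed

lemma divalent_nbrs:
  assumes "d x = 2" "y \<in> N x"
  obtains y' where "N x = {y, y'}" "y \<noteq> y'"
proof -
  have "card (N x) = 2" using assms(1) d_card by simp
  then obtain a b where "N x = {a, b}" "a \<noteq> b" by (meson card_2_iff)
  then show thesis using assms(2) that by (cases "y = a") (auto simp: insert_commute)
qed

text \<open>Here the Kempe analysis enters. A vertex \<open>w\<close> of degree 2 next to
  \<open>u\<close> but different from \<open>x\<close> would complete a \<open>two_divalent\<close>
  configuration: by \<open>nd2\<close> all neighbours of \<open>x\<close> and \<open>w\<close> have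
  degree 5, and \<open>x\<close> and \<open>w\<close> share none of them because no vertex has two
  neighbours of degree 2.\<close>

lemma near2_nbr:
  assumes x: "x \<in> N v" "d x = 2" and u: "u \<in> N v" "u \<noteq> x" "near2 u"
  shows "u \<in> N x"
proof (rule ccontr)
  assume nux: "u \<notin> N x"
  obtain w where w: "w \<in> N u" "d w = 2" using u(3) unfolding near2_def by (rule bexE[OF nd_pos])
  have sym: "v \<in> N x" "u \<in> N w" "v \<in> N u" using x(1) w(1) u(1) nbrs_sym[of x E v] nbrs_sym[of w E u] nbrs_sym[of u E v] by simp_all
  have wx: "w \<noteq> x" using nux w(1) nbrs_sym[of w E u] by metis
  obtain y' where y': "N x = {v, y'}" "v \<noteq> y'" by (rule divalent_nbrs[OF x(2) sym(1)])
  obtain z' where z': "N w = {u, z'}" "u \<noteq> z'" by (rule divalent_nbrs[OF w(2) sym(2)])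
  have five: "d t = 5" if "t \<in> N x \<or> t \<in> N w" for t
  proof -
    have "x \<in> N t \<or> w \<in> N t" using that nbrs_sym[of t E x] nbrs_sym[of t E w] by simp
    then have "0 < nd 2 t" using nd_posI[OF _ x(2), of t] nd_posI[OF _ w(2), of t] by metis
    then show ?thesis using nd2 by simp
  qed
  have d5: "d v = 5" "d y' = 5" "d u = 5" "d z' = 5" using five y' z' by auto
  have apart: False if "t \<in> N x" "t \<in> N w" for t
    using unique_divalent_nbr[of x t w] that nbrs_sym[of t E x] nbrs_sym[of t E w] x(2) w(2) wx by simp
  have dist: "distinct [x, v, y', w, u, z']"
  proof -
    have "v \<in> N x" "y' \<in> N x" "u \<in> N w" "z' \<in> N w" using y'(1) z'(1) by simp_all
    then have "v \<noteq> z'" "y' \<noteq> z'" "y' \<noteq> u" using apart[of v] apart[of y'] nux by metis+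
    moreover have "x \<noteq> v" "x \<noteq> y'" "x \<noteq> u" "x \<noteq> z'" "v \<noteq> w" "y' \<noteq> w" "w \<noteq> u" "w \<noteq> z'"
      using x(2) w(2) d5 by force+
    ultimately show ?thesis using y'(2) z'(2) wx N_irrefl[OF u(1)] by simp
  qed
  have at: "{e \<in> E. t \<in> e} = {{t, a}, {t, b}}" if "N t = {a, b}" for t a b
    unfolding edges_at[OF edge_set] that by simp
  have vu: "{v, u} \<in> E" using u(1) by (simp add: nbrs_def)
  have nc: "\<not> colourable 5 E" using crit unfolding critical_edges_def by blast
  have "two_divalent E 5 x v y' w u z'"
    by (rule two_divalent.intro[OF edge_set nc _ dist at[OF y'(1)] at[OF z'(1)] d5 vu]) simp
  from two_divalent.not_critical[OF this] show False using crit by simp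
qed

text \<open>Charges are counted in units of 1/30, and a face \<open>f\<close> gives its charge \<open>30 (card (bd f) - 4)\<close> to the
  vertices of its boundary: \<open>\<omega> f\<close> is a lower bound for what each edge of \<open>f\<close> passes to each of its two ends.\<close>

definition \<omega> :: "'f \<Rightarrow> int" where
  "\<omega> f = (if card (bd f) = 3 then -5 else if card (bd f) = 4 then 0 else 3)"

definition val :: "'a set \<Rightarrow> int" where
  "val e = (\<Sum>f | f \<in> K \<and> e \<in> bd f. \<omega> f)"

definition tri :: "'a set \<Rightarrow> bool" where
  "tri e \<longleftrightarrow> (\<exists>f\<in>K. e \<in> bd f \<and> card (bd f) = 3)"

lemma two_facesE:
  assumes "e \<in> E"
  obtains f g where "{f \<in> K. e \<in> bd f} = {f, g}" "f \<noteq> g"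
  using two_faces[OF assms] by (meson card_2_iff)

lemma val_eq:
  assumes "{f \<in> K. e \<in> bd f} = {f, g}" "f \<noteq> g"
  shows "val e = \<omega> f + \<omega> g" "tri e \<longleftrightarrow> card (bd f) = 3 \<or> card (bd g) = 3"
proof -
  show "val e = \<omega> f + \<omega> g" unfolding val_def assms(1) using assms(2) by simp
  have "tri e \<longleftrightarrow> (\<exists>h\<in>{f \<in> K. e \<in> bd f}. card (bd h) = 3)" unfolding tri_def by blast
  then show "tri e \<longleftrightarrow> card (bd f) = 3 \<or> card (bd g) = 3" unfolding assms(1) by simp
qed

text \<open>The worst case is a 3-face next to a face of degree at least 5, with value
  \<open>-5 + 3\<close>.\<close>

lemma val_ge:
  assumes "e \<in> E"
  shows "-2 \<le> val e" "\<not> tri e \<Longrightarrow> 0 \<le> val e"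
proof -
  obtain f g where fg: "{f \<in> K. e \<in> bd f} = {f, g}" "f \<noteq> g" by (rule two_facesE[OF assms])
  then have "f \<in> {f \<in> K. e \<in> bd f}" "g \<in> {f \<in> K. e \<in> bd f}" by simp_all
  then have *: "f \<in> K" "g \<in> K" "e \<in> bd f" "e \<in> bd g" by simp_all
  show "-2 \<le> val e" "\<not> tri e \<Longrightarrow> 0 \<le> val e"
    using val_eq[OF fg] no_pair[OF *(1,2) fg(2) *(3,4)] no_pair[OF *(2,1) fg(2)[symmetric] *(4,3)]
    by (auto simp: \<omega>_def)
qed

definition star :: "'a \<Rightarrow> 'a set set" where
  "star v = {e \<in> E. v \<in> e}"

lemma card_star: "card (star v) = d v" by (simp add: star_def deg_def)
lemma fin_star [simp]: "finite (star v)" using finE by (simp add: star_def)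

text \<open>No edge lies on two 3-faces, so the 3-faces at \<open>v\<close> pair off the edges at \<open>v\<close> that lie on a 3-face.\<close>

lemma even_tri: "even (card {e \<in> star v. tri e})"
proof -
  define T where "T = {f \<in> K. card (bd f) = 3 \<and> v \<in> \<Union>(bd f)}"
  have "{e \<in> star v. tri e} = (\<Union>f\<in>T. {e \<in> bd f. v \<in> e})"
    unfolding T_def star_def tri_def using bd_E by blast
  also have "card \<dots> = (\<Sum>f\<in>T. card {e \<in> bd f. v \<in> e})"
  proof (rule card_UN_disjoint)
    show "finite T" using finite_K by (simp add: T_def)
    show "\<forall>f\<in>T. finite {e \<in> bd f. v \<in> e}" unfolding T_def using bd_E finE finite_subset by fastforce
    show "\<forall>f\<in>T. \<forall>g\<in>T. f \<noteq> g \<longrightarrow> {e \<in> bd f. v \<in> e} \<inter> {e \<in> bd g. v \<in> e} = {}"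
    proof (intro ballI impI, rule ccontr)
      fix f g assume *: "f \<in> T" "g \<in> T" "f \<noteq> g" "{e \<in> bd f. v \<in> e} \<inter> {e \<in> bd g. v \<in> e} \<noteq> {}"
      then obtain e where "e \<in> bd f" "e \<in> bd g" by blast
      then have "5 \<le> card (bd g)" using no_pair[of f g e] * unfolding T_def by blast
      then show False using *(2) unfolding T_def by simp
    qed
  qed
  also have "\<dots> = (\<Sum>f\<in>T. 2)"
  proof (rule sum.cong[OF refl])
    fix f assume "f \<in> T"
    then obtain e where "f \<in> K" "e \<in> bd f" "v \<in> e" unfolding T_def by blast
    then show "card {e \<in> bd f. v \<in> e} = 2" by (rule bd_at)
  qed
  finally show ?thesis by simp
qed

text \<open>Each face at \<open>e0\<close> has a second edge at \<open>v\<close>. That edge lies on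
  a 3-face, and this is a different face, since \<open>e0\<close> lies on no 3-face. Hence both
  faces at \<open>e0\<close> are adjacent to 3-faces and have degree at least 5, which yields
  \<open>3 + 3\<close>.\<close>

lemma val_single:
  assumes "{e \<in> star v. \<not> tri e} = {e0}"
  shows "val e0 = 6"
proof -
  have e0: "e0 \<in> E" "v \<in> e0" "\<not> tri e0" using assms unfolding star_def by blast+
  obtain f g where fg: "{f \<in> K. e0 \<in> bd f} = {f, g}" "f \<noteq> g" by (rule two_facesE[OF e0(1)])
  have three: "\<omega> h = 3" if h: "h \<in> {f, g}" for h
  proof -
    have "h \<in> {f \<in> K. e0 \<in> bd f}" using h unfolding fg(1) .
    then have hK: "h \<in> K" "e0 \<in> bd h" by simp_all
    have "card {e \<in> bd h. v \<in> e} = 2" by (rule bd_at[OF hK e0(2)])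
    then have "\<not> {e \<in> bd h. v \<in> e} \<subseteq> {e0}" using card_mono[of "{e0}" "{e \<in> bd h. v \<in> e}"] by auto
    then obtain e where e: "e \<in> bd h" "v \<in> e" "e \<noteq> e0" by blast
    have "e \<in> star v" using e bd_E[OF hK(1)] unfolding star_def by blast
    then have "tri e" using assms e(3) by blast
    then obtain t where t: "t \<in> K" "e \<in> bd t" "card (bd t) = 3" unfolding tri_def by blast
    have "t \<noteq> h" using e0(3) hK t(3) unfolding tri_def by blast
    then have "5 \<le> card (bd h)" using no_pair[OF t(1) hK(1) _ t(2) e(1) t(3)] by blast
    then show ?thesis by (simp add: \<omega>_def)
  qed
  show ?thesis unfolding val_eq(1)[OF fg] using three[of f] three[of g] by simp
qed

definition ch :: "'a \<Rightarrow> int" where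
  "ch v = 30 * (int (d v) - 4) + (\<Sum>e\<in>star v. val e)"

text \<open>An even number \<open>2 * m\<close> of edges at \<open>v\<close> lies on 3-faces, each
  costing at most 2. For odd degree a single remaining edge returns 6, so the worst cases are
  \<open>m = 0\<close> for degree 3 and \<open>m = 1\<close> for degree 5, with \<open>-30\<close>
  and \<open>30 - 4\<close>.\<close>

lemma ch_ge:
  assumes v: "v \<in> V"
  shows "d v = 2 \<Longrightarrow> -64 \<le> ch v" "d v = 3 \<Longrightarrow> -30 \<le> ch v" "d v = 4 \<Longrightarrow> -8 \<le> ch v" "d v = 5 \<Longrightarrow> 26 \<le> ch v"
proof -
  define T where "T = {e \<in> star v. tri e}"
  define U where "U = {e \<in> star v. \<not> tri e}"
  have TU: "star v = T \<union> U" "T \<inter> U = {}" "finite T" "finite U" unfolding T_def U_def by auto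
  have sum: "(\<Sum>e\<in>star v. val e) = (\<Sum>e\<in>T. val e) + (\<Sum>e\<in>U. val e)"
    unfolding TU(1) by (rule sum.union_disjoint[OF TU(3,4,2)])
  have cd: "d v = card T + card U" using card_star[of v] card_Un_disjoint[OF TU(3,4,2)] TU(1) by simp
  have "(\<Sum>e\<in>T. -2) \<le> (\<Sum>e\<in>T. val e)"
    by (rule sum_mono) (use val_ge(1) in \<open>auto simp: T_def star_def\<close>)
  then have sT: "-2 * int (card T) \<le> (\<Sum>e\<in>T. val e)" by simp
  have sU: "0 \<le> (\<Sum>e\<in>U. val e)"
    by (rule sum_nonneg) (use val_ge(2) in \<open>auto simp: U_def star_def\<close>)
  have sU1: "(\<Sum>e\<in>U. val e) = 6" if U1: "card U = 1"
  proof -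
    obtain e0 where e0: "U = {e0}" using card_1_singletonE[OF U1] .
    then show ?thesis using val_single[of v e0] unfolding U_def by simp
  qed
  obtain m where m: "card T = 2 * m" using even_tri[of v] unfolding T_def by (elim evenE)
  note ch = ch_def[of v] sum
  show "d v = 2 \<Longrightarrow> -64 \<le> ch v" using ch sT sU cd m by simp
  show "d v = 4 \<Longrightarrow> -8 \<le> ch v" using ch sT sU cd m by simp
  show "d v = 3 \<Longrightarrow> -30 \<le> ch v" using ch sT sU sU1 cd m by (cases "m = 0"; cases "m = 1") simp_all
  show "d v = 5 \<Longrightarrow> 26 \<le> ch v" using ch sT sU sU1 cd m by (cases "m = 2") simp_all
qed

lemma total_charge: "(\<Sum>v\<in>V. ch v) < 0"
proof -
  have 1: "(\<Sum>v\<in>V. int (d v)) = 2 * int (card E)"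
  proof -
    have "(\<Sum>v\<in>V. int (d v)) = (\<Sum>v\<in>V. \<Sum>e | e \<in> E \<and> v \<in> e. 1)" by (simp add: deg_def)
    also have "\<dots> = 2 * (\<Sum>e\<in>E. 1)" by (rule sum_at_vertices[OF edge_set])
    finally show ?thesis by simp
  qed
  have bdE: "{e \<in> E. e \<in> bd f} = bd f" if "f \<in> K" for f using bd_E[OF that] by blast
  have 2: "(\<Sum>f\<in>K. int (card (bd f)) * g f) = (\<Sum>e\<in>E. \<Sum>f | f \<in> K \<and> e \<in> bd f. g f)" for g :: "'f \<Rightarrow> int"
  proof -
    have "(\<Sum>f\<in>K. int (card (bd f)) * g f) = (\<Sum>f\<in>K. \<Sum>e | e \<in> E \<and> e \<in> bd f. g f)"
      by (rule sum.cong[OF refl]) (simp add: bdE)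
    also have "\<dots> = (\<Sum>e\<in>E. \<Sum>f | f \<in> K \<and> e \<in> bd f. g f)"
      by (rule sum.swap_restrict[OF finite_K finE])
    finally show ?thesis .
  qed
  have 3: "(\<Sum>f\<in>K. int (card (bd f))) = 2 * int (card E)"
    using 2[of "\<lambda>_. 1"] two_faces by simp
  \<comment> \<open>The factor 15 is half of 30, because the value of an edge is counted at both of
    its ends. Equality holds for faces of degree 3, 4 and 5.\<close>
  have 4: "(\<Sum>e\<in>E. val e) \<le> (\<Sum>f\<in>K. 15 * (int (card (bd f)) - 4))"
    unfolding val_def 2[symmetric]
  proof (rule sum_mono)
    fix f assume "f \<in> K"
    then have "3 \<le> card (bd f)" by (rule bd_3)
    then show "int (card (bd f)) * \<omega> f \<le> 15 * (int (card (bd f)) - 4)" by (auto simp: \<omega>_def)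
  qed
  have "(\<Sum>v\<in>V. ch v) = 30 * (\<Sum>v\<in>V. int (d v) - 4) + (\<Sum>v\<in>V. \<Sum>e\<in>star v. val e)"
    unfolding ch_def by (simp add: sum.distrib sum_distrib_left)
  also have "(\<Sum>v\<in>V. \<Sum>e\<in>star v. val e) = 2 * (\<Sum>e\<in>E. val e)"
    unfolding star_def by (rule sum_at_vertices[OF edge_set])
  finally have 5: "(\<Sum>v\<in>V. ch v) = 30 * (\<Sum>v\<in>V. int (d v) - 4) + 2 * (\<Sum>e\<in>E. val e)" .
  have "(\<Sum>v\<in>V. int (d v) - 4) = 2 * int (card E) - 4 * int (card V)" using 1 by (simp add: sum_subtractf)
  moreover have "(\<Sum>f\<in>K. 15 * (int (card (bd f)) - 4)) = 15 * (2 * int (card E) - 4 * int (card K))"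
    using 3 by (simp add: sum_subtractf sum_distrib_left[symmetric])
  moreover have "int (card K) + int (card V) = int (card E) + 2"
    using arg_cong[OF euler, of int] by simp
  ultimately show ?thesis using 4 5 by simp
qed

text \<open>A vertex of degree 2 receives 32 from each neighbour, although a vertex of degree 5 may own only 26:
  the missing 6 come from three neighbours that have no neighbour of degree 2, see \<open>near2_nbr\<close>.\<close>

definition send :: "'a \<Rightarrow> 'a \<Rightarrow> int" where
  "send u v = (if d v = 2 then 32 else if d v = 3 then 10
    else if d v = 4 then (if d u = 5 then 6 else 0)
    else if d u = 5 \<and> \<not> near2 u \<and> near2 v then 2 else 0) * (if 4 \<le> d u \<and> (d u = 5 \<or> d v = 3) then 1 else 0)"

lemma transfers_cancel: "(\<Sum>v\<in>V. \<Sum>u\<in>N v. send u v) = (\<Sum>v\<in>V. \<Sum>u\<in>N v. send v u)"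
proof -
  have N: "N v = {u \<in> V. u \<in> N v}" for v using N_V by blast
  have "(\<Sum>v\<in>V. \<Sum>u\<in>N v. send u v) = (\<Sum>v\<in>V. \<Sum>u | u \<in> V \<and> u \<in> N v. send u v)" using N by simp
  also have "\<dots> = (\<Sum>u\<in>V. \<Sum>v | v \<in> V \<and> u \<in> N v. send u v)" by (rule sum.swap_restrict[OF finV finV])
  also have "\<dots> = (\<Sum>u\<in>V. \<Sum>v\<in>N u. send u v)"
  proof (rule sum.cong[OF refl])
    fix u
    have "v \<in> V \<and> u \<in> N v \<longleftrightarrow> v \<in> N u" for v using N_V[of u v] nbrs_sym[of v E u] by auto
    then show "(\<Sum>v | v \<in> V \<and> u \<in> N v. send u v) = (\<Sum>v\<in>N u. send u v)" by simp
  qed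
  finally show ?thesis .
qed

lemma send_nonneg: "0 \<le> send u v"
  by (simp add: send_def)

text \<open>The amounts in \<open>send\<close> are dictated by \<open>ch_ge\<close>: 32 and 10
  divide the debts 64 and 30 of degrees 2 and 3 evenly among the neighbours. The other balances are
  tight as well: \<open>18 - 8 - 10\<close> at degree 4, \<open>26 + 6 - 32\<close> and
  \<open>26 - 20 - 6\<close> at degree 5.\<close>

lemma final_charge:
  assumes v: "v \<in> V"
  shows "0 \<le> ch v + (\<Sum>u\<in>N v. send u v) - (\<Sum>u\<in>N v. send v u)"
proof -
  have at5: "nd 2 u = 0" if "d u \<noteq> 5" for u using nd2[of u] that by auto
  consider "d v = 2" | "d v = 3" | "d v = 4" | "d v = 5" "near2 v" | "d v = 5" "\<not> near2 v"
    using d_in[OF v] by fastforce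
  then show ?thesis
  proof cases
    case 1
    have "d u = 5" if "u \<in> N v" for u
      using nd2[of u] nd_posI[of v u 2] that nbrs_sym[of u E v] 1 by auto
    then have "(\<Sum>u\<in>N v. send u v) = (\<Sum>u\<in>N v. 32)" by (intro sum.cong) (auto simp: send_def 1)
    moreover have "(\<Sum>u\<in>N v. send v u) = 0" by (rule sum.neutral) (simp add: send_def 1)
    ultimately show ?thesis using ch_ge(1)[OF v 1] d_card[of v] 1 by simp
  next
    case 2
    \<comment> \<open>Besides \<open>v\<close>, of degree 3, such a \<open>u\<close> has at least
      three neighbours of degree 5.\<close>
    have "4 \<le> d u" if u: "u \<in> N v" for u
    proof -
      have "0 < nd 3 u" using nd_posI[of v u 3] u nbrs_sym[of u E v] 2 by auto
      then show ?thesis using nd3[of u] d_split[of u] by linarith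
    qed
    then have "(\<Sum>u\<in>N v. send u v) = (\<Sum>u\<in>N v. 10)" by (intro sum.cong) (auto simp: send_def 2)
    moreover have "(\<Sum>u\<in>N v. send v u) = 0" by (rule sum.neutral) (simp add: send_def 2)
    ultimately show ?thesis using ch_ge(2)[OF v 2] d_card[of v] 2 by simp
  next
    case 3
    have n: "4 = nd 3 v + nd 4 v + nd 5 v" "nd 2 v = 0" using d_split[of v] at5[of v] 3 by auto
    have "(\<Sum>u\<in>N v. send u v) = (\<Sum>u\<in>N v. (\<lambda>k. if k = 5 then 6 else 0) (d u))"
      by (intro sum.cong) (auto simp: send_def 3)
    also have "\<dots> = 6 * int (nd 5 v)" using sum_nbrs[of "\<lambda>k. if k = 5 then 6 else 0" v] by simp
    finally have inn: "(\<Sum>u\<in>N v. send u v) = 6 * int (nd 5 v)" .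
    have "(\<Sum>u\<in>N v. send v u) = (\<Sum>u\<in>N v. (\<lambda>k. if k = 3 then 10 else 0) (d u))"
      by (intro sum.cong) (auto simp: send_def 3)
    also have "\<dots> = 10 * int (nd 3 v)" using sum_nbrs[of "\<lambda>k. if k = 3 then 10 else 0" v] by simp
    finally have out: "(\<Sum>u\<in>N v. send v u) = 10 * int (nd 3 v)" .
    \<comment> \<open>A neighbour of degree 3 forces three of degree 5 and is then the only one;
      otherwise at least two neighbours have degree 5.\<close>
    have "8 + 10 * nd 3 v \<le> 6 * nd 5 v"
      using n nd3[of v] nd4[of v] by (cases "nd 3 v = 0"; cases "nd 4 v = 0") simp_all
    then show ?thesis using ch_ge(3)[OF v 3] inn out by linarith
  next
    case 4
    have n: "nd 2 v = 1" "nd 3 v = 0" "nd 4 v = 0" "nd 5 v = 4" using nd2 4(2) unfolding near2_def by auto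
    have "(\<Sum>u\<in>N v. send v u) \<le> (\<Sum>u\<in>N v. (\<lambda>k. if k = 2 then 32 else if k = 3 then 10 else if k = 4 then 6 else 0) (d u))"
      by (intro sum_mono) (auto simp: send_def 4)
    also have "\<dots> = 32"
      using sum_nbrs[of "\<lambda>k. if k = 2 then 32 else if k = 3 then 10 else if k = 4 then 6 else 0" v] n by simp
    finally have out: "(\<Sum>u\<in>N v. send v u) \<le> 32" .
    obtain x where x: "x \<in> N v" "d x = 2" using nd_pos[of 2 v] n by auto
    \<comment> \<open>The neighbours of \<open>v\<close> apart from \<open>x\<close> and from the
      second neighbour of \<open>x\<close>. By \<open>near2_nbr\<close> none of these has a
      neighbour of degree 2, so each can afford to send 2.\<close>
    define M where "M = (N v - {x}) - (N x - {v})"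
    have vx: "v \<in> N x" using x(1) nbrs_sym[of x E v] by simp
    have "card (N x - {v}) = 1" using vx x(2) d_card[of x] by simp
    moreover have "card (N v - {x}) = 4" using x(1) 4(1) d_card[of v] by simp
    ultimately have M3: "3 \<le> card M" unfolding M_def using diff_card_le_card_Diff[of "N x - {v}" "N v - {x}"] by simp
    have two: "2 \<le> send u v" if u: "u \<in> M" for u
    proof -
      have "u \<in> N v" "u \<noteq> x" "u \<noteq> v" "u \<notin> N x" using u N_irrefl unfolding M_def by auto
      then have "\<not> near2 u" using near2_nbr[OF x] by metis
      moreover have "d u = 5"
      proof -
        have "d u \<noteq> 2" using unique_divalent_nbr[OF x(1) \<open>u \<in> N v\<close> x(2)] \<open>u \<noteq> x\<close> by metis
        moreover have "d u \<noteq> 3" "d u \<noteq> 4"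
          using nd_posI[OF \<open>u \<in> N v\<close>, of 3] nd_posI[OF \<open>u \<in> N v\<close>, of 4] n by auto
        ultimately show ?thesis using d_in[of u] N_V[OF \<open>u \<in> N v\<close>] by simp
      qed
      ultimately show ?thesis using 4 by (simp add: send_def)
    qed
    have "(\<Sum>u\<in>M. 2) \<le> (\<Sum>u\<in>M. send u v)" by (rule sum_mono) (rule two)
    also have "\<dots> \<le> (\<Sum>u\<in>N v. send u v)" by (rule sum_mono2) (auto simp: M_def send_nonneg)
    finally have "6 \<le> (\<Sum>u\<in>N v. send u v)" using M3 by simp
    then show ?thesis using ch_ge(4)[OF v 4(1)] out by linarith
  next
    case 5
    have n2: "nd 2 v = 0" using 5(2) unfolding near2_def by simp
    have n: "5 = nd 3 v + nd 4 v + nd 5 v" using d_split[of v] n2 5 by auto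
    have "(\<Sum>u\<in>N v. send v u) \<le> (\<Sum>u\<in>N v. (\<lambda>k. if k = 2 then 32 else if k = 3 then 10 else if k = 4 then 6 else 2) (d u))"
      by (intro sum_mono) (auto simp: send_def 5)
    also have "\<dots> = 10 * int (nd 3 v) + 6 * int (nd 4 v) + 2 * int (nd 5 v)"
      using sum_nbrs[of "\<lambda>k. if k = 2 then 32 else if k = 3 then 10 else if k = 4 then 6 else 2" v] n2 by simp
    finally have out: "(\<Sum>u\<in>N v. send v u) \<le> 10 * int (nd 3 v) + 6 * int (nd 4 v) + 2 * int (nd 5 v)" .
    \<comment> \<open>The maximum is reached by two neighbours of degree 3 and three of degree 5; a
      neighbour of degree 3 always comes with three of degree 5, one of degree 4 with two.\<close>
    have "10 * nd 3 v + 6 * nd 4 v + 2 * nd 5 v \<le> 26"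
      using n nd3[of v] nd4[of v] by (cases "nd 3 v = 0"; cases "nd 4 v = 0") simp_all
    moreover have "0 \<le> (\<Sum>u\<in>N v. send u v)" by (rule sum_nonneg) (rule send_nonneg)
    ultimately show ?thesis using ch_ge(4)[OF v 5(1)] out by linarith
  qed
qed

theorem contradiction: False
proof -
  have "0 \<le> (\<Sum>v\<in>V. ch v + (\<Sum>u\<in>N v. send u v) - (\<Sum>u\<in>N v. send v u))"
    by (rule sum_nonneg) (rule final_charge)
  also have "\<dots> = (\<Sum>v\<in>V. ch v)" using transfers_cancel by (simp add: sum.distrib sum_subtractf)
  finally show False using total_charge by simp
qed

end

section \<open>From the plane graph to the discharging argument\<close>

context plane
begin

lemma face_boundary:
  assumes wd: "well_drawn E" and f: "f \<in> components (- Dr E)"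
  obtains C where "distinct C" "3 \<le> length C" "frontier f = Dr (circuit_edges C)"
    "circuit_edges C = {e \<in> E. path_image (curve S e) \<subseteq> frontier f}" "circuit_edges C \<subseteq> E"
proof -
  have "face_circuit E f" using wd f unfolding well_drawn_def by simp
  then obtain C where C: "distinct C" "3 \<le> length C" "circuit_edges C \<subseteq> E" "frontier f = Dr (circuit_edges C)"
    unfolding face_circuit_def by (elim exE conjE)
  have "circuit_edges C = {e \<in> E. path_image (curve S e) \<subseteq> frontier f}"
    unfolding C(4) using curve_subset_Dr[OF _ C(3)] C(3) by auto
  then show thesis by (rule that[OF C(1,2,4) _ C(3)])
qed

end

theorem theorem1p3:
  fixes G :: "'a graph" and S :: "'a embedding"
  assumes "plane_graph G S"
    and "critical 5 G"
  shows "\<exists>f g. k_face G S 3 f \<and> (k_face G S 3 g \<or> k_face G S 4 g) \<and> adjacent_faces G S f g"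
proof (rule ccontr)
  assume none: "\<not> ?thesis"
  interpret plane G S by unfold_locales (rule assms(1))
  have crit: "critical_edges 5 E" and V: "verts G = \<Union>E" and ne: "E \<noteq> {}"
    using critical_critical_edges[OF assms(2)] by simp_all
  have conn: "no_cutvertex E"
    unfolding no_cutvertex_def using critical_no_cutvertex[OF crit] by simp
  obtain e where e: "e \<in> E" using ne by auto
  then obtain u p where up: "{u, p} \<in> E" using edges_simple(3) by (metis card_2_iff)
  \<comment> \<open>The adjacency lemma supplies a second neighbour of \<open>u\<close>, and with it
    a first circuit.\<close>
  have "{v. {u, v} \<in> E \<and> v \<noteq> p \<and> deg E v = 5} \<noteq> {}"
    using vizing_adjacency[OF crit up] by (metis card.empty not_less_zero)
  then obtain q where "{u, q} \<in> E" "p \<noteq> q" by auto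
  then have wd: "well_drawn E" using well_drawn_E[OF conn up] by simp
  define K where "K = components (- Dr E)"
  \<comment> \<open>Defined through the frontier instead of a chosen circuit, so that different
    faces are adjacent as soon as their \<open>bd\<close> share an edge.\<close>
  define bd where "bd f = {e \<in> E. path_image (curve S e) \<subseteq> frontier f}" for f
  have faces: "faces G S = K" unfolding faces_def K_def drawing_Dr[OF V] ..
  have boundary: "\<exists>C. distinct C \<and> 3 \<le> length C \<and> circuit_edges C = bd f \<and> card (bd f) = length C \<and> k_face G S (card (bd f)) f"
    if f: "f \<in> K" for f
  proof -
    obtain C where C: "distinct C" "3 \<le> length C" "frontier f = Dr (circuit_edges C)"
      "circuit_edges C = bd f" "circuit_edges C \<subseteq> E"
      by (rule face_boundary[OF wd f[unfolded K_def], folded bd_def])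
    have len: "card (bd f) = length C" using card_circuit_edges[OF C(1,2)] C(4) by simp
    have "facial_circuit G S f C" unfolding facial_circuit_def circuit_def using C by (simp add: Dr_def)
    then have "k_face G S (card (bd f)) f" unfolding k_face_def faces len using f by auto
    then show ?thesis using C(1,2,4) len by (intro exI[of _ C] conjI)
  qed
  have "discharging E K bd"
  proof
    show "critical_edges 5 E" by (rule crit)
    show "finite K" "card K + card (\<Union>E) = card E + 2" using wd unfolding well_drawn_def K_def by simp_all
    show "bd f \<subseteq> E" for f unfolding bd_def by (rule Collect_restrict)
    show "3 \<le> card (bd f)" if "f \<in> K" for f using boundary[OF that] by auto
    show "card {e \<in> bd f. v \<in> e} = 2" if f: "f \<in> K" and e: "e \<in> bd f" "v \<in> e" for f e v
    proof -
      obtain C where C: "distinct C" "3 \<le> length C" "circuit_edges C = bd f" using boundary[OF f] by auto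
      have "v \<in> \<Union>(circuit_edges C)" using e C(3) by auto
      then have "v \<in> set C" using Union_circuit_edges[OF C(2)] by simp
      from circuit_edges_at_vertex[OF this C(1,2)] show ?thesis unfolding C(3) .
    qed
    show "card {f \<in> K. e \<in> bd f} = 2" if e: "e \<in> E" for e
    proof -
      have "{f \<in> K. e \<in> bd f} = faces_at E e" unfolding faces_at_def K_def bd_def using e by simp
      then show ?thesis using wd e unfolding well_drawn_def by simp
    qed
    show "5 \<le> card (bd g)"
      if fg: "f \<in> K" "g \<in> K" "f \<noteq> g" and e: "e \<in> bd f" "e \<in> bd g" and 3: "card (bd f) = 3" for f g e
    proof (rule ccontr)
      assume "\<not> 5 \<le> card (bd g)"
      moreover have "3 \<le> card (bd g)" "k_face G S (card (bd g)) g" using boundary[OF fg(2)] by auto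
      moreover have "card (bd g) = 3 \<or> card (bd g) = 4" using calculation(1,2) by auto
      ultimately have "k_face G S 3 g \<or> k_face G S 4 g" by metis
      moreover have "k_face G S 3 f" using boundary[OF fg(1)] 3 by auto
      moreover have "adjacent_faces G S f g"
        unfolding adjacent_faces_def faces using fg e by (auto simp: bd_def)
      ultimately show False using none by metis
    qed
  qed
  then show False by (rule discharging.contradiction)
qed

end
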